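(* Let $r,m\in\mathbb Z_{\ge0}$ with $r+k\ge m+1$. For $x,y\in V_b^{\mathrm{symp}}$ one has $$x\sim_{b,m,r+1}y\ \Longrightarrow\ x\sim_{b,m,r}y,$$ and the same statement holds for $\dot\sim_{b,m,r}$ (for $x,y\in V_b^{\mathrm{symp}}$ with $\sigma(\alpha_x)/\alpha_x\equiv\sigma(\alpha_y)/\alpha_y\equiv1\bmod\mathfrak p^{m+1}$). Consequently, via the bijections induced by $g_{b,r+1}$ and $g_{b,r}$ recalled in the context, there are maps of sets $$X^m_{w_{r+1}}(b)(\overline{\mathbb F}_q)\to X^m_{w_r}(b)(\overline{\mathbb F}_q),\qquad \dot X^m_{w_{r+1}}(b)(\overline{\mathbb F}_q)\to\dot X^m_{w_r}(b)(\overline{\mathbb F}_q).$$ Moreover there is an isomorphism of sets $$\Bigl(\varprojlim_{r>m}\dot X^m_{w_r}(b)\Bigr)(\overline{\mathbb F}_q)\;\simeq\;X_w^{(U)}(b).$$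
   Context: Setting. $K$ is a non-archimedean local field with residue field $\mathbb F_q$ and uniformizer $\varpi$; $\breve K$ is the completion of its maximal unramified extension, with ring of integers $\mathcal O$, maximal ideal $\mathfrak p$, residue field $\overline{\mathbb F}_q$; $\sigma$ is the Frobenius of $\breve K/K$. Let $n\ge1$, $V=\breve K^{2n}$ with standard basis $e_1,\dots,e_{2n}$ and symplectic form $\langle x,y\rangle={}^tx\,\Omega\,y$, where $\Omega$ is the antidiagonal $2n\times2n$ matrix with all antidiagonal entries $1$, multiplied on the right by $\mathrm{diag}(1,-1,\dots,1,-1)$. $G=\mathrm{GSp}_{2n}$ is its similitude group over $K$, $\lambda$ the similitude character. Fix $k\in\{0,1\}$ and a representative $b\in G(K)$, with $\lambda(b)=-\varpi^k$, of a basic $\sigma$-conjugacy class of $G(\breve K)$. Put $F=b\sigma$ and $V_k=\varpi^kF^{-1}$. $V_b^{\mathrm{symp}}:=\{v\in V\mid\langle v,F^i(v)\rangle=0\ (1\le i\le n-1),\ \langle v,F^n(v)\rangle\ne0\}$; $\alpha_v:=\langle v,F^n(v)\rangle$. Set $G_1(v):=(-1)^{n+1}\frac{\alpha_v}{\sigma^{-1}(\alpha_v)}\bigl(V_k(v)-\frac{\langle V_k(v),F^n(v)\rangle}{\alpha_v}v\bigr)$, $G_{i+1}(v):=\frac{\alpha_v}{\sigma^{-1}(\alpha_v)}\bigl(V_k(G_i(v))-\frac{\langle V_k(G_i(v)),F^n(v)\rangle}{\alpha_v}v\bigr)$ for $1\le i\le n-2$, and let $g_{b,r}(v)\in G(\breve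 K)$ be the matrix with columns $(v,\varpi^rF(v),\dots,\varpi^{(n-1)r}F^{n-1}(v),\varpi^rG_1(v),\dots,\varpi^{(n-1)r}G_{n-1}(v),\varpi^{nr}F^n(v))$. $w_r\in G(\breve K)$ is given by $w_re_i=\varpi^{-r}e_{i+1}$ $(1\le i\le n-1)$, $w_re_n=\varpi^{-r}e_{2n}$, $w_re_{n+1}=(-1)^{n+1}\varpi^{r+k}e_1$, $w_re_{n+i}=\varpi^{r+k}e_{n+i-1}$ $(2\le i\le n)$; $w=w_0$. $U$ is the group of upper triangular unipotent matrices in $G$, and $X_w^{(U)}(b)=\{g\in G(\breve K)/U(\breve K)\mid g^{-1}b\sigma(g)\in U(\breve K)wU(\breve K)\}$. $I^m\subset G(\breve K)$ (resp. $\dot I^m$) is the subgroup of matrices in $G(\breve K)$ with diagonal entries in $\mathcal O^\times$ (resp. $1+\mathfrak p^{m+1}$), entries strictly above the diagonal in $\mathfrak p^{m+1}$ and strictly below in $\mathfrak p^m$. $X^m_{w_r}(b)(\overline{\mathbb F}_q)=\{gI^m\in G(\breve K)/I^m\mid g^{-1}b\sigma(g)\in I^mw_rI^m\}$ and $\dot X^m_{w_r}(b)(\overline{\mathbb F}_q)=\{g\dot I^m\in G(\breve K)/\dot I^m\mid g^{-1}b\sigma(g)\in\dot I^mw_r\dot I^m\}$. For $x,y\in V_b^{\mathrm{symp}}$, $x\sim_{b,m,r}y$ means $g_{b,r}(x)I^m=g_{b,r}(y)I^m$, and $x\,\dot\sim_{b,m,r}\,y$ means $g_{b,r}(x)\dot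 I^m=g_{b,r}(y)\dot I^m$. It is known that for $r+k\ge m+1$ the map $g_{b,r}$ induces bijections $V_b^{\mathrm{symp}}/\!\sim_{b,m,r}\;\to X^m_{w_r}(b)(\overline{\mathbb F}_q)$ and $\{v\in V_b^{\mathrm{symp}}\mid\sigma(\alpha_v)/\alpha_v\equiv1\bmod\mathfrak p^{m+1}\}/\dot\sim_{b,m,r}\;\to\dot X^m_{w_r}(b)(\overline{\mathbb F}_q)$. The inverse limit is over pairs $(r,m)$ with $r>m\ge 0$; the transition maps in $r$ are those of the claim, and in $m$ they are the natural ones coming from $\dot I^{m+1}\subset\dot I^m$. *)

theory Defs
  imports
    "HOL-Algebra.Algebraic_Closure_Type"
    "HOL-Algebra.Coset"
    "HOL-Library.FuncSet"
    "Jordan_Normal_Form.Matrix"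
begin

section \<open>Discretely valued fields\<close>

text \<open>
  Valuations are additive, normalised and integer valued; their value at 0 is irrelevant, the
  convention that 0 has infinite valuation being built into \<open>val_ideal\<close>.
\<close>

definition discrete_valuation_on :: "'f::field set \<Rightarrow> ('f \<Rightarrow> int) \<Rightarrow> bool" where
  "discrete_valuation_on E v \<longleftrightarrow>
     (\<forall>x\<in>E - {0}. \<forall>y\<in>E - {0}. v (x * y) = v x + v y) \<and>
     (\<forall>x\<in>E - {0}. \<forall>y\<in>E - {0}. x + y \<noteq> 0 \<longrightarrow> min (v x) (v y) \<le> v (x + y)) \<and>
     v ` (E - {0}) = UNIV"

definition val_ideal :: "('f::field \<Rightarrow> int) \<Rightarrow> int \<Rightarrow> 'f set" where
  "val_ideal v N = {x. x = 0 \<or> N \<le> v x}"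

abbreviation val_ring :: "('f::field \<Rightarrow> int) \<Rightarrow> 'f set" where
  "val_ring v \<equiv> val_ideal v 0"

definition val_units :: "('f::field \<Rightarrow> int) \<Rightarrow> 'f set" where
  "val_units v = {x. x \<noteq> 0 \<and> v x = 0}"

definition residue_classes :: "('f::field \<Rightarrow> int) \<Rightarrow> 'f set set" where
  "residue_classes v = (\<lambda>x. {y. y - x \<in> val_ideal v 1}) ` val_ring v"

definition val_complete :: "('f::field \<Rightarrow> int) \<Rightarrow> bool" where
  "val_complete v \<longleftrightarrow>
     (\<forall>s :: nat \<Rightarrow> 'f.
        (\<forall>N. \<exists>M. \<forall>i\<ge>M. \<forall>j\<ge>M. s i - s j \<in> val_ideal v N) \<longrightarrow>
        (\<exists>l. \<forall>N. \<exists>M. \<forall>i\<ge>M. s i - l \<in> val_ideal v N))"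

definition local_field :: "('k::field \<Rightarrow> int) \<Rightarrow> bool" where
  "local_field v \<longleftrightarrow>
     discrete_valuation_on UNIV v \<and> val_complete v \<and> finite (residue_classes v)"


section \<open>The completed maximal unramified extension and its Frobenius\<close>

text \<open>
  A finite subextension of the algebraic closure is unramified iff the normalised valuation of
  the base field extends to a valuation with the same value group; separability of the residue
  extension is automatic, the residue field being finite.
\<close>

definition finite_unramified :: "('k::field \<Rightarrow> int) \<Rightarrow> 'k alg_closure set \<Rightarrow> bool" where
  "finite_unramified v E \<longleftrightarrow>
     range to_ac \<subseteq> E \<and>
     (\<forall>x\<in>E. \<forall>y\<in>E. x - y \<in> E \<and> x * y \<in> E) \<and> (\<forall>x\<in>E. inverse x \<in> E) \<and>
     (\<exists>B. finite B \<and> E = {\<Sum>\<beta>\<in>B. to_ac (c \<beta>) * \<beta> | c. True}) \<and>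
     (\<exists>w. discrete_valuation_on E w \<and> (\<forall>x. x \<noteq> 0 \<longrightarrow> w (to_ac x) = v x))"

definition max_unramified :: "('k::field \<Rightarrow> int) \<Rightarrow> 'k alg_closure set" where
  "max_unramified v = \<Union> {E. finite_unramified v E}"

text \<open>
  The map \<open>\<iota>\<close>, relevant only on \<open>max_unramified vK\<close>, exhibits the type \<open>'a\<close> with its
  valuation \<open>vL\<close> as the completion of \<open>max_unramified vK\<close>.
\<close>

definition completed_max_unramified ::
  "('k::field \<Rightarrow> int) \<Rightarrow> ('a::field \<Rightarrow> int) \<Rightarrow> ('k alg_closure \<Rightarrow> 'a) \<Rightarrow> bool" where
  "completed_max_unramified vK vL \<iota> \<longleftrightarrow>
     discrete_valuation_on UNIV vL \<and> val_complete vL \<and>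
     \<iota> 1 = 1 \<and>
     (\<forall>x\<in>max_unramified vK. \<forall>y\<in>max_unramified vK.
        \<iota> (x + y) = \<iota> x + \<iota> y \<and> \<iota> (x * y) = \<iota> x * \<iota> y) \<and>
     (\<forall>x. x \<noteq> 0 \<longrightarrow> vL (\<iota> (to_ac x)) = vK x) \<and>
     (\<forall>y N. \<exists>x\<in>max_unramified vK. y - \<iota> x \<in> val_ideal vL N)"

text \<open>
  Invariance of \<open>vL\<close> expresses continuity, without which the automorphism would not be determined
  by its restriction to the maximal unramified extension.
\<close>

definition frobenius ::
  "('k::field \<Rightarrow> int) \<Rightarrow> ('a::field \<Rightarrow> int) \<Rightarrow> ('k alg_closure \<Rightarrow> 'a) \<Rightarrow> ('a \<Rightarrow> 'a) \<Rightarrow> bool" where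
  "frobenius vK vL \<iota> \<sigma> \<longleftrightarrow>
     bij \<sigma> \<and> \<sigma> 1 = 1 \<and> (\<forall>x y. \<sigma> (x + y) = \<sigma> x + \<sigma> y \<and> \<sigma> (x * y) = \<sigma> x * \<sigma> y) \<and>
     (\<forall>x. \<sigma> (\<iota> (to_ac x)) = \<iota> (to_ac x)) \<and>
     (\<forall>x. x \<noteq> 0 \<longrightarrow> vL (\<sigma> x) = vL x) \<and>
     (\<forall>x\<in>val_ring vL. \<sigma> x - x ^ card (residue_classes vK) \<in> val_ideal vL 1)"


section \<open>The symplectic similitude group\<close>

text \<open>
  Row and column indices run from 0 to \<open>2 * n - 1\<close>; hence the basis vector written \<open>e\<^sub>i\<close> on
  paper is \<open>unit_vec (2 * n) (i - 1)\<close>.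
\<close>

definition Omega :: "nat \<Rightarrow> 'f::field mat" where
  "Omega n = mat (2 * n) (2 * n) (\<lambda>(i, j). if i + j = 2 * n - 1 then 1 else 0)
           * mat (2 * n) (2 * n) (\<lambda>(i, j). if i = j then (- 1) ^ j else 0)"

definition sform :: "nat \<Rightarrow> 'f::field vec \<Rightarrow> 'f vec \<Rightarrow> 'f" where
  "sform n x y = x \<bullet> (Omega n *\<^sub>v y)"

definition GSp :: "nat \<Rightarrow> 'f::field mat monoid" where
  "GSp n = \<lparr>carrier = {g \<in> carrier_mat (2 * n) (2 * n).
                         \<exists>c. c \<noteq> 0 \<and> transpose_mat g * Omega n * g = c \<cdot>\<^sub>m Omega n},
            monoid.mult = (*), one = 1\<^sub>m (2 * n)\<rparr>"

definition simil :: "nat \<Rightarrow> 'f::field mat \<Rightarrow> 'f" where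
  "simil n g = (THE c. transpose_mat g * Omega n * g = c \<cdot>\<^sub>m Omega n)"

text \<open>
  The element \<open>b \<sigma>(b) \<dots> \<sigma>\<^sup>s\<^sup>-\<^sup>1(b)\<close>, i.e. the linear part of the \<open>s\<close>-th power of \<open>b\<sigma>\<close>.
\<close>

primrec sigma_norm :: "nat \<Rightarrow> ('a::field \<Rightarrow> 'a) \<Rightarrow> 'a mat \<Rightarrow> nat \<Rightarrow> 'a mat" where
  "sigma_norm n \<sigma> b 0 = 1\<^sub>m (2 * n)"
| "sigma_norm n \<sigma> b (Suc s) = b * map_mat \<sigma> (sigma_norm n \<sigma> b s)"

text \<open>
  Basic means that the slope homomorphism \<open>\<nu>\<close> is central. By Kottwitz's definition of \<open>\<nu>\<close> this
  says \<open>c (b\<sigma>)\<^sup>s c\<^sup>-\<^sup>1 = (s\<nu>)(\<pi>) \<sigma>\<^sup>s\<close> for some \<open>s > 0\<close> and \<open>c\<close>, where \<open>s\<nu>\<close> is a cocharacter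
  \<open>t \<mapsto> t\<^sup>j\<close> of the centre, which consists of the scalar matrices.
\<close>

definition basic :: "nat \<Rightarrow> ('a::field \<Rightarrow> 'a) \<Rightarrow> 'a \<Rightarrow> 'a mat \<Rightarrow> bool" where
  "basic n \<sigma> \<pi> b \<longleftrightarrow>
     (\<exists>s>0. \<exists>j::int. \<exists>c\<in>carrier (GSp n).
        c * sigma_norm n \<sigma> b s * inv\<^bsub>GSp n\<^esub> (map_mat (\<sigma> ^^ s) c) = (\<pi> powi j) \<cdot>\<^sub>m 1\<^sub>m (2 * n))"


section \<open>The vectors and matrices attached to \<open>b\<close>\<close>

definition Frob :: "('a::field \<Rightarrow> 'a) \<Rightarrow> 'a mat \<Rightarrow> 'a vec \<Rightarrow> 'a vec" where
  "Frob \<sigma> b x = b *\<^sub>v map_vec \<sigma> x"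

definition Ver :: "nat \<Rightarrow> ('a::field \<Rightarrow> 'a) \<Rightarrow> 'a \<Rightarrow> nat \<Rightarrow> 'a mat \<Rightarrow> 'a vec \<Rightarrow> 'a vec" where
  "Ver n \<sigma> \<pi> k b x = \<pi> ^ k \<cdot>\<^sub>v the_inv_into (carrier_vec (2 * n)) (Frob \<sigma> b) x"

definition alpha :: "nat \<Rightarrow> ('a::field \<Rightarrow> 'a) \<Rightarrow> 'a mat \<Rightarrow> 'a vec \<Rightarrow> 'a" where
  "alpha n \<sigma> b v = sform n v ((Frob \<sigma> b ^^ n) v)"

definition Vsymp :: "nat \<Rightarrow> ('a::field \<Rightarrow> 'a) \<Rightarrow> 'a mat \<Rightarrow> 'a vec set" where
  "Vsymp n \<sigma> b = {v \<in> carrier_vec (2 * n).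
     (\<forall>i\<in>{1..<n}. sform n v ((Frob \<sigma> b ^^ i) v) = 0) \<and> sform n v ((Frob \<sigma> b ^^ n) v) \<noteq> 0}"

definition Vsymp_dot ::
  "nat \<Rightarrow> ('a::field \<Rightarrow> int) \<Rightarrow> ('a \<Rightarrow> 'a) \<Rightarrow> 'a mat \<Rightarrow> nat \<Rightarrow> 'a vec set" where
  "Vsymp_dot n v \<sigma> b m = {x \<in> Vsymp n \<sigma> b.
     \<sigma> (alpha n \<sigma> b x) / alpha n \<sigma> b x - 1 \<in> val_ideal v (int m + 1)}"

definition Gstep ::
  "nat \<Rightarrow> ('a::field \<Rightarrow> 'a) \<Rightarrow> 'a \<Rightarrow> nat \<Rightarrow> 'a mat \<Rightarrow> 'a vec \<Rightarrow> 'a vec \<Rightarrow> 'a vec" where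
  "Gstep n \<sigma> \<pi> k b v x =
     (alpha n \<sigma> b v / inv_into UNIV \<sigma> (alpha n \<sigma> b v)) \<cdot>\<^sub>v
       (Ver n \<sigma> \<pi> k b x
        - (sform n (Ver n \<sigma> \<pi> k b x) ((Frob \<sigma> b ^^ n) v) / alpha n \<sigma> b v) \<cdot>\<^sub>v v)"

text \<open>Only indices \<open>i \<ge> 1\<close> are meaningful.\<close>

primrec Gvec ::
  "nat \<Rightarrow> ('a::field \<Rightarrow> 'a) \<Rightarrow> 'a \<Rightarrow> nat \<Rightarrow> 'a mat \<Rightarrow> 'a vec \<Rightarrow> nat \<Rightarrow> 'a vec" where
  "Gvec n \<sigma> \<pi> k b v 0 = 0\<^sub>v (2 * n)"
| "Gvec n \<sigma> \<pi> k b v (Suc i) =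
     (if i = 0 then (- 1) ^ (n + 1) \<cdot>\<^sub>v Gstep n \<sigma> \<pi> k b v v
      else Gstep n \<sigma> \<pi> k b v (Gvec n \<sigma> \<pi> k b v i))"

definition gmat ::
  "nat \<Rightarrow> ('a::field \<Rightarrow> 'a) \<Rightarrow> 'a \<Rightarrow> nat \<Rightarrow> 'a mat \<Rightarrow> nat \<Rightarrow> 'a vec \<Rightarrow> 'a mat" where
  "gmat n \<sigma> \<pi> k b r v = mat_of_cols (2 * n)
     (map (\<lambda>i. \<pi> ^ (i * r) \<cdot>\<^sub>v (Frob \<sigma> b ^^ i) v) [0..<n]
      @ map (\<lambda>i. \<pi> ^ (i * r) \<cdot>\<^sub>v Gvec n \<sigma> \<pi> k b v i) [1..<n]
      @ [\<pi> ^ (n * r) \<cdot>\<^sub>v (Frob \<sigma> b ^^ n) v])"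

definition wmat :: "nat \<Rightarrow> 'a::field \<Rightarrow> nat \<Rightarrow> nat \<Rightarrow> 'a mat" where
  "wmat n \<pi> k r = mat_of_cols (2 * n)
     (map (\<lambda>i. inverse (\<pi> ^ r) \<cdot>\<^sub>v unit_vec (2 * n) i) [1..<n]
      @ [inverse (\<pi> ^ r) \<cdot>\<^sub>v unit_vec (2 * n) (2 * n - 1)]
      @ [((- 1) ^ (n + 1) * \<pi> ^ (r + k)) \<cdot>\<^sub>v unit_vec (2 * n) 0]
      @ map (\<lambda>i. \<pi> ^ (r + k) \<cdot>\<^sub>v unit_vec (2 * n) (n + i - 2)) [2..<n + 1])"


section \<open>Deligne--Lusztig sets\<close>

definition Unip :: "nat \<Rightarrow> 'a::field mat set" where
  "Unip n = {g \<in> carrier (GSp n). \<forall>i<2 * n. \<forall>j<2 * n.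
     (i = j \<longrightarrow> g $$ (i, j) = 1) \<and> (j < i \<longrightarrow> g $$ (i, j) = 0)}"

definition Iw :: "nat \<Rightarrow> ('a::field \<Rightarrow> int) \<Rightarrow> nat \<Rightarrow> 'a mat set" where
  "Iw n v m = {g \<in> carrier (GSp n). \<forall>i<2 * n. \<forall>j<2 * n.
     (i = j \<longrightarrow> g $$ (i, j) \<in> val_units v) \<and>
     (i < j \<longrightarrow> g $$ (i, j) \<in> val_ideal v (int m + 1)) \<and>
     (j < i \<longrightarrow> g $$ (i, j) \<in> val_ideal v (int m))}"

definition Iw_dot :: "nat \<Rightarrow> ('a::field \<Rightarrow> int) \<Rightarrow> nat \<Rightarrow> 'a mat set" where
  "Iw_dot n v m = {g \<in> carrier (GSp n). \<forall>i<2 * n. \<forall>j<2 * n.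
     (i = j \<longrightarrow> g $$ (i, j) - 1 \<in> val_ideal v (int m + 1)) \<and>
     (i < j \<longrightarrow> g $$ (i, j) \<in> val_ideal v (int m + 1)) \<and>
     (j < i \<longrightarrow> g $$ (i, j) \<in> val_ideal v (int m))}"

text \<open>\<open>DL n \<sigma> b H w\<close> is the set of \<open>gH \<in> G/H\<close> with \<open>g\<^sup>-\<^sup>1 b \<sigma>(g) \<in> HwH\<close>.\<close>

definition DL :: "nat \<Rightarrow> ('a::field \<Rightarrow> 'a) \<Rightarrow> 'a mat \<Rightarrow> 'a mat set \<Rightarrow> 'a mat \<Rightarrow> 'a mat set set" where
  "DL n \<sigma> b H w = {g <#\<^bsub>GSp n\<^esub> H | g. g \<in> carrier (GSp n) \<and>
     inv\<^bsub>GSp n\<^esub> g * b * map_mat \<sigma> g \<in> H <#>\<^bsub>GSp n\<^esub> {w} <#>\<^bsub>GSp n\<^esub> H}"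

definition XU :: "nat \<Rightarrow> ('a::field \<Rightarrow> 'a) \<Rightarrow> 'a \<Rightarrow> nat \<Rightarrow> 'a mat \<Rightarrow> 'a mat set set" where
  "XU n \<sigma> \<pi> k b = DL n \<sigma> b (Unip n) (wmat n \<pi> k 0)"

definition Xset ::
  "nat \<Rightarrow> ('a::field \<Rightarrow> int) \<Rightarrow> ('a \<Rightarrow> 'a) \<Rightarrow> 'a \<Rightarrow> nat \<Rightarrow> 'a mat \<Rightarrow> nat \<Rightarrow> nat \<Rightarrow> 'a mat set set" where
  "Xset n v \<sigma> \<pi> k b m r = DL n \<sigma> b (Iw n v m) (wmat n \<pi> k r)"

definition Xset_dot ::
  "nat \<Rightarrow> ('a::field \<Rightarrow> int) \<Rightarrow> ('a \<Rightarrow> 'a) \<Rightarrow> 'a \<Rightarrow> nat \<Rightarrow> 'a mat \<Rightarrow> nat \<Rightarrow> nat \<Rightarrow> 'a mat set set" where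
  "Xset_dot n v \<sigma> \<pi> k b m r = DL n \<sigma> b (Iw_dot n v m) (wmat n \<pi> k r)"

definition rel_level ::
  "nat \<Rightarrow> ('a::field \<Rightarrow> int) \<Rightarrow> ('a \<Rightarrow> 'a) \<Rightarrow> 'a \<Rightarrow> nat \<Rightarrow> 'a mat \<Rightarrow> nat \<Rightarrow> nat \<Rightarrow> 'a vec \<Rightarrow> 'a vec \<Rightarrow> bool" where
  "rel_level n v \<sigma> \<pi> k b m r x y \<longleftrightarrow>
     gmat n \<sigma> \<pi> k b r x <#\<^bsub>GSp n\<^esub> Iw n v m = gmat n \<sigma> \<pi> k b r y <#\<^bsub>GSp n\<^esub> Iw n v m"

definition rel_level_dot ::
  "nat \<Rightarrow> ('a::field \<Rightarrow> int) \<Rightarrow> ('a \<Rightarrow> 'a) \<Rightarrow> 'a \<Rightarrow> nat \<Rightarrow> 'a mat \<Rightarrow> nat \<Rightarrow> nat \<Rightarrow> 'a vec \<Rightarrow> 'a vec \<Rightarrow> bool" where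
  "rel_level_dot n v \<sigma> \<pi> k b m r x y \<longleftrightarrow>
     gmat n \<sigma> \<pi> k b r x <#\<^bsub>GSp n\<^esub> Iw_dot n v m = gmat n \<sigma> \<pi> k b r y <#\<^bsub>GSp n\<^esub> Iw_dot n v m"


section \<open>Transition maps and the inverse limit\<close>

text \<open>
  The maps from level \<open>r + 1\<close> to level \<open>r\<close>: choose a representing vector of the coset by means of
  \<open>g\<^bsub>b,r+1\<^esub>\<close> and apply \<open>g\<^bsub>b,r\<^esub>\<close> to it.
\<close>

definition transition ::
  "nat \<Rightarrow> ('a::field \<Rightarrow> int) \<Rightarrow> ('a \<Rightarrow> 'a) \<Rightarrow> 'a \<Rightarrow> nat \<Rightarrow> 'a mat \<Rightarrow> nat \<Rightarrow> nat \<Rightarrow> 'a mat set \<Rightarrow> 'a mat set" where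
  "transition n v \<sigma> \<pi> k b m r C =
     gmat n \<sigma> \<pi> k b r
       (SOME x. x \<in> Vsymp n \<sigma> b \<and> gmat n \<sigma> \<pi> k b (Suc r) x <#\<^bsub>GSp n\<^esub> Iw n v m = C)
     <#\<^bsub>GSp n\<^esub> Iw n v m"

definition transition_dot ::
  "nat \<Rightarrow> ('a::field \<Rightarrow> int) \<Rightarrow> ('a \<Rightarrow> 'a) \<Rightarrow> 'a \<Rightarrow> nat \<Rightarrow> 'a mat \<Rightarrow> nat \<Rightarrow> nat \<Rightarrow> 'a mat set \<Rightarrow> 'a mat set" where
  "transition_dot n v \<sigma> \<pi> k b m r C =
     gmat n \<sigma> \<pi> k b r
       (SOME x. x \<in> Vsymp_dot n v \<sigma> b m \<and> gmat n \<sigma> \<pi> k b (Suc r) x <#\<^bsub>GSp n\<^esub> Iw_dot n v m = C)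
     <#\<^bsub>GSp n\<^esub> Iw_dot n v m"

text \<open>
  Elements of the inverse limit are compatible families indexed by the pairs \<open>(r, m)\<close> with
  \<open>r > m\<close>; compatibility is imposed along the unit steps in \<open>r\<close> and in \<open>m\<close>, which generate the
  order on these pairs. The map in \<open>m\<close> sends a coset \<open>C\<close> of the smaller subgroup to the coset
  \<open>C <#> Iw_dot n v m\<close> containing it.
\<close>

definition Xdot_limit ::
  "nat \<Rightarrow> ('a::field \<Rightarrow> int) \<Rightarrow> ('a \<Rightarrow> 'a) \<Rightarrow> 'a \<Rightarrow> nat \<Rightarrow> 'a mat \<Rightarrow> (nat \<times> nat \<Rightarrow> 'a mat set) set" where
  "Xdot_limit n v \<sigma> \<pi> k b =
     {f \<in> (\<Pi>\<^sub>E (r, m) \<in> {(r, m). m < r}. Xset_dot n v \<sigma> \<pi> k b m r).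
        (\<forall>r m. m < r \<longrightarrow> transition_dot n v \<sigma> \<pi> k b m r (f (Suc r, m)) = f (r, m)) \<and>
        (\<forall>r m. Suc m < r \<longrightarrow> f (r, Suc m) <#>\<^bsub>GSp n\<^esub> Iw_dot n v m = f (r, m))}"

end

(* Fix g with g^-1 b sigma(g) = w_r A, A in one of the groups I^m, its dotted variant, or U. If v in
   V_b^symp is g times a vector having the shape of a first column, then v, pi^r F v, ...,
   pi^r G_1(v), ..., pi^(nr) F^n v are g times vectors having the shape of the respective columns,
   so g_(b,r)(v) and g define the same coset. Conversely g_(b,r)(v) is itself such a g: its matrix A
   is read off from the relation expressing F^(n+1) v, whose coefficients satisfy the Newton polygon
   bound because b is basic. Thus equality of cosets at level r only says that y is g_(b,r)(x) times
   a vector with first coordinate a unit (or = 1 mod p^(m+1), or 1) and the others in p^m (or 0), and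
   passing from r + 1 to r multiplies the coordinates by powers of pi. Every coset contains some
   g_(b,r)(v) because the orthogonality relations can be solved by successive approximation.
   For the limit, representatives of a compatible family form a Cauchy sequence in V; both the
   limit and X_w^(U)(b) are thereby parametrised by the v in V_b^symp with sigma(alpha_v) = alpha_v. *)

theory Submission
  imports Defs "Jordan_Normal_Form.Determinant"
begin

no_notation fps_nth (infixl \<open>$\<close> 75)

section \<open>The symplectic form and its similitude group\<close>

text \<open>The condition r + k >= m + 1 enters twice. In the basis given by the columns of g,
  \<pi>^r F and \<pi>^r V are, apart from A and \<sigma>, permutations of coordinates; those
  crossing from below to above the diagonal pick up \<pi>^(2r+k), of positive valuation. Conversely,
  a basic b is isoclinic of slope k/2, so the coefficient of F^(l+1) v in the relation for F^(n+1) v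
  has valuation at least (n-l)k/2; rescaled by \<pi>^((n-l)r) it has valuation at least r + k/2,
  hence at least r + k by integrality and k in {0, 1}. It is then admissible above the diagonal of
  I^m. The three groups can be treated together because only one feature matters: an entry above the
  diagonal times an entry below it is harmless in every position. For I^m this holds as p^(m+1) p^m
  lies in p^(m+1), for U as entries below the diagonal vanish. In the limit, orthogonality survives
  by continuity, but \<alpha> \<noteq> 0 is not a closed condition. It is recovered from the shape
  of the limit vector: first and last column types pair to an element of D.\<close>

lemma mult_mat_vec_sum:
  fixes A :: "'f::field mat"
  assumes "A \<in> carrier_mat N M" "x \<in> carrier_vec M" "i < N"
  shows "(A *\<^sub>v x) $ i = (\<Sum>l<M. A $$ (i, l) * x $ l)"
  using assms by (auto simp: scalar_prod_def lessThan_atLeast0 intro!: sum.cong)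

lemma Omega_carrier [simp]: "Omega n \<in> carrier_mat (2 * n) (2 * n)"
  unfolding Omega_def by (rule mult_carrier_mat[of _ _ "2 * n"]) auto

lemma Omega_dim [simp]: "dim_row (Omega n) = 2 * n" "dim_col (Omega n) = 2 * n"
  by (simp_all add: Omega_def)

lemma Omega_index:
  assumes "i < 2 * n" "j < 2 * n"
  shows "(Omega n :: 'f::field mat) $$ (i, j) = (if i + j = 2 * n - 1 then (- 1) ^ j else 0)"
proof -
  have "(Omega n :: 'f mat) $$ (i, j)
      = (\<Sum>l\<in>{0..<2 * n}. (if i + l = 2 * n - 1 then 1 else 0) * (if l = j then (- 1) ^ j else 0))"
    unfolding Omega_def using assms by (simp add: scalar_prod_def)
  also have "\<dots> = (\<Sum>l\<in>{0..<2 * n}. if l = j then (if i + j = 2 * n - 1 then (- 1) ^ j else 0) else 0)"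
    by (rule sum.cong) simp_all
  also have "\<dots> = (if i + j = 2 * n - 1 then (- 1) ^ j else 0)"
    using assms by (simp only: sum.delta finite_atLeastLessThan atLeastLessThan_iff) simp
  finally show ?thesis .
qed

lemma Omega_mult_vec_index:
  fixes y :: "'f::field vec"
  assumes "y \<in> carrier_vec (2 * n)" "i < 2 * n"
  shows "(Omega n *\<^sub>v y) $ i = (- 1) ^ Suc i * y $ (2 * n - 1 - i)"
proof -
  have "(Omega n *\<^sub>v y) $ i = (\<Sum>j<2 * n. Omega n $$ (i, j) * y $ j)"
    by (rule mult_mat_vec_sum[OF Omega_carrier assms])
  also have "\<dots> = (\<Sum>j<2 * n. if j = 2 * n - 1 - i then (- 1) ^ j * y $ j else 0)"
    using assms by (intro sum.cong) (auto simp: Omega_index)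
  also have "\<dots> = (- 1) ^ (2 * n - 1 - i) * y $ (2 * n - 1 - i)"
    using assms by simp
  also have "(- 1 :: 'f) ^ (2 * n - 1 - i) = (- 1) ^ Suc i"
    using assms by (auto simp: minus_one_power_iff)
  finally show ?thesis .
qed

lemma sform_sum:
  fixes x y :: "'f::field vec"
  assumes "x \<in> carrier_vec (2 * n)" "y \<in> carrier_vec (2 * n)"
  shows "sform n x y = (\<Sum>i<2 * n. (- 1) ^ Suc i * x $ i * y $ (2 * n - 1 - i))"
proof -
  have "sform n x y = (\<Sum>i<2 * n. x $ i * (Omega n *\<^sub>v y) $ i)"
    using assms unfolding sform_def scalar_prod_def by (auto simp: lessThan_atLeast0)
  also have "\<dots> = (\<Sum>i<2 * n. (- 1) ^ Suc i * x $ i * y $ (2 * n - 1 - i))"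
    using assms by (intro sum.cong refl, subst Omega_mult_vec_index) auto
  finally show ?thesis .
qed

context
  fixes n :: nat and x y z :: "'f::field vec"
  assumes x: "x \<in> carrier_vec (2 * n)" and y: "y \<in> carrier_vec (2 * n)"
    and z: "z \<in> carrier_vec (2 * n)"
begin

lemma sform_add_left: "sform n (x + y) z = sform n x z + sform n y z"
  and sform_minus_left: "sform n (x - y) z = sform n x z - sform n y z"
  and sform_minus_right: "sform n z (x - y) = sform n z x - sform n z y"
proof -
  have p: "x + y \<in> carrier_vec (2 * n)" and m: "x - y \<in> carrier_vec (2 * n)" using x y by auto
  show "sform n (x + y) z = sform n x z + sform n y z"
    unfolding sform_sum[OF p z] sform_sum[OF x z] sform_sum[OF y z] sum.distrib[symmetric]
    using x y by (intro sum.cong) (auto simp: algebra_simps)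
  show "sform n (x - y) z = sform n x z - sform n y z"
    unfolding sform_sum[OF m z] sform_sum[OF x z] sform_sum[OF y z] sum_subtractf[symmetric]
    using x y by (intro sum.cong) (auto simp: algebra_simps)
  show "sform n z (x - y) = sform n z x - sform n z y"
    unfolding sform_sum[OF z m] sform_sum[OF z x] sform_sum[OF z y] sum_subtractf[symmetric]
    using x y by (intro sum.cong) (auto simp: algebra_simps)
qed

end

lemma sform_smult_left: "x \<in> carrier_vec (2 * n) \<Longrightarrow> y \<in> carrier_vec (2 * n) \<Longrightarrow> sform n (c \<cdot>\<^sub>v x) y = c * sform n x y"
  and sform_smult_right: "x \<in> carrier_vec (2 * n) \<Longrightarrow> y \<in> carrier_vec (2 * n) \<Longrightarrow> sform n x (c \<cdot>\<^sub>v y) = c * sform n x y"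
  for x y :: "'f::field vec"
  by (simp_all add: sform_sum sum_distrib_left algebra_simps)

lemma sform_swap:
  fixes x y :: "'f::field vec"
  assumes x: "x \<in> carrier_vec (2 * n)" and y: "y \<in> carrier_vec (2 * n)"
  shows "sform n x y = - sform n y x"
proof -
  have "sform n x y = (\<Sum>i<2 * n. (- 1) ^ Suc i * x $ i * y $ (2 * n - 1 - i))"
    using x y by (rule sform_sum)
  also have "\<dots> = (\<Sum>i<2 * n. - ((- 1) ^ Suc i * y $ i * x $ (2 * n - 1 - i)))"
  \<comment> \<open>The reversal i -> 2n - 1 - i flips parity because 2n - 1 is odd; this is the
    source of the sign.\<close>
  proof (rule sum.reindex_bij_witness[of _ "\<lambda>i. 2 * n - 1 - i" "\<lambda>i. 2 * n - 1 - i"])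
    fix i assume "i \<in> {..<2 * n}"
    then have "(- 1 :: 'f) ^ Suc (2 * n - 1 - i) = - ((- 1) ^ Suc i)" "2 * n - 1 - (2 * n - 1 - i) = i"
      by (auto simp: minus_one_power_iff)
    then show "- ((- 1) ^ Suc (2 * n - 1 - i) * y $ (2 * n - 1 - i) * x $ (2 * n - 1 - (2 * n - 1 - i)))
        = (- 1) ^ Suc i * x $ i * y $ (2 * n - 1 - i)"
      by simp
  qed auto
  also have "\<dots> = - sform n y x"
    using x y by (simp add: sform_sum sum_negf)
  finally show ?thesis .
qed

lemma sform_zero_left [simp]: "x \<in> carrier_vec (2 * n) \<Longrightarrow> sform n (0\<^sub>v (2 * n)) x = 0"
  and sform_zero_right [simp]: "x \<in> carrier_vec (2 * n) \<Longrightarrow> sform n x (0\<^sub>v (2 * n)) = 0"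
  for x :: "'f::field vec"
  by (simp_all add: sform_sum)

lemma sform_unit_left:
  fixes y :: "'f::field vec"
  assumes "y \<in> carrier_vec (2 * n)" "i < 2 * n"
  shows "sform n (unit_vec (2 * n) i) y = (- 1) ^ Suc i * y $ (2 * n - 1 - i)"
proof -
  have "sform n (unit_vec (2 * n) i) y
      = (\<Sum>j<2 * n. if j = i then (- 1) ^ Suc i * y $ (2 * n - 1 - i) else 0)"
    unfolding sform_sum[OF unit_vec_carrier assms(1)]
    by (rule sum.cong) (use assms in \<open>auto simp: unit_vec_def\<close>)
  then show ?thesis using assms by simp
qed

lemma sform_unit_unit:
  assumes "i < 2 * n" "j < 2 * n"
  shows "sform n (unit_vec (2 * n) i) (unit_vec (2 * n) j :: 'f::field vec)
    = (if i + j = 2 * n - 1 then (- 1) ^ j else 0)"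
  unfolding sform_unit_left[OF unit_vec_carrier assms(1)]
  using assms by (auto simp: unit_vec_def minus_one_power_iff)

text \<open>The factor is kept as a parameter, so that products, inverses and base change can be
  computed without the definite description in \<open>simil\<close>.\<close>

definition is_simil :: "nat \<Rightarrow> 'f::field \<Rightarrow> 'f mat \<Rightarrow> bool" where
  "is_simil n c g \<longleftrightarrow> g \<in> carrier_mat (2 * n) (2 * n) \<and> c \<noteq> 0 \<and>
     transpose_mat g * Omega n * g = c \<cdot>\<^sub>m Omega n"

lemma is_simil_carrier: "is_simil n c g \<Longrightarrow> g \<in> carrier_mat (2 * n) (2 * n)"
  and is_simil_nonzero: "is_simil n c g \<Longrightarrow> c \<noteq> 0"
  by (auto simp: is_simil_def)

lemma GSp_iff: "g \<in> carrier (GSp n) \<longleftrightarrow> (\<exists>c. is_simil n c g)"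
  by (auto simp: GSp_def is_simil_def)

lemma GSp_mult [simp]: "x \<otimes>\<^bsub>GSp n\<^esub> y = x * y"
  and GSp_one [simp]: "\<one>\<^bsub>GSp n\<^esub> = 1\<^sub>m (2 * n)"
  by (auto simp: GSp_def)

lemma GSp_carrier_mat: "g \<in> carrier (GSp n) \<Longrightarrow> g \<in> carrier_mat (2 * n) (2 * n)"
  by (auto simp: GSp_def)

lemma sform_mult_mat_vec:
  fixes g :: "'f::field mat"
  assumes g: "g \<in> carrier_mat (2 * n) (2 * n)"
    and x: "x \<in> carrier_vec (2 * n)" and y: "y \<in> carrier_vec (2 * n)"
  shows "sform n (g *\<^sub>v x) (g *\<^sub>v y) = x \<bullet> ((transpose_mat g * Omega n * g) *\<^sub>v y)"
proof -
  have O: "Omega n \<in> carrier_mat (2 * n) (2 * n)" by simp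
  have gy: "g *\<^sub>v y \<in> carrier_vec (2 * n)" and gx: "g *\<^sub>v x \<in> carrier_vec (2 * n)"
    using g x y by auto
  have tg: "transpose_mat g \<in> carrier_mat (2 * n) (2 * n)" using g by simp
  have "(transpose_mat g * Omega n * g) *\<^sub>v y = transpose_mat g *\<^sub>v (Omega n *\<^sub>v (g *\<^sub>v y))"
    using assoc_mult_mat_vec[OF mult_carrier_mat[OF tg O] g y] assoc_mult_mat_vec[OF tg O gy] by simp
  then have "x \<bullet> ((transpose_mat g * Omega n * g) *\<^sub>v y)
      = (transpose_mat g *\<^sub>v (Omega n *\<^sub>v (g *\<^sub>v y))) \<bullet> x"
    using comm_scalar_prod[OF x mult_mat_vec_carrier[OF tg mult_mat_vec_carrier[OF O gy]]] by simp
  also have "\<dots> = (Omega n *\<^sub>v (g *\<^sub>v y)) \<bullet> (g *\<^sub>v x)"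
    using mult_mat_vec_carrier[OF O gy] by (rule transpose_vec_mult_scalar[OF g x])
  also have "\<dots> = sform n (g *\<^sub>v x) (g *\<^sub>v y)"
    unfolding sform_def using mult_mat_vec_carrier[OF O gy] gx by (rule comm_scalar_prod)
  finally show ?thesis ..
qed

lemma sform_simil:
  fixes g :: "'f::field mat"
  assumes "is_simil n c g" "x \<in> carrier_vec (2 * n)" "y \<in> carrier_vec (2 * n)"
  shows "sform n (g *\<^sub>v x) (g *\<^sub>v y) = c * sform n x y"
proof -
  have "sform n (g *\<^sub>v x) (g *\<^sub>v y) = x \<bullet> ((c \<cdot>\<^sub>m Omega n) *\<^sub>v y)"
    using assms by (simp add: sform_mult_mat_vec is_simil_def)
  also have "(c \<cdot>\<^sub>m Omega n) *\<^sub>v y = c \<cdot>\<^sub>v (Omega n *\<^sub>v y)"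
    using assms by (intro eq_vecI) auto
  also have "x \<bullet> \<dots> = c * sform n x y"
    using assms by (simp add: sform_def)
  finally show ?thesis .
qed

lemma mat_mult_unit_vec:
  fixes g :: "'f::field mat"
  assumes "g \<in> carrier_mat N M" "j < M"
  shows "g *\<^sub>v unit_vec M j = col g j"
  using assms by (intro eq_vecI) (auto simp: scalar_prod_right_unit)

text \<open>The matrix g^t Omega g is the Gram matrix of the columns of g, so similitudes can be
  recognised by pairing columns.\<close>

lemma is_similI:
  fixes g :: "'f::field mat"
  assumes g: "g \<in> carrier_mat (2 * n) (2 * n)" and c: "c \<noteq> 0"
    and gram: "\<And>i j. i < 2 * n \<Longrightarrow> j < 2 * n \<Longrightarrow>
      sform n (col g i) (col g j) = c * (if i + j = 2 * n - 1 then (- 1) ^ j else 0)"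
  shows "is_simil n c g"
proof -
  have "transpose_mat g * Omega n * g = c \<cdot>\<^sub>m Omega n" (is "?M = _")
  proof (rule eq_matI)
    fix i j assume "i < dim_row (c \<cdot>\<^sub>m Omega n)" "j < dim_col (c \<cdot>\<^sub>m Omega n)"
    then have i: "i < 2 * n" and j: "j < 2 * n" by auto
    have M: "?M \<in> carrier_mat (2 * n) (2 * n)"
      using g by (intro mult_carrier_mat[of _ _ "2 * n"]) auto
    have "?M $$ (i, j) = (?M *\<^sub>v unit_vec (2 * n) j) $ i"
      unfolding mat_mult_unit_vec[OF M j] using i j M by (auto simp: index_col)
    also have "\<dots> = unit_vec (2 * n) i \<bullet> (?M *\<^sub>v unit_vec (2 * n) j)"
      using i by (subst scalar_prod_left_unit) (use M in auto)
    also have "\<dots> = sform n (g *\<^sub>v unit_vec (2 * n) i) (g *\<^sub>v unit_vec (2 * n) j)"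
      by (rule sform_mult_mat_vec[OF g, symmetric]) auto
    also have "\<dots> = sform n (col g i) (col g j)"
      by (simp add: mat_mult_unit_vec[OF g] i j)
    finally show "?M $$ (i, j) = (c \<cdot>\<^sub>m Omega n) $$ (i, j)"
      using i j gram[OF i j] by (simp add: Omega_index)
  qed (use g in auto)
  with g c show ?thesis by (simp add: is_simil_def)
qed

lemma is_simil_gram:
  fixes g :: "'f::field mat"
  assumes g: "is_simil n c g" and ij: "i < 2 * n" "j < 2 * n"
  shows "sform n (col g i) (col g j) = c * (if i + j = 2 * n - 1 then (- 1) ^ j else 0)"
proof -
  have "sform n (col g i) (col g j) = c * sform n (unit_vec (2 * n) i) (unit_vec (2 * n) j)"
    using sform_simil[OF g, of "unit_vec (2 * n) i" "unit_vec (2 * n) j"] ij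
    by (simp add: mat_mult_unit_vec[OF is_simil_carrier[OF g]])
  also have "sform n (unit_vec (2 * n) i) (unit_vec (2 * n) j :: 'f vec)
      = (if i + j = 2 * n - 1 then (- 1) ^ j else 0)"
    using ij by (rule sform_unit_unit)
  finally show ?thesis .
qed

lemma is_simil_unique:
  fixes g :: "'f::field mat"
  assumes "n \<ge> 1" "is_simil n c g" "is_simil n d g"
  shows "c = d"
  using is_simil_gram[OF assms(2), of 0 "2 * n - 1"] is_simil_gram[OF assms(3), of 0 "2 * n - 1"] assms(1)
  by (simp add: minus_one_power_iff split: if_splits)

lemma is_simil_simil:
  fixes g :: "'f::field mat"
  assumes "n \<ge> 1" "g \<in> carrier (GSp n)"
  shows "is_simil n (simil n g) g"
proof -
  obtain c where c: "is_simil n c g" using assms by (auto simp: GSp_iff)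
  have "simil n g = c" unfolding simil_def
  proof (rule the_equality)
    show "transpose_mat g * Omega n * g = c \<cdot>\<^sub>m Omega n" using c by (simp add: is_simil_def)
    fix d assume "transpose_mat g * Omega n * g = d \<cdot>\<^sub>m Omega n"
    with c have "c \<cdot>\<^sub>m Omega n = d \<cdot>\<^sub>m (Omega n :: 'f mat)" by (simp add: is_simil_def)
    then have "(c \<cdot>\<^sub>m Omega n) $$ (0, 2 * n - 1) = (d \<cdot>\<^sub>m (Omega n :: 'f mat)) $$ (0, 2 * n - 1)" by simp
    then show "d = c" using assms(1) by (simp add: Omega_index minus_one_power_iff split: if_splits)
  qed
  with c show ?thesis by simp
qed

lemma is_simil_mult:
  fixes g h :: "'f::field mat"
  assumes "is_simil n c g" "is_simil n d h"
  shows "is_simil n (c * d) (g * h)"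
proof (rule is_similI)
  have g: "g \<in> carrier_mat (2 * n) (2 * n)" and h: "h \<in> carrier_mat (2 * n) (2 * n)"
    using is_simil_carrier[OF assms(1)] is_simil_carrier[OF assms(2)] by auto
  show "g * h \<in> carrier_mat (2 * n) (2 * n)" using g h by simp
  fix i j assume ij: "i < 2 * n" "j < 2 * n"
  have "col (g * h) l = g *\<^sub>v col h l" if "l < 2 * n" for l
    using g h that by (intro eq_vecI) auto
  then show "sform n (col (g * h) i) (col (g * h) j)
      = c * d * (if i + j = 2 * n - 1 then (- 1) ^ j else 0)"
    using ij h sform_simil[OF assms(1), of "col h i" "col h j"] is_simil_gram[OF assms(2) ij] by simp
qed (use is_simil_nonzero[OF assms(1)] is_simil_nonzero[OF assms(2)] in auto)

lemma is_simil_one: "is_simil n 1 (1\<^sub>m (2 * n))"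
  by (rule is_similI) (auto simp: sform_unit_unit)

text \<open>This is c^-1 Omega^-1 g^t Omega written out: up to signs and the scalar, the reflection
  of g in the antidiagonal. The explicit entries are what later shows that inverses respect the
  shape of the groups.\<close>

definition sinv :: "nat \<Rightarrow> 'f::field \<Rightarrow> 'f mat \<Rightarrow> 'f mat" where
  "sinv n c g = mat (2 * n) (2 * n)
     (\<lambda>(i, j). inverse c * (- 1) ^ (i + j) * g $$ (2 * n - 1 - j, 2 * n - 1 - i))"

lemma sinv_carrier [simp]: "sinv n c g \<in> carrier_mat (2 * n) (2 * n)"
  by (simp add: sinv_def)

lemma sinv_mult_vec_index:
  fixes g :: "'f::field mat"
  assumes g: "g \<in> carrier_mat (2 * n) (2 * n)" and x: "x \<in> carrier_vec (2 * n)" and i: "i < 2 * n"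
  shows "(sinv n c g *\<^sub>v x) $ i = inverse c * (- 1) ^ i * sform n x (col g (2 * n - 1 - i)) * - 1"
proof -
  have "(sinv n c g *\<^sub>v x) $ i = (\<Sum>j<2 * n. sinv n c g $$ (i, j) * x $ j)"
    by (rule mult_mat_vec_sum[OF sinv_carrier x i])
  also have "\<dots> = (\<Sum>j<2 * n. inverse c * (- 1) ^ i * - 1 * ((- 1) ^ Suc j * x $ j * g $$ (2 * n - 1 - j, 2 * n - 1 - i)))"
    using i by (intro sum.cong) (auto simp: sinv_def power_add)
  also have "\<dots> = inverse c * (- 1) ^ i * - 1 * sform n x (col g (2 * n - 1 - i))"
  proof -
    have c: "col g (2 * n - 1 - i) \<in> carrier_vec (2 * n)"
      using g col_dim[of g "2 * n - 1 - i"] by simp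
    show ?thesis unfolding sform_sum[OF x c] sum_distrib_left
      by (rule sum.cong) (use g i in auto)
  qed
  finally show ?thesis by simp
qed

lemma sinv_left:
  fixes g :: "'f::field mat"
  assumes "is_simil n c g"
  shows "sinv n c g * g = 1\<^sub>m (2 * n)"
proof (rule eq_matI)
  have g: "g \<in> carrier_mat (2 * n) (2 * n)" using is_simil_carrier[OF assms] .
  fix i j assume "i < dim_row (1\<^sub>m (2 * n) :: 'f mat)" "j < dim_col (1\<^sub>m (2 * n) :: 'f mat)"
  then have i: "i < 2 * n" and j: "j < 2 * n" by auto
  have "(sinv n c g * g) $$ (i, j) = (sinv n c g *\<^sub>v col g j) $ i"
    using g i j by (auto simp: sinv_def)
  also have "\<dots> = inverse c * (- 1) ^ i * sform n (col g j) (col g (2 * n - 1 - i)) * - 1"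
    using g i j by (simp only: sinv_mult_vec_index[OF g _ i] col_carrier_vec)
  also have "\<dots> = (if i = j then inverse c * c * ((- 1) ^ i * (- 1) ^ (2 * n - 1 - i) * - 1) else 0)"
    using i j by (subst is_simil_gram[OF assms j]) auto
  also have "((- 1) ^ i * (- 1) ^ (2 * n - 1 - i) * - 1 :: 'f) = 1"
    using i by (auto simp: minus_one_power_iff)
  also have "inverse c * c = 1" using is_simil_nonzero[OF assms] by simp
  finally show "(sinv n c g * g) $$ (i, j) = 1\<^sub>m (2 * n) $$ (i, j)" using i j by simp
qed (use is_simil_carrier[OF assms] in \<open>auto simp: sinv_def\<close>)

lemma sinv_right:
  fixes g :: "'f::field mat"
  assumes "is_simil n c g"
  shows "g * sinv n c g = 1\<^sub>m (2 * n)"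
  by (rule mat_mult_left_right_inverse[OF sinv_carrier is_simil_carrier[OF assms] sinv_left[OF assms]])

lemma is_simil_sinv:
  fixes g :: "'f::field mat"
  assumes "is_simil n c g"
  shows "is_simil n (inverse c) (sinv n c g)"
proof (rule is_similI)
  have g: "g \<in> carrier_mat (2 * n) (2 * n)" and c: "c \<noteq> 0"
    using is_simil_carrier[OF assms] is_simil_nonzero[OF assms] by auto
  show "inverse c \<noteq> 0" using c by simp
  fix i j assume i: "i < 2 * n" and j: "j < 2 * n"
  let ?h = "sinv n c g"
  have "c * sform n (col ?h i) (col ?h j) = sform n (g *\<^sub>v col ?h i) (g *\<^sub>v col ?h j)"
    using sform_simil[OF assms, of "col ?h i" "col ?h j"] i j by (simp add: col_carrier_vec)
  also have "g *\<^sub>v col ?h l = unit_vec (2 * n) l" if "l < 2 * n" for l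
  proof -
    have "g *\<^sub>v col ?h l = col (g * ?h) l" using g that by (intro eq_vecI) (auto simp: sinv_def)
    then show ?thesis using that by (simp add: sinv_right[OF assms])
  qed
  then have "sform n (g *\<^sub>v col ?h i) (g *\<^sub>v col ?h j) = (if i + j = 2 * n - 1 then (- 1) ^ j else 0)"
    using i j by (simp add: sform_unit_unit)
  finally show "sform n (col ?h i) (col ?h j) = inverse c * (if i + j = 2 * n - 1 then (- 1) ^ j else 0)"
    using c by (simp add: field_simps)
qed auto

lemma group_GSp: "group (GSp n :: 'f::field mat monoid)"
proof (rule groupI)
  fix g h :: "'f mat" assume "g \<in> carrier (GSp n)" "h \<in> carrier (GSp n)"
  then obtain c d where "is_simil n c g" "is_simil n d h" by (auto simp: GSp_iff)
  then have "is_simil n (c * d) (g * h)" by (rule is_simil_mult)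
  then show "g \<otimes>\<^bsub>GSp n\<^esub> h \<in> carrier (GSp n)" by (auto simp: GSp_iff)
next
  show "\<one>\<^bsub>GSp n\<^esub> \<in> carrier (GSp n :: 'f mat monoid)"
    using is_simil_one by (auto simp: GSp_iff)
next
  fix g :: "'f mat" assume "g \<in> carrier (GSp n)"
  then obtain c where c: "is_simil n c g" by (auto simp: GSp_iff)
  then show "\<exists>h\<in>carrier (GSp n). h \<otimes>\<^bsub>GSp n\<^esub> g = \<one>\<^bsub>GSp n\<^esub>"
    using is_simil_sinv[OF c] sinv_left[OF c] by (intro bexI[of _ "sinv n c g"]) (auto simp: GSp_iff)
next
  fix g :: "'f mat" assume "g \<in> carrier (GSp n)"
  then show "\<one>\<^bsub>GSp n\<^esub> \<otimes>\<^bsub>GSp n\<^esub> g = g" using GSp_carrier_mat[of g n] by auto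
next
  fix x y z :: "'f mat" assume "x \<in> carrier (GSp n)" "y \<in> carrier (GSp n)" "z \<in> carrier (GSp n)"
  then show "x \<otimes>\<^bsub>GSp n\<^esub> y \<otimes>\<^bsub>GSp n\<^esub> z = x \<otimes>\<^bsub>GSp n\<^esub> (y \<otimes>\<^bsub>GSp n\<^esub> z)"
    unfolding GSp_mult by (intro assoc_mult_mat[of _ "2 * n" "2 * n" _ "2 * n" _ "2 * n"] GSp_carrier_mat)
qed

lemma GSp_inv:
  assumes "is_simil n c g"
  shows "inv\<^bsub>GSp n\<^esub> g = sinv n c g"
proof -
  interpret group "GSp n :: 'a mat monoid" by (rule group_GSp)
  show ?thesis
    using assms is_simil_sinv[OF assms] sinv_left[OF assms]
    by (intro inv_equality) (auto simp: GSp_iff)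
qed

section \<open>Valuation ideals\<close>

locale disc_val =
  fixes v :: "'a::field \<Rightarrow> int"
  assumes dv: "discrete_valuation_on UNIV v"
begin

abbreviation P :: "int \<Rightarrow> 'a set" where "P N \<equiv> val_ideal v N"

lemma v_mult: "x \<noteq> 0 \<Longrightarrow> y \<noteq> 0 \<Longrightarrow> v (x * y) = v x + v y"
  using dv by (simp add: discrete_valuation_on_def)

lemma v_add: "x \<noteq> 0 \<Longrightarrow> y \<noteq> 0 \<Longrightarrow> x + y \<noteq> 0 \<Longrightarrow> min (v x) (v y) \<le> v (x + y)"
  using dv by (simp add: discrete_valuation_on_def)

lemma v_one [simp]: "v 1 = 0"
  using v_mult[of 1 1] by simp

lemma v_minus [simp]: "v (- x) = v x"
proof (cases "x = 0")
  case False
  have "v (- 1) = 0" using v_mult[of "- 1" "- 1"] by simp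
  then show ?thesis using v_mult[of "- 1" x] False by simp
qed simp

lemma v_inverse: "x \<noteq> 0 \<Longrightarrow> v (inverse x) = - v x"
  using v_mult[of x "inverse x"] by simp

lemma v_divide: "x \<noteq> 0 \<Longrightarrow> y \<noteq> 0 \<Longrightarrow> v (x / y) = v x - v y"
  by (simp add: divide_inverse v_mult v_inverse)

lemma v_power: "x \<noteq> 0 \<Longrightarrow> v (x ^ i) = int i * v x"
  by (induction i) (auto simp: v_mult algebra_simps)

lemma v_powi: "x \<noteq> 0 \<Longrightarrow> v (x powi i) = i * v x"
  by (cases "i \<ge> 0") (auto simp: power_int_def v_power v_inverse power_inverse)

lemma P_zero [simp]: "0 \<in> P N"
  by (simp add: val_ideal_def)

lemma P_iff: "x \<noteq> 0 \<Longrightarrow> x \<in> P N \<longleftrightarrow> N \<le> v x"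
  by (simp add: val_ideal_def)

lemma P_one: "1 \<in> P N \<longleftrightarrow> N \<le> 0"
  by (simp add: P_iff)

lemma P_add: "x \<in> P N \<Longrightarrow> y \<in> P N \<Longrightarrow> x + y \<in> P N"
  using v_add[of x y] by (cases "x = 0"; cases "y = 0"; cases "x + y = 0") (auto simp: val_ideal_def)

lemma P_minus_iff [simp]: "- x \<in> P N \<longleftrightarrow> x \<in> P N"
  by (auto simp: val_ideal_def)

lemma P_diff: "x \<in> P N \<Longrightarrow> y \<in> P N \<Longrightarrow> x - y \<in> P N"
  using P_add[of x N "- y"] by simp

lemma P_diff_swap: "x - y \<in> P N \<longleftrightarrow> y - x \<in> P N"
  using P_minus_iff[of "x - y"] by simp

lemma P_sum: "(\<And>i. i \<in> A \<Longrightarrow> f i \<in> P N) \<Longrightarrow> sum f A \<in> P N"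
  by (induction A rule: infinite_finite_induct) (auto intro: P_add)

lemma P_mono: "x \<in> P M \<Longrightarrow> N \<le> M \<Longrightarrow> x \<in> P N"
  by (auto simp: val_ideal_def)

lemma P_mult: "x \<in> P M \<Longrightarrow> y \<in> P N \<Longrightarrow> x * y \<in> P (M + N)"
  by (cases "x = 0"; cases "y = 0") (auto simp: val_ideal_def v_mult)

lemma P_mult_le: "x \<in> P M \<Longrightarrow> y \<in> P N \<Longrightarrow> L \<le> M + N \<Longrightarrow> x * y \<in> P L"
  using P_mult P_mono by blast

lemma P_sign_mult [simp]: "(- 1) ^ i * x \<in> P N \<longleftrightarrow> x \<in> P N"
  by (auto simp: minus_one_power_iff)

text \<open>The valuation of a nonzero element is finite. This turns congruences at every level into
  equations.\<close>

lemma P_all_zero: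
  assumes "\<And>N :: nat. x \<in> P (int N)"
  shows "x = 0"
proof (rule ccontr)
  assume "x \<noteq> 0"
  with assms[of "nat (v x + 1)"] show False by (auto simp: P_iff split: if_splits)
qed

lemma units_mult: "x \<in> val_units v \<Longrightarrow> y \<in> val_units v \<Longrightarrow> x * y \<in> val_units v"
  and units_inverse: "x \<in> val_units v \<Longrightarrow> inverse x \<in> val_units v"
  and units_P: "x \<in> val_units v \<Longrightarrow> N \<le> 0 \<Longrightarrow> x \<in> P N"
  by (auto simp: val_units_def v_mult v_inverse P_iff)

lemma units_add: 
  assumes "x \<in> val_units v" "y \<in> P 1"
  shows "x + y \<in> val_units v"
proof (cases "y = 0")
  case False
  have x: "x \<noteq> 0" "v x = 0" and y: "v y \<ge> 1" using assms False by (auto simp: val_units_def P_iff)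
  then have "x + y \<noteq> 0" by (metis add_eq_0_iff v_minus not_one_le_zero)
  moreover have "v (x + y) \<ge> 0" using v_add[of x y] x y False \<open>x + y \<noteq> 0\<close> by auto
  moreover have "\<not> v (x + y) \<ge> 1"
    using v_add[of "x + y" "- y"] x y False \<open>x + y \<noteq> 0\<close> by auto
  ultimately show ?thesis by (simp add: val_units_def)
qed (use assms in simp)

lemma one_units_P: "x - 1 \<in> P N \<Longrightarrow> N \<ge> 1 \<Longrightarrow> x \<in> val_units v"
  using units_add[of 1 "x - 1"] P_mono[of "x - 1" N 1] by (simp add: val_units_def)

lemma one_units_mult:
  assumes "x - 1 \<in> P N" "y - 1 \<in> P N" "N \<ge> 0"
  shows "x * y - 1 \<in> P N"
proof -
  have "x * y - 1 = (x - 1) * (y - 1) + ((x - 1) + (y - 1))" by (simp add: algebra_simps)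
  then show ?thesis using P_add[OF P_mult_le[OF assms(1,2), of N] P_add[OF assms(1,2)]] assms(3) by (simp only:)
qed

lemma one_units_inverse:
  assumes "x - 1 \<in> P N" "N \<ge> 1"
  shows "inverse x - 1 \<in> P N"
proof -
  have u: "x \<in> val_units v" using assms one_units_P by auto
  then have "x \<noteq> 0" by (simp add: val_units_def)
  then have "inverse x - 1 = - (inverse x * (x - 1))" by (simp add: algebra_simps)
  then show ?thesis using P_mult_le[OF units_P[OF units_inverse[OF u] order.refl] assms(1)] by simp
qed

end

section \<open>Groups of matrices with prescribed column types\<close>

text \<open>
  A common axiomatisation of \<open>Iw\<close>, \<open>Iw_dot\<close> and \<open>Unip\<close>: \<open>D\<close>, \<open>up\<close> and \<open>low\<close> are the sets of
  admissible entries on, above and below the diagonal.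
\<close>

locale coltype =
  fixes n :: nat and D up low :: "'a::field set"
  assumes n1: "n \<ge> 1"
    and up0: "0 \<in> up" and up_add: "\<And>x y. x \<in> up \<Longrightarrow> y \<in> up \<Longrightarrow> x + y \<in> up"
    and up_minus: "\<And>x. x \<in> up \<Longrightarrow> - x \<in> up"
    and low0: "0 \<in> low" and low_add: "\<And>x y. x \<in> low \<Longrightarrow> y \<in> low \<Longrightarrow> x + y \<in> low"
    and low_minus: "\<And>x. x \<in> low \<Longrightarrow> - x \<in> low"
    and D1: "1 \<in> D" and D0: "0 \<notin> D"
    and D_mult: "\<And>x y. x \<in> D \<Longrightarrow> y \<in> D \<Longrightarrow> x * y \<in> D"
    and D_inverse: "\<And>x. x \<in> D \<Longrightarrow> inverse x \<in> D"
    and D_up: "\<And>x y. x \<in> D \<Longrightarrow> y \<in> up \<Longrightarrow> x * y \<in> up"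
    and D_low: "\<And>x y. x \<in> D \<Longrightarrow> y \<in> low \<Longrightarrow> x * y \<in> low"
    and up_up: "\<And>x y. x \<in> up \<Longrightarrow> y \<in> up \<Longrightarrow> x * y \<in> up"
    and low_low: "\<And>x y. x \<in> low \<Longrightarrow> y \<in> low \<Longrightarrow> x * y \<in> low"
    and up_low: "\<And>x y. x \<in> up \<Longrightarrow> y \<in> low \<Longrightarrow> x * y \<in> up \<inter> low"
    and D_add: "\<And>x y z. x \<in> D \<Longrightarrow> y \<in> up \<Longrightarrow> z \<in> low \<Longrightarrow> x + y * z \<in> D"
begin

text \<open>The shape of the j-th column of an element of \<open>H\<close>. Single vectors are typed
  because membership in \<open>H\<close> will be deduced by following one vector under F and
  V.\<close>

definition col_typ :: "nat \<Rightarrow> 'a vec \<Rightarrow> bool" where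
  "col_typ j x \<longleftrightarrow> x \<in> carrier_vec (2 * n) \<and> (\<forall>i<2 * n.
     (i = j \<longrightarrow> x $ i \<in> D) \<and> (i < j \<longrightarrow> x $ i \<in> up) \<and> (j < i \<longrightarrow> x $ i \<in> low))"

definition H :: "'a mat set" where
  "H = {g \<in> carrier (GSp n). \<forall>i<2 * n. \<forall>j<2 * n.
     (i = j \<longrightarrow> g $$ (i, j) \<in> D) \<and> (i < j \<longrightarrow> g $$ (i, j) \<in> up) \<and> (j < i \<longrightarrow> g $$ (i, j) \<in> low)}"

lemma col_typD: 
  assumes "col_typ j x"
  shows "x \<in> carrier_vec (2 * n)" "j < 2 * n \<Longrightarrow> x $ j \<in> D"
    "i < j \<Longrightarrow> i < 2 * n \<Longrightarrow> x $ i \<in> up" "j < i \<Longrightarrow> i < 2 * n \<Longrightarrow> x $ i \<in> low"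
  using assms by (auto simp: col_typ_def)

lemma H_carrier: "g \<in> H \<Longrightarrow> g \<in> carrier_mat (2 * n) (2 * n)"
  by (auto simp: H_def dest: GSp_carrier_mat)

lemma H_iff: "g \<in> H \<longleftrightarrow> g \<in> carrier (GSp n) \<and> (\<forall>j<2 * n. col_typ j (col g j))"
proof (cases "g \<in> carrier (GSp n)")
  case True
  then have "g \<in> carrier_mat (2 * n) (2 * n)" by (rule GSp_carrier_mat)
  then show ?thesis using True by (auto simp: H_def col_typ_def)
qed (auto simp: H_def)

lemma up_sum: "(\<And>i. i \<in> A \<Longrightarrow> f i \<in> up) \<Longrightarrow> sum f A \<in> up"
  by (induction A rule: infinite_finite_induct) (auto intro: up_add up0)

lemma low_sum: "(\<And>i. i \<in> A \<Longrightarrow> f i \<in> low) \<Longrightarrow> sum f A \<in> low"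
  by (induction A rule: infinite_finite_induct) (auto intro: low_add low0)

lemma up_diff: "x \<in> up \<Longrightarrow> y \<in> up \<Longrightarrow> x - y \<in> up"
  using up_add[of x "- y"] up_minus by simp

text \<open>For unipotent matrices \<open>up\<close> is the whole field, so a diagonal entry cannot
  absorb elements of \<open>up\<close>. In the sums that occur it is perturbed only by products of
  an upper and a lower entry.\<close>

definition UL :: "'a set" where "UL = {y * z | y z. y \<in> up \<and> z \<in> low}"

lemma ULI1: "y \<in> up \<Longrightarrow> z \<in> low \<Longrightarrow> y * z \<in> UL"
  and ULI2: "y \<in> up \<Longrightarrow> z \<in> low \<Longrightarrow> z * y \<in> UL"
  by (auto simp: UL_def mult.commute)

lemma UL_minus: "x \<in> UL \<Longrightarrow> - x \<in> UL"
  unfolding UL_def by (auto, metis mult_minus_left up_minus)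

lemma D_add_UL: "x \<in> D \<Longrightarrow> y \<in> UL \<Longrightarrow> x + y \<in> D"
  by (auto simp: UL_def D_add)

lemma D_add_sum: "x \<in> D \<Longrightarrow> (\<And>i. i \<in> A \<Longrightarrow> f i \<in> UL) \<Longrightarrow> x + sum f A \<in> D"
proof (induction A rule: infinite_finite_induct)
  case (insert i A)
  then have "(x + sum f A) + f i \<in> D" by (intro D_add_UL[of "x + sum f A"]) auto
  then show ?case using insert by (simp add: algebra_simps)
qed auto

lemma D_sum:
  assumes "finite A" "j \<in> A" "f j \<in> D" "\<And>i. i \<in> A \<Longrightarrow> i \<noteq> j \<Longrightarrow> f i \<in> UL"
  shows "sum f A \<in> D"
  using assms D_add_sum[of "f j" "A - {j}" f] by (auto simp: sum.remove)

text \<open>Each summand of entry i is classified by the position of its index l relative to i and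
  j; a product of an upper and a lower entry lies in both \<open>up\<close> and \<open>low\<close>.
  Applied to the columns of a second matrix this gives closure of \<open>H\<close> under
  multiplication.\<close>

lemma H_typ:
  assumes A: "A \<in> H" and x: "col_typ j x" and j: "j < 2 * n"
  shows "col_typ j (A *\<^sub>v x)"
proof -
  have Ac: "A \<in> carrier_mat (2 * n) (2 * n)" using A by (rule H_carrier)
  have e: "i < 2 * n \<Longrightarrow> A $$ (i, i) \<in> D" "i < l \<Longrightarrow> l < 2 * n \<Longrightarrow> A $$ (i, l) \<in> up"
    "l < i \<Longrightarrow> i < 2 * n \<Longrightarrow> A $$ (i, l) \<in> low" for i l
    using A by (auto simp: H_def)
  note xs = col_typD[OF x]
  have "(i = j \<longrightarrow> (A *\<^sub>v x) $ i \<in> D) \<and> (i < j \<longrightarrow> (A *\<^sub>v x) $ i \<in> up) \<and> (j < i \<longrightarrow> (A *\<^sub>v x) $ i \<in> low)"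
    if i: "i < 2 * n" for i
  proof (intro conjI impI; unfold mult_mat_vec_sum[OF Ac xs(1) i])
    assume "i = j"
    show "(\<Sum>l<2 * n. A $$ (i, l) * x $ l) \<in> D"
    proof (rule D_sum[of _ j])
      show "A $$ (i, j) * x $ j \<in> D" using e(1)[OF j] xs(2)[OF j] \<open>i = j\<close> by (auto intro: D_mult)
      fix l assume l: "l \<in> {..<2 * n}" "l \<noteq> j"
      then consider "l < j" | "l > j" by linarith
      then show "A $$ (i, l) * x $ l \<in> UL"
        using l i e(2,3)[of _ _] xs(3,4) \<open>i = j\<close> by cases (auto intro: ULI1 ULI2)
    qed (use j in auto)
  next
    assume ij: "i < j"
    show "(\<Sum>l<2 * n. A $$ (i, l) * x $ l) \<in> up"
    proof (rule up_sum)
      fix l assume l: "l \<in> {..<2 * n}"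
      consider "l < i" | "l = i" | "i < l" "l < j" | "l = j" | "j < l" by linarith
      then show "A $$ (i, l) * x $ l \<in> up"
      proof cases
        case 1
        then have "x $ l * A $$ (i, l) \<in> up" using l i ij e(3)[of l i] xs(3)[of l] up_low by auto
        then show ?thesis by (simp add: mult.commute)
      next
        case 2
        then show ?thesis using l ij e(1)[of i] xs(3)[of l] D_up by auto
      next
        case 3
        then show ?thesis using l e(2)[of i l] xs(3)[of l] up_up by auto
      next
        case 4
        then have "x $ l * A $$ (i, l) \<in> up" using l ij e(2)[of i l] xs(2) D_up by auto
        then show ?thesis by (simp add: mult.commute)
      next
        case 5
        then show ?thesis using l ij e(2)[of i l] xs(4)[of l] up_low by auto
      qed
    qed
  next
    assume ij: "j < i"
    show "(\<Sum>l<2 * n. A $$ (i, l) * x $ l) \<in> low"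
    proof (rule low_sum)
      fix l assume l: "l \<in> {..<2 * n}"
      consider "l < j" | "l = j" | "j < l" "l < i" | "l = i" | "i < l" by linarith
      then show "A $$ (i, l) * x $ l \<in> low"
      proof cases
        case 1
        then have "x $ l * A $$ (i, l) \<in> low" using l i ij e(3)[of l i] xs(3)[of l] up_low by auto
        then show ?thesis by (simp add: mult.commute)
      next
        case 2
        then have "x $ l * A $$ (i, l) \<in> low" using l ij i e(3)[of l i] xs(2) D_low by auto
        then show ?thesis by (simp add: mult.commute)
      next
        case 3
        then show ?thesis using l i e(3)[of l i] xs(4)[of l] low_low by auto
      next
        case 4
        then show ?thesis using l ij e(1)[of i] xs(4)[of l] D_low by auto
      next
        case 5
        then show ?thesis using l ij e(2)[of i l] xs(4)[of l] up_low by auto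
      qed
    qed
  qed
  then show ?thesis using Ac xs(1) by (auto simp: col_typ_def)
qed

text \<open>The summand with index 0 pairs the two diagonal entries; every other one pairs an entry
  of \<open>x\<close> below the diagonal with an entry of \<open>y\<close> above it.\<close>

lemma sform_typ:
  assumes "col_typ 0 x" "col_typ (2 * n - 1) y"
  shows "- sform n x y \<in> D"
proof -
  note xs = col_typD[OF assms(1)] and ys = col_typD[OF assms(2)]
  have "- sform n x y = (\<Sum>i<2 * n. (- 1) ^ i * (x $ i * y $ (2 * n - 1 - i)))"
    unfolding sform_sum[OF xs(1) ys(1)] sum_negf[symmetric] by (intro sum.cong) auto
  also have "\<dots> \<in> D"
  proof (rule D_sum[of _ 0])
    show "(- 1) ^ 0 * (x $ 0 * y $ (2 * n - 1 - 0)) \<in> D" using xs(2) ys(2) n1 by (auto intro: D_mult)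
    fix i assume i: "i \<in> {..<2 * n}" "i \<noteq> 0"
    then have "x $ i * y $ (2 * n - 1 - i) \<in> UL" using xs(4)[of i] ys(3)[of "2 * n - 1 - i"] ULI2 by auto
    then show "(- 1) ^ i * (x $ i * y $ (2 * n - 1 - i)) \<in> UL"
      using UL_minus by (auto simp: minus_one_power_iff)
  qed (use n1 in auto)
  finally show ?thesis .
qed

lemma H_simil:
  assumes "A \<in> H" "is_simil n c A"
  shows "c \<in> D"
proof -
  have "col_typ 0 (col A 0)" "col_typ (2 * n - 1) (col A (2 * n - 1))" using assms(1) n1 by (auto simp: H_iff)
  then have "- sform n (col A 0) (col A (2 * n - 1)) \<in> D" by (rule sform_typ)
  moreover have "sform n (col A 0) (col A (2 * n - 1)) = - c"
    using n1 by (subst is_simil_gram[OF assms(2)]) (auto simp: minus_one_power_iff)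
  ultimately show ?thesis by simp
qed

lemma H_mult:
  assumes "A \<in> H" "B \<in> H"
  shows "A * B \<in> H"
proof -
  interpret group "GSp n :: 'a mat monoid" by (rule group_GSp)
  have "A * B \<in> carrier (GSp n)" using assms m_closed[of A B] by (auto simp: H_def)
  moreover have "col_typ j (col (A * B) j)" if "j < 2 * n" for j
  proof -
    have "col (A * B) j = A *\<^sub>v col B j"
      using H_carrier[OF assms(1)] H_carrier[OF assms(2)] that by (intro eq_vecI) auto
    then show ?thesis using H_typ[OF assms(1) _ that] assms(2) that by (auto simp: H_iff)
  qed
  ultimately show ?thesis by (auto simp: H_iff)
qed

text \<open>Reflection in the antidiagonal preserves the regions on, above and below the diagonal,
  and the scalar c^-1 lies in D by \<open>H_simil\<close>.\<close>

lemma H_sinv: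
  assumes A: "A \<in> H" "is_simil n c A"
  shows "sinv n c A \<in> H"
proof -
  have e: "i < 2 * n \<Longrightarrow> A $$ (i, i) \<in> D" "i < l \<Longrightarrow> l < 2 * n \<Longrightarrow> A $$ (i, l) \<in> up"
    "l < i \<Longrightarrow> i < 2 * n \<Longrightarrow> A $$ (i, l) \<in> low" for i l
    using A by (auto simp: H_def)
  have c: "inverse c \<in> D" using H_simil[OF A] by (rule D_inverse)
  have s: "sinv n c A $$ (i, j) = (- 1) ^ (i + j) * (inverse c * A $$ (2 * n - 1 - j, 2 * n - 1 - i))"
    if "i < 2 * n" "j < 2 * n" for i j using that by (auto simp: sinv_def)
  have "(i = j \<longrightarrow> sinv n c A $$ (i, j) \<in> D) \<and> (i < j \<longrightarrow> sinv n c A $$ (i, j) \<in> up) \<and>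
      (j < i \<longrightarrow> sinv n c A $$ (i, j) \<in> low)" if ij: "i < 2 * n" "j < 2 * n" for i j
  proof (intro conjI impI; unfold s[OF ij])
    assume "i = j"
    then show "(- 1) ^ (i + j) * (inverse c * A $$ (2 * n - 1 - j, 2 * n - 1 - i)) \<in> D"
      using ij c e(1)[of "2 * n - 1 - i"] by (simp add: D_mult flip: mult_2)
  next
    assume "i < j"
    then have "inverse c * A $$ (2 * n - 1 - j, 2 * n - 1 - i) \<in> up"
      using ij by (intro D_up c e(2)) auto
    then show "(- 1) ^ (i + j) * (inverse c * A $$ (2 * n - 1 - j, 2 * n - 1 - i)) \<in> up"
      using up_minus by (auto simp: minus_one_power_iff)
  next
    assume "j < i"
    then have "inverse c * A $$ (2 * n - 1 - j, 2 * n - 1 - i) \<in> low"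
      using ij by (intro D_low c e(3)) auto
    then show "(- 1) ^ (i + j) * (inverse c * A $$ (2 * n - 1 - j, 2 * n - 1 - i)) \<in> low"
      using low_minus by (auto simp: minus_one_power_iff)
  qed
  moreover have "sinv n c A \<in> carrier (GSp n)" using is_simil_sinv[OF A(2)] by (auto simp: GSp_iff)
  ultimately show ?thesis by (simp add: H_def)
qed

lemma one_H: "1\<^sub>m (2 * n) \<in> H"
  using is_simil_one by (auto simp: H_def GSp_iff D1 up0 low0)

lemma H_subgroup: "subgroup H (GSp n)"
proof
  show "H \<subseteq> carrier (GSp n)" by (auto simp: H_def)
  fix A assume A: "A \<in> H"
  then obtain c where c: "is_simil n c A" by (auto simp: H_def GSp_iff)
  then show "inv\<^bsub>GSp n\<^esub> A \<in> H" using H_sinv[OF A c] by (simp add: GSp_inv)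
qed (auto simp: H_mult one_H)

end

text \<open>The summands i and 2n - 1 - i cancel. Skew symmetry alone would not suffice, since the
  field may have characteristic 2.\<close>

lemma sform_self:
  fixes x :: "'f::field vec"
  assumes x: "x \<in> carrier_vec (2 * n)"
  shows "sform n x x = 0"
proof -
  let ?f = "\<lambda>i. (- 1) ^ Suc i * x $ i * x $ (2 * n - 1 - i)"
  have split: "{..<2 * n} = {..<n} \<union> {n..<2 * n}" by auto
  have "sform n x x = sum ?f {..<n} + sum ?f {n..<2 * n}"
    unfolding sform_sum[OF x x] split by (rule sum.union_disjoint) auto
  also have "sum ?f {n..<2 * n} = sum (\<lambda>i. - ?f i) {..<n}"
  proof (rule sum.reindex_bij_witness[of _ "\<lambda>i. 2 * n - 1 - i" "\<lambda>i. 2 * n - 1 - i"])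
    fix i assume "i \<in> {n..<2 * n}"
    then have "(- 1 :: 'f) ^ Suc (2 * n - 1 - i) = - ((- 1) ^ Suc i)" "2 * n - 1 - (2 * n - 1 - i) = i"
      by (auto simp: minus_one_power_iff)
    then show "- ((- 1) ^ Suc (2 * n - 1 - i) * x $ (2 * n - 1 - i) * x $ (2 * n - 1 - (2 * n - 1 - i)))
        = (- 1) ^ Suc i * x $ i * x $ (2 * n - 1 - i)"
      by simp
  qed auto
  finally show ?thesis by (simp add: sum_negf)
qed

section \<open>The vectors attached to a Frobenius-semilinear similitude\<close>

text \<open>The exponent of \<pi>^r in column j of \<open>gmat\<close>. Columns j and 2n - 1 - j
  have exponents adding up to n, which makes \<open>gmat\<close> a similitude for every r.\<close>

definition dexp :: "nat \<Rightarrow> nat \<Rightarrow> nat" where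
  "dexp n j = (if j < n then j else if j < 2 * n - 1 then j - n + 1 else n)"

locale symp_frob =
  fixes n k :: nat and \<sigma> :: "'a::field \<Rightarrow> 'a" and \<pi> :: 'a and b :: "'a mat"
  assumes n1: "n \<ge> 1" and \<sigma>_bij: "bij \<sigma>" and \<sigma>_1: "\<sigma> 1 = 1"
    and \<sigma>_add: "\<sigma> (x + y) = \<sigma> x + \<sigma> y" and \<sigma>_mult: "\<sigma> (x * y) = \<sigma> x * \<sigma> y"
    and \<pi>0: "\<pi> \<noteq> 0" and \<sigma>_\<pi>: "\<sigma> \<pi> = \<pi>" and b: "is_simil n (- (\<pi> ^ k)) b"
begin

lemma \<sigma>_0 [simp]: "\<sigma> 0 = 0"
  by (metis \<sigma>_add add_0 add_cancel_right_right)

sublocale \<sigma>: semiring_hom \<sigma>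
  by unfold_locales (auto simp: \<sigma>_1 \<sigma>_add \<sigma>_mult)

lemma \<sigma>_minus: "\<sigma> (- x) = - \<sigma> x"
  using \<sigma>_add[of x "- x"] by (simp add: eq_neg_iff_add_eq_0 add.commute)

lemma \<sigma>_diff: "\<sigma> (x - y) = \<sigma> x - \<sigma> y"
  using \<sigma>_add[of x "- y"] by (simp add: \<sigma>_minus)

lemma \<sigma>_inj: "\<sigma> x = \<sigma> y \<longleftrightarrow> x = y"
  using \<sigma>_bij by (auto simp: bij_def inj_eq)

lemma \<sigma>_eq_0: "\<sigma> x = 0 \<longleftrightarrow> x = 0"
  using \<sigma>_inj[of x 0] by simp

lemma \<sigma>_inverse: "\<sigma> (inverse x) = inverse (\<sigma> x)"
proof (cases "x = 0")
  case False
  then have "\<sigma> x * \<sigma> (inverse x) = 1" by (simp flip: \<sigma>_mult add: \<sigma>_1)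
  then show ?thesis by (metis inverse_unique)
qed simp

lemma \<sigma>_divide: "\<sigma> (x / y) = \<sigma> x / \<sigma> y"
  by (simp add: divide_inverse \<sigma>_mult \<sigma>_inverse)

lemma \<sigma>_power: "\<sigma> (x ^ i) = \<sigma> x ^ i"
  by (induction i) (auto simp: \<sigma>_1 \<sigma>_mult)

lemma \<sigma>_\<pi>_power [simp]: "\<sigma> (\<pi> ^ i) = \<pi> ^ i"
  by (simp add: \<sigma>_power \<sigma>_\<pi>)

lemma \<sigma>_sign [simp]: "\<sigma> ((- 1) ^ i) = (- 1) ^ i"
  by (simp add: \<sigma>_power \<sigma>_minus \<sigma>_1)

lemma \<sigma>_sum: "\<sigma> (sum f A) = (\<Sum>i\<in>A. \<sigma> (f i))"
  by (induction A rule: infinite_finite_induct) (auto simp: \<sigma>_add)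

abbreviation \<tau> :: "'a \<Rightarrow> 'a" where "\<tau> \<equiv> inv_into UNIV \<sigma>"

lemma \<tau>_\<sigma> [simp]: "\<tau> (\<sigma> x) = x" and \<sigma>_\<tau> [simp]: "\<sigma> (\<tau> x) = x"
  using \<sigma>_bij by (auto simp: bij_def surj_f_inv_f)

lemma \<tau>_eqI: "\<sigma> y = x \<Longrightarrow> \<tau> x = y"
  by auto

lemma \<tau>_0 [simp]: "\<tau> 0 = 0" and \<tau>_1: "\<tau> 1 = 1" and \<tau>_minus: "\<tau> (- x) = - \<tau> x"
  and \<tau>_add: "\<tau> (x + y) = \<tau> x + \<tau> y"
  and \<tau>_mult: "\<tau> (x * y) = \<tau> x * \<tau> y" and \<tau>_\<pi>_power [simp]: "\<tau> (\<pi> ^ i) = \<pi> ^ i"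
  and \<tau>_sign [simp]: "\<tau> ((- 1) ^ i) = (- 1) ^ i"
  by (auto intro!: \<tau>_eqI simp: \<sigma>_minus \<sigma>_mult \<sigma>_1 \<sigma>_add)

lemma \<tau>_eq_0: "\<tau> x = 0 \<longleftrightarrow> x = 0"
  by (metis \<sigma>_0 \<sigma>_\<tau> \<tau>_0)

sublocale \<tau>: semiring_hom \<tau>
  by unfold_locales (auto simp: \<tau>_1 \<tau>_add \<tau>_mult)

lemma b_carrier: "b \<in> carrier_mat (2 * n) (2 * n)"
  using b by (rule is_simil_carrier)

abbreviation F :: "'a vec \<Rightarrow> 'a vec" where "F \<equiv> Frob \<sigma> b"

abbreviation Car :: "'a vec set" where "Car \<equiv> carrier_vec (2 * n)"

lemma F_carrier [simp]: "x \<in> Car \<Longrightarrow> F x \<in> Car"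
  using b_carrier by (auto simp: Frob_def)

lemma map_\<sigma>_add: "x \<in> Car \<Longrightarrow> y \<in> Car \<Longrightarrow> map_vec \<sigma> (x + y) = map_vec \<sigma> x + map_vec \<sigma> y"
  by (intro eq_vecI) (auto simp: \<sigma>_add)

lemma F_add: "x \<in> Car \<Longrightarrow> y \<in> Car \<Longrightarrow> F (x + y) = F x + F y"
  unfolding Frob_def using b_carrier by (simp add: map_\<sigma>_add mult_add_distrib_mat_vec)

lemma F_smult: "x \<in> Car \<Longrightarrow> F (c \<cdot>\<^sub>v x) = \<sigma> c \<cdot>\<^sub>v F x"
  unfolding Frob_def using b_carrier by (simp add: \<sigma>.vec_hom_smult mult_mat_vec[of _ "2 * n" "2 * n"])

lemma F_minus: 
  assumes "x \<in> Car" "y \<in> Car"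
  shows "F (x - y) = F x - F y"
proof -
  have "x - y = x + (- 1) \<cdot>\<^sub>v y" using assms by (intro eq_vecI) auto
  then have "F (x - y) = F x + (- 1) \<cdot>\<^sub>v F y" using assms by (simp add: F_add F_smult \<sigma>_minus \<sigma>_1)
  also have "\<dots> = F x - F y" using F_carrier[OF assms(1)] F_carrier[OF assms(2)] by (intro eq_vecI) auto
  finally show ?thesis .
qed

lemma sform_map_vec: "x \<in> Car \<Longrightarrow> y \<in> Car \<Longrightarrow> sform n (map_vec \<sigma> x) (map_vec \<sigma> y) = \<sigma> (sform n x y)"
  by (subst (1 2) sform_sum) (auto simp: \<sigma>_sum \<sigma>_mult \<sigma>_minus \<sigma>_1 \<sigma>_power intro!: sum.cong)

lemma sform_F: "x \<in> Car \<Longrightarrow> y \<in> Car \<Longrightarrow> sform n (F x) (F y) = - (\<pi> ^ k) * \<sigma> (sform n x y)"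
  unfolding Frob_def by (subst sform_simil[OF b]) (auto simp: sform_map_vec)

lemma is_simil_map_\<sigma>:
  assumes g: "is_simil n l g"
  shows "is_simil n (\<sigma> l) (map_mat \<sigma> g)"
proof (rule is_similI)
  have gC: "g \<in> carrier_mat (2 * n) (2 * n)" using g by (rule is_simil_carrier)
  then show "map_mat \<sigma> g \<in> carrier_mat (2 * n) (2 * n)" by simp
  fix i j assume ij: "i < 2 * n" "j < 2 * n"
  then have "sform n (col (map_mat \<sigma> g) i) (col (map_mat \<sigma> g) j) = \<sigma> (sform n (col g i) (col g j))"
    using gC sform_map_vec[of "col g i" "col g j"] by auto
  then show "sform n (col (map_mat \<sigma> g) i) (col (map_mat \<sigma> g) j) = \<sigma> l * (if i + j = 2 * n - 1 then (- 1) ^ j else 0)"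
    using is_simil_gram[OF g ij] by (simp add: \<sigma>_mult)
qed (use is_simil_nonzero[OF g] \<sigma>_eq_0 in auto)

text \<open>An explicit inverse of F, built from the symplectic inverse of b. \<open>Ver\<close> is
  defined through \<open>the_inv_into\<close>, which means something only once F is known to be
  bijective on column vectors.\<close>

definition Finv :: "'a vec \<Rightarrow> 'a vec" where
  "Finv x = map_vec \<tau> (sinv n (- (\<pi> ^ k)) b *\<^sub>v x)"

lemma Finv_carrier [simp]: "x \<in> Car \<Longrightarrow> Finv x \<in> Car"
  unfolding Finv_def using mult_mat_vec_carrier[OF sinv_carrier] by simp

lemma F_Finv [simp]:
  assumes "x \<in> Car"
  shows "F (Finv x) = x"
proof -
  have "map_vec \<sigma> (Finv x) = sinv n (- (\<pi> ^ k)) b *\<^sub>v x"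
    unfolding Finv_def by (intro eq_vecI) auto
  then have "F (Finv x) = (b * sinv n (- (\<pi> ^ k)) b) *\<^sub>v x"
    unfolding Frob_def using assoc_mult_mat_vec[OF b_carrier sinv_carrier assms] by simp
  then show ?thesis using assms by (simp add: sinv_right[OF b])
qed

lemma Finv_F [simp]:
  assumes x: "x \<in> Car"
  shows "Finv (F x) = x"
proof -
  have mx: "map_vec \<sigma> x \<in> Car" using x by simp
  have "sinv n (- (\<pi> ^ k)) b *\<^sub>v F x = (sinv n (- (\<pi> ^ k)) b * b) *\<^sub>v map_vec \<sigma> x"
    unfolding Frob_def using assoc_mult_mat_vec[OF sinv_carrier b_carrier mx] by simp
  also have "\<dots> = map_vec \<sigma> x" using mx by (simp add: sinv_left[OF b])
  finally show ?thesis unfolding Finv_def by (intro eq_vecI) auto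
qed

lemma F_inj: "x \<in> Car \<Longrightarrow> y \<in> Car \<Longrightarrow> F x = F y \<Longrightarrow> x = y"
  by (metis Finv_F)

abbreviation V :: "'a vec \<Rightarrow> 'a vec" where "V \<equiv> Ver n \<sigma> \<pi> k b"

lemma V_Finv: "x \<in> Car \<Longrightarrow> V x = \<pi> ^ k \<cdot>\<^sub>v Finv x"
  unfolding Ver_def using the_inv_into_f_f[of F Car "Finv x"] F_inj
  by (auto simp: inj_on_def)

lemma V_carrier [simp]: "x \<in> Car \<Longrightarrow> V x \<in> Car"
  by (simp add: V_Finv)

lemma F_V: "x \<in> Car \<Longrightarrow> F (V x) = \<pi> ^ k \<cdot>\<^sub>v x"
  by (simp add: V_Finv F_smult)

text \<open>F multiplies the form by -\<pi>^k and F V = \<pi>^k, so V is minus the semilinear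
  adjoint of F.\<close>

lemma sform_V_left:
  assumes "x \<in> Car" "y \<in> Car"
  shows "sform n (V x) y = - \<tau> (sform n x (F y))"
proof -
  have "\<pi> ^ k * sform n x (F y) = - (\<pi> ^ k) * \<sigma> (sform n (V x) y)"
    using sform_F[of "V x" y] assms by (simp add: F_V sform_smult_left)
  then have "sform n x (F y) = - \<sigma> (sform n (V x) y)"
    using \<pi>0 by (metis minus_mult_commute mult_cancel_left power_not_zero)
  then show ?thesis by (simp add: \<tau>_minus)
qed

lemma sform_V_V:
  assumes "x \<in> Car" "y \<in> Car"
  shows "sform n (V x) (V y) = - (\<pi> ^ k) * \<tau> (sform n x y)"
  using assms by (simp add: sform_V_left F_V sform_smult_right \<tau>_mult)

lemma Fi_carrier [simp]: "x \<in> Car \<Longrightarrow> (F ^^ i) x \<in> Car"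
  by (induction i) auto

lemma sform_Fi_eq_0:
  "x \<in> Car \<Longrightarrow> y \<in> Car \<Longrightarrow> sform n ((F ^^ i) x) ((F ^^ i) y) = 0 \<longleftrightarrow> sform n x y = 0"
  by (induction i) (auto simp: sform_F \<sigma>_eq_0 \<pi>0)

abbreviation \<alpha> :: "'a vec \<Rightarrow> 'a" where "\<alpha> \<equiv> alpha n \<sigma> b"

abbreviation G :: "'a vec \<Rightarrow> nat \<Rightarrow> 'a vec" where "G \<equiv> Gvec n \<sigma> \<pi> k b"

abbreviation Gs :: "'a vec \<Rightarrow> 'a vec \<Rightarrow> 'a vec" where "Gs \<equiv> Gstep n \<sigma> \<pi> k b"

abbreviation gm :: "nat \<Rightarrow> 'a vec \<Rightarrow> 'a mat" where "gm \<equiv> gmat n \<sigma> \<pi> k b"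

lemma Gs_carrier [simp]: "v \<in> Car \<Longrightarrow> x \<in> Car \<Longrightarrow> Gs v x \<in> Car"
  by (simp add: Gstep_def)

lemma G_carrier [simp]: "v \<in> Car \<Longrightarrow> G v i \<in> Car"
  by (induction i) auto

text \<open>Index 0 is filled with v in place of the zero vector of \<open>Gvec\<close>; then v,
  G_1, G_2, ... obey a single recursion, in which \<open>gsgn\<close> supplies the sign special to
  G_1.\<close>

definition Xv :: "'a vec \<Rightarrow> nat \<Rightarrow> 'a vec" where "Xv v i = (if i = 0 then v else G v i)"

definition gsgn :: "nat \<Rightarrow> 'a" where "gsgn i = (if i = 0 then (- 1) ^ (n + 1) else 1)"

lemma Xv_carrier [simp]: "v \<in> Car \<Longrightarrow> Xv v i \<in> Car"
  by (simp add: Xv_def)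

lemma Xv_0 [simp]: "Xv v 0 = v"
  by (simp add: Xv_def)

lemma Xv_Suc: "v \<in> Car \<Longrightarrow> Xv v (Suc i) = gsgn i \<cdot>\<^sub>v Gs v (Xv v i)"
  by (auto simp: Xv_def gsgn_def Gs_carrier)

text \<open>The columns of \<open>gmat\<close> stripped of their powers of \<pi>, so that the Gram
  matrix is computed once for all r.\<close>

definition base :: "'a vec \<Rightarrow> nat \<Rightarrow> 'a vec" where
  "base v j = (if j < n then (F ^^ j) v else if j < 2 * n - 1 then Xv v (j - n + 1) else (F ^^ n) v)"

lemma base_carrier [simp]: "v \<in> Car \<Longrightarrow> base v j \<in> Car"
  by (simp add: base_def)

lemma gm_carrier [simp]: "gm r v \<in> carrier_mat (2 * n) (2 * n)"
proof -
  have "length ([0..<n]) + (length [1..<n] + 1) = 2 * n" using n1 by auto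
  then show ?thesis unfolding gmat_def by (intro mat_of_cols_carrier(1)[THEN back_subst[of "\<lambda>m. _ \<in> carrier_mat _ m"]]) simp
qed

lemma gm_index:
  assumes "v \<in> Car" "i < 2 * n" "j < 2 * n"
  shows "gm r v $$ (i, j) = \<pi> ^ (dexp n j * r) * base v j $ i"
proof -
  let ?L1 = "map (\<lambda>i. \<pi> ^ (i * r) \<cdot>\<^sub>v (F ^^ i) v) [0..<n]"
  let ?L2 = "map (\<lambda>i. \<pi> ^ (i * r) \<cdot>\<^sub>v G v i) [1..<n]"
  let ?L3 = "[\<pi> ^ (n * r) \<cdot>\<^sub>v (F ^^ n) v]"
  have "(?L1 @ ?L2 @ ?L3) ! j = \<pi> ^ (dexp n j * r) \<cdot>\<^sub>v base v j"
  proof -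
    consider "j < n" | "n \<le> j" "j < 2 * n - 1" | "j = 2 * n - 1" using assms(3) by linarith
    then show ?thesis
    proof cases
      case 1
      then show ?thesis by (simp add: nth_append dexp_def base_def)
    next
      case 2
      then have "\<not> j < n" "j - n < n - 1" "1 + (j - n) = j - n + 1" by auto
      with 2 show ?thesis by (simp add: nth_append dexp_def base_def Xv_def)
    next
      case 3
      then have "\<not> j < n" "j - n = n - 1" using n1 by auto
      with 3 show ?thesis by (simp add: nth_append dexp_def base_def)
    qed
  qed
  moreover have "gm r v $$ (i, j) = (?L1 @ ?L2 @ ?L3) ! j $ i"
    unfolding gmat_def by (rule mat_of_cols_index) (use assms n1 in auto)
  moreover have "i < dim_vec (base v j)" using base_carrier[OF assms(1), of j] assms(2) by simp
  ultimately show ?thesis by simp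
qed

lemma gm_col:
  assumes v: "v \<in> Car" and j: "j < 2 * n"
  shows "col (gm r v) j = \<pi> ^ (dexp n j * r) \<cdot>\<^sub>v base v j"
proof (rule eq_vecI)
  have d: "dim_vec (base v j) = 2 * n" using base_carrier[OF v, of j] by auto
  fix i assume "i < dim_vec (\<pi> ^ (dexp n j * r) \<cdot>\<^sub>v base v j)"
  then have i: "i < 2 * n" using d by simp
  then show "col (gm r v) j $ i = (\<pi> ^ (dexp n j * r) \<cdot>\<^sub>v base v j) $ i"
    using gm_index[OF v i j] j d carrier_matD[OF gm_carrier[of r v]] by simp
qed (use base_carrier[OF v, of j] carrier_matD[OF gm_carrier[of r v]] in auto)

abbreviation Vs :: "'a vec set" where "Vs \<equiv> Vsymp n \<sigma> b"

lemma Vs_carrier: "v \<in> Vs \<Longrightarrow> v \<in> Car"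
  by (simp add: Vsymp_def)

context
  fixes v assumes v: "v \<in> Vs"
begin

lemma vC [simp]: "v \<in> Car"
  using v by (rule Vs_carrier)

lemma \<alpha>_nonzero: "\<alpha> v \<noteq> 0"
  using v by (simp add: Vsymp_def alpha_def)

lemma sform_v_Fi: "j < n \<Longrightarrow> sform n v ((F ^^ j) v) = 0"
  using v sform_self[of v n] by (cases "j = 0") (auto simp: Vsymp_def)

lemma sform_Fi_Fj_le:
  assumes "i \<le> j" "j - i < n"
  shows "sform n ((F ^^ i) v) ((F ^^ j) v) = 0"
proof -
  have "(F ^^ j) v = (F ^^ i) ((F ^^ (j - i)) v)"
    using assms(1) by (metis funpow_add le_add_diff_inverse o_apply)
  then show ?thesis using sform_v_Fi[OF assms(2)] by (simp add: sform_Fi_eq_0)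
qed

lemma sform_Fi_Fj: "i < j + n \<Longrightarrow> j < i + n \<Longrightarrow> sform n ((F ^^ i) v) ((F ^^ j) v) = 0"
  using sform_Fi_Fj_le[of i j] sform_Fi_Fj_le[of j i] sform_swap[of "(F ^^ i) v" n "(F ^^ j) v"]
  by (cases "i \<le> j") auto

text \<open>The multiple of v subtracted in \<open>Gstep\<close> is chosen to kill the pairing with
  F^n v; pairings with F^j v for j < n are not disturbed by it, as v is orthogonal to these
  vectors.\<close>

lemma sform_Gs_Fj:
  assumes x: "x \<in> Car" and j: "j \<le> n"
  shows "sform n (Gs v x) ((F ^^ j) v)
    = (if j < n then - (\<alpha> v / \<tau> (\<alpha> v)) * \<tau> (sform n x ((F ^^ Suc j) v)) else 0)"
proof -
  let ?c = "sform n (V x) ((F ^^ n) v) / \<alpha> v"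
  have "sform n (Gs v x) ((F ^^ j) v) = \<alpha> v / \<tau> (\<alpha> v) * (sform n (V x) ((F ^^ j) v) - ?c * sform n v ((F ^^ j) v))"
    unfolding Gstep_def using x
    by (simp add: sform_smult_left sform_minus_left)
  also have "\<dots> = (if j < n then - (\<alpha> v / \<tau> (\<alpha> v)) * \<tau> (sform n x ((F ^^ Suc j) v)) else 0)"
  proof (cases "j < n")
    case True
    then show ?thesis using x by (simp add: sform_v_Fi sform_V_left)
  next
    case False
    then have "j = n" using j by simp
    then show ?thesis using \<alpha>_nonzero by (simp add: alpha_def)
  qed
  finally show ?thesis .
qed

text \<open>Each application of V moves the nonzero pairing back by one power of F at the cost of a
  sign and a \<tau>. The factor \<alpha>/\<tau>(\<alpha>) in \<open>Gstep\<close> exists to turn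
  \<tau>(\<alpha>) back into \<alpha>.\<close>

lemma sform_Xv_Fj:
  "1 \<le> i \<Longrightarrow> i < n \<Longrightarrow> j \<le> n \<Longrightarrow>
    sform n (Xv v i) ((F ^^ j) v) = (if i + j = n then (- 1) ^ (n + i - 1) * \<alpha> v else 0)"
proof (induction i arbitrary: j rule: dec_induct)
  case base
  have "sform n (Xv v 1) ((F ^^ j) v) = (- 1) ^ (n + 1) * sform n (Gs v v) ((F ^^ j) v)"
    using Xv_Suc[of v 0] by (simp add: gsgn_def sform_smult_left)
  also have "\<dots> = (if 1 + j = n then (- 1) ^ (n + 1 - 1) * \<alpha> v else 0)"
  proof (cases "Suc j = n")
    case True
    then show ?thesis using \<alpha>_nonzero base
      by (simp add: sform_Gs_Fj \<tau>_eq_0 flip: alpha_def)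
  next
    case False
    then show ?thesis using base sform_v_Fi[of "Suc j"] by (simp add: sform_Gs_Fj)
  qed
  finally show ?case by simp
next
  case (step i)
  have "sform n (Xv v (Suc i)) ((F ^^ j) v) = sform n (Gs v (Xv v i)) ((F ^^ j) v)"
    using Xv_Suc[of v i] step.hyps by (simp add: gsgn_def)
  also have "\<dots> = (if j < n then - (\<alpha> v / \<tau> (\<alpha> v)) * \<tau> (sform n (Xv v i) ((F ^^ Suc j) v)) else 0)"
    using step.prems by (intro sform_Gs_Fj) auto
  also have "\<dots> = (if Suc i + j = n then (- 1) ^ (n + Suc i - 1) * \<alpha> v else 0)"
    using step.IH[of "Suc j"] step.prems step.hyps \<alpha>_nonzero
    by (auto simp: \<tau>_mult \<tau>_eq_0 minus_one_power_iff \<tau>_minus)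
  finally show ?case .
qed

lemma sform_v_Xv: "i < n \<Longrightarrow> sform n v (Xv v i) = 0"
  using sform_Xv_Fj[of i 0] sform_swap[of v n "Xv v i"] by (cases "i = 0") (auto simp: sform_self)

lemma sform_Xv_Fv: "Suc i < n \<Longrightarrow> sform n (Xv v i) (F v) = 0"
  using sform_Xv_Fj[of i 1] sform_v_Fi[of 1] by (cases "i = 0") auto

text \<open>Expanding leaves <V x, V y>, a multiple of \<tau> of <x, y>, together with terms
  containing v, where <V x, v> = -\<tau>(<x, F v>).\<close>

lemma sform_Gs_Gs:
  assumes "x \<in> Car" "y \<in> Car" "sform n x y = 0" "sform n x (F v) = 0" "sform n y (F v) = 0"
  shows "sform n (Gs v x) (Gs v y) = 0"
proof -
  let ?c = "\<lambda>x. sform n (V x) ((F ^^ n) v) / \<alpha> v"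
  have 1: "sform n (V x) v = 0" "sform n v (V y) = 0"
    using assms sform_swap[of v n "V y"] by (simp_all add: sform_V_left)
  have "sform n (V x - ?c x \<cdot>\<^sub>v v) (V y - ?c y \<cdot>\<^sub>v v) = 0"
    using assms 1 by (simp add: sform_minus_left sform_minus_right sform_smult_left sform_smult_right
        sform_V_V sform_self)
  then show ?thesis unfolding Gstep_def using assms by (simp add: sform_smult_left sform_smult_right)
qed

lemma sform_Xv_X: "i < n \<Longrightarrow> j < n \<Longrightarrow> sform n (Xv v i) (Xv v j) = 0"
proof (induction i arbitrary: j)
  case 0
  then show ?case by (simp add: sform_v_Xv)
next
  case (Suc i)
  show ?case
  proof (cases j)
    case 0
    then show ?thesis using Suc.prems sform_v_Xv[of "Suc i"] sform_swap[of "Xv v (Suc i)" n v] by simp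
  next
    case (Suc j')
    then show ?thesis using Suc.prems Suc.IH[of j'] sform_Xv_Fv[of i] sform_Xv_Fv[of j']
      by (simp add: Xv_Suc sform_smult_left sform_smult_right sform_Gs_Gs)
  qed
qed

lemma base_gram_le:
  assumes "i \<le> j" "j < 2 * n"
  shows "sform n (base v i) (base v j) = - \<alpha> v * (if i + j = 2 * n - 1 then (- 1) ^ j else 0)"
proof -
  consider "j < n" | "i < n" "n \<le> j" "j < 2 * n - 1" | "i < n" "j = 2 * n - 1"
    | "n \<le> i" "j < 2 * n - 1" | "n \<le> i" "i < 2 * n - 1" "j = 2 * n - 1" | "n \<le> i" "i = 2 * n - 1" "j = 2 * n - 1"
    using assms by linarith
  then show ?thesis
  proof cases
    case 1
    then show ?thesis using assms sform_Fi_Fj[of i j] by (simp add: base_def)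
  next
    case 2
    let ?l = "j - n + 1"
    have "sform n (base v i) (base v j) = - sform n (Xv v ?l) ((F ^^ i) v)"
      using 2 sform_swap[of "(F ^^ i) v" n "Xv v ?l"] by (simp add: base_def)
    also have "\<dots> = - (if ?l + i = n then (- 1) ^ (n + ?l - 1) * \<alpha> v else 0)"
      using 2 by (subst sform_Xv_Fj) auto
    also have "?l + i = n \<longleftrightarrow> i + j = 2 * n - 1" using 2 by linarith
    also have "n + ?l - 1 = j" using 2 by linarith
    finally show ?thesis by simp
  next
    case 3
    then have "sform n (base v i) (base v j) = sform n ((F ^^ i) v) ((F ^^ n) v)"
      by (auto simp: base_def)
    then show ?thesis using 3 sform_Fi_Fj[of i n] n1 by (cases "i = 0") (auto simp: alpha_def minus_one_power_iff)
  next
    case 4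
    then show ?thesis using assms sform_Xv_X[of "i - n + 1" "j - n + 1"] by (auto simp: base_def)
  next
    case 5
    then show ?thesis using sform_Xv_Fj[of "i - n + 1" n] by (auto simp: base_def)
  next
    case 6
    then show ?thesis using n1 sform_self[of "(F ^^ n) v" n] by (auto simp: base_def)
  qed
qed

lemma base_gram:
  assumes "i < 2 * n" "j < 2 * n"
  shows "sform n (base v i) (base v j) = - \<alpha> v * (if i + j = 2 * n - 1 then (- 1) ^ j else 0)"
proof (cases "i \<le> j")
  case False
  have "sform n (base v i) (base v j) = - sform n (base v j) (base v i)"
    by (rule sform_swap) (auto intro!: base_carrier vC)
  also have "\<dots> = \<alpha> v * (if i + j = 2 * n - 1 then (- 1) ^ i else 0)"
    using False assms by (simp add: base_gram_le add.commute)
  also have "\<dots> = - \<alpha> v * (if i + j = 2 * n - 1 then (- 1) ^ j else 0)"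
  \<comment> \<open>An odd index sum forces i and j to have opposite parity, which absorbs the sign
    produced by exchanging the arguments.\<close>
  proof (cases "i + j = 2 * n - 1")
    case True
    then have "odd (i + j)" using n1 by simp
    then show ?thesis by (auto simp: minus_one_power_iff)
  qed simp
  finally show ?thesis .
qed (use base_gram_le assms in auto)

lemma gm_simil: "is_simil n (- (\<pi> ^ (n * r) * \<alpha> v)) (gm r v)"
proof (rule is_similI)
  show "- (\<pi> ^ (n * r) * \<alpha> v) \<noteq> 0" using \<pi>0 \<alpha>_nonzero by simp
  fix i j assume ij: "i < 2 * n" "j < 2 * n"
  have "sform n (col (gm r v) i) (col (gm r v) j)
      = \<pi> ^ (dexp n i * r) * \<pi> ^ (dexp n j * r) * (- \<alpha> v * (if i + j = 2 * n - 1 then (- 1) ^ j else 0))"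
    using ij by (simp add: gm_col sform_smult_left sform_smult_right base_gram)
  also have "\<dots> = - (\<pi> ^ (n * r) * \<alpha> v) * (if i + j = 2 * n - 1 then (- 1) ^ j else 0)"
  proof (cases "i + j = 2 * n - 1")
    case True
    then have "dexp n i + dexp n j = n" using ij by (auto simp: dexp_def)
    then have "\<pi> ^ (dexp n i * r) * \<pi> ^ (dexp n j * r) = \<pi> ^ (n * r)"
      by (metis power_add distrib_right)
    then show ?thesis by simp
  qed simp
  finally show "sform n (col (gm r v) i) (col (gm r v) j)
    = - (\<pi> ^ (n * r) * \<alpha> v) * (if i + j = 2 * n - 1 then (- 1) ^ j else 0)" .
qed simp

lemma gm_GSp: "gm r v \<in> carrier (GSp n)"
  using gm_simil by (auto simp: GSp_iff)

end

end

section \<open>The matrix w_r in coordinates\<close>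

context symp_frob
begin

abbreviation W :: "nat \<Rightarrow> 'a mat" where "W \<equiv> wmat n \<pi> k"

text \<open>The monomial matrix w_r is read by rows, because its action on a vector is then a
  substitution: entry i of the image is \<open>wcoef r i\<close> times entry
  \<open>wrow i\<close>.\<close>

definition wrow :: "nat \<Rightarrow> nat" where
  "wrow i = (if i = 0 then n else if i < n then i - 1 else if i < 2 * n - 1 then i + 1 else n - 1)"

definition wcoef :: "nat \<Rightarrow> nat \<Rightarrow> 'a" where
  "wcoef r i = (if i = 0 then (- 1) ^ (n + 1) * \<pi> ^ (r + k)
     else if n \<le> i \<and> i < 2 * n - 1 then \<pi> ^ (r + k) else inverse (\<pi> ^ r))"

lemma W_carrier [simp]: "W r \<in> carrier_mat (2 * n) (2 * n)"
proof -
  have "length [1..<n] + (1 + (1 + length [2..<n + 1])) = 2 * n" using n1 by auto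
  then show ?thesis unfolding wmat_def
    by (intro mat_of_cols_carrier(1)[THEN back_subst[of "\<lambda>m. _ \<in> carrier_mat _ m"]]) simp
qed

lemma W_index:
  assumes i: "i < 2 * n" and j: "j < 2 * n"
  shows "W r $$ (i, j) = (if j = wrow i then wcoef r i else 0)"
proof -
  let ?L1 = "map (\<lambda>i. inverse (\<pi> ^ r) \<cdot>\<^sub>v unit_vec (2 * n) i) [1..<n] :: 'a vec list"
  let ?L2 = "[inverse (\<pi> ^ r) \<cdot>\<^sub>v unit_vec (2 * n) (2 * n - 1)] :: 'a vec list"
  let ?L3 = "[((- 1) ^ (n + 1) * \<pi> ^ (r + k)) \<cdot>\<^sub>v unit_vec (2 * n) 0] :: 'a vec list"
  let ?L4 = "map (\<lambda>i. \<pi> ^ (r + k) \<cdot>\<^sub>v unit_vec (2 * n) (n + i - 2)) [2..<n + 1] :: 'a vec list"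
  have "W r $$ (i, j) = (?L1 @ ?L2 @ ?L3 @ ?L4) ! j $ i"
    unfolding wmat_def by (rule mat_of_cols_index) (use i j n1 in auto)
  also have "\<dots> = (if j = wrow i then wcoef r i else 0)"
  proof -
    consider "j < n - 1" | "j = n - 1" | "j = n" | "n < j" by linarith
    then show ?thesis
    proof cases
      case 1
      then have "(?L1 @ ?L2 @ ?L3 @ ?L4) ! j = inverse (\<pi> ^ r) \<cdot>\<^sub>v unit_vec (2 * n) (j + 1)"
        by (simp add: nth_append)
      moreover have "j = wrow i \<longleftrightarrow> i = j + 1" using 1 i by (auto simp: wrow_def)
      ultimately show ?thesis using 1 i by (auto simp: unit_vec_def wcoef_def)
    next
      case 2
      then have "(?L1 @ ?L2 @ ?L3 @ ?L4) ! j = inverse (\<pi> ^ r) \<cdot>\<^sub>v unit_vec (2 * n) (2 * n - 1)"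
        by (simp add: nth_append)
      moreover have "j = wrow i \<longleftrightarrow> i = 2 * n - 1" using 2 i n1 by (auto simp: wrow_def split: if_splits)
      ultimately show ?thesis using 2 i n1 by (auto simp: unit_vec_def wcoef_def)
    next
      case 3
      then have "j - (n - 1) = Suc 0" "\<not> j < n - 1" using n1 by auto
      then have "(?L1 @ ?L2 @ ?L3 @ ?L4) ! j = ((- 1) ^ (n + 1) * \<pi> ^ (r + k)) \<cdot>\<^sub>v unit_vec (2 * n) 0"
        by (simp add: nth_append)
      moreover have "j = wrow i \<longleftrightarrow> i = 0" using 3 i n1 by (auto simp: wrow_def split: if_splits)
      ultimately show ?thesis using 3 i by (auto simp: unit_vec_def wcoef_def)
    next
      case 4
      then have "j - (n - 1) = Suc (Suc (j - (n + 1)))" "\<not> j < n - 1" "j - (n + 1) < n - 1"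
        "n + (2 + (j - (n + 1))) - 2 = j - 1" using n1 j by auto
      then have "(?L1 @ ?L2 @ ?L3 @ ?L4) ! j = \<pi> ^ (r + k) \<cdot>\<^sub>v unit_vec (2 * n) (j - 1)"
        by (simp add: nth_append del: upt_Suc)
      moreover have "j = wrow i \<longleftrightarrow> i = j - 1" using 4 i j n1 by (auto simp: wrow_def split: if_splits)
      ultimately show ?thesis using 4 i j by (auto simp: unit_vec_def wcoef_def)
    qed
  qed
  finally show ?thesis .
qed

lemma wrow_less: "i < 2 * n \<Longrightarrow> wrow i < 2 * n"
  using n1 by (auto simp: wrow_def)

lemma bij_wrow: "bij_betw wrow {..<2 * n} {..<2 * n}"
proof -
  have "inj_on wrow {..<2 * n}" by (auto simp: inj_on_def wrow_def split: if_splits)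
  moreover have "wrow ` {..<2 * n} \<subseteq> {..<2 * n}" using wrow_less by auto
  ultimately show ?thesis by (metis bij_betw_def card_image card_subset_eq finite_lessThan)
qed

lemma W_mult_vec_index:
  assumes "x \<in> Car" "i < 2 * n"
  shows "(W r *\<^sub>v x) $ i = wcoef r i * x $ wrow i"
proof -
  have "(W r *\<^sub>v x) $ i = (\<Sum>l<2 * n. W r $$ (i, l) * x $ l)"
    by (rule mult_mat_vec_sum[OF W_carrier assms])
  also have "\<dots> = (\<Sum>l<2 * n. if l = wrow i then wcoef r i * x $ wrow i else 0)"
    using assms by (intro sum.cong) (auto simp: W_index)
  also have "\<dots> = wcoef r i * x $ wrow i" using wrow_less[OF assms(2)] by simp
  finally show ?thesis .
qed

lemma W_col_sform:
  assumes x: "x \<in> Car" and y: "y \<in> Car"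
  shows "sform n (W r *\<^sub>v x) (W r *\<^sub>v y) = - (\<pi> ^ k) * sform n x y"
proof -
  have Wc: "W r *\<^sub>v x \<in> Car" "W r *\<^sub>v y \<in> Car"
    using mult_mat_vec_carrier[OF W_carrier] x y by auto
  let ?f = "\<lambda>i. - (\<pi> ^ k) * ((- 1) ^ Suc i * x $ i * y $ (2 * n - 1 - i))"
  have "sform n (W r *\<^sub>v x) (W r *\<^sub>v y) = (\<Sum>i<2 * n. ?f (wrow i))"
    unfolding sform_sum[OF Wc]
  proof (rule sum.cong)
    fix i assume "i \<in> {..<2 * n}"
    then have i: "i < 2 * n" by simp
    have s: "wrow (2 * n - 1 - i) = 2 * n - 1 - wrow i"
      using i n1 by (auto simp: wrow_def)
    \<comment> \<open>Paired rows have coefficients with product \<pi>^k up to sign. Passing from i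
      to \<open>wrow i\<close> changes the index by one, except in the first and last row, where it
      changes by n; the sign (-1)^(n+1) in w_r compensates for that.\<close>
    have c: "(- 1) ^ Suc i * (wcoef r i * wcoef r (2 * n - 1 - i)) = - (\<pi> ^ k) * (- 1) ^ Suc (wrow i)"
    proof -
      have p: "\<pi> ^ (r + k) * inverse (\<pi> ^ r) = \<pi> ^ k" "inverse (\<pi> ^ r) * \<pi> ^ (r + k) = \<pi> ^ k"
        using \<pi>0 by (simp_all add: power_add)
      consider "i = 0" | "0 < i" "i < n" | "n \<le> i" "i < 2 * n - 1" | "i = 2 * n - 1" "i \<noteq> 0" using i by linarith
      then show ?thesis
      proof cases
        case 1
        then have "\<not> (2 * n - 1 - i < n \<or> 2 * n - 1 - i = 0)" using n1 by auto
        then have "wcoef r (2 * n - 1 - i) = inverse (\<pi> ^ r)" using 1 by (auto simp: wcoef_def)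
        then show ?thesis using 1 p by (simp add: wcoef_def wrow_def)
      next
        case 2
        then have "wcoef r i = inverse (\<pi> ^ r)" "wcoef r (2 * n - 1 - i) = \<pi> ^ (r + k)" "wrow i = i - 1"
          by (auto simp: wcoef_def wrow_def)
        then show ?thesis using 2 p by (simp only:) (auto simp: minus_one_power_iff)
      next
        case 3
        then have "wcoef r i = \<pi> ^ (r + k)" "wcoef r (2 * n - 1 - i) = inverse (\<pi> ^ r)" "wrow i = i + 1"
          by (auto simp: wcoef_def wrow_def)
        then show ?thesis using p by (simp only:) (auto simp: minus_one_power_iff)
      next
        case 4
        then have "wcoef r i = inverse (\<pi> ^ r)" "wcoef r (2 * n - 1 - i) = (- 1) ^ (n + 1) * \<pi> ^ (r + k)" "wrow i = n - 1"
          using n1 by (auto simp: wcoef_def wrow_def)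
        then show ?thesis using 4 p n1 by (simp only:) (auto simp: minus_one_power_iff algebra_simps)
      qed
    qed
    have "(- 1) ^ Suc i * (W r *\<^sub>v x) $ i * (W r *\<^sub>v y) $ (2 * n - 1 - i)
        = ((- 1) ^ Suc i * (wcoef r i * wcoef r (2 * n - 1 - i))) * (x $ wrow i * y $ wrow (2 * n - 1 - i))"
      using i W_mult_vec_index[OF x i] W_mult_vec_index[OF y, of "2 * n - 1 - i"] by simp
    also have "\<dots> = ?f (wrow i)" unfolding c s by (simp add: algebra_simps)
    finally show "(- 1) ^ Suc i * (W r *\<^sub>v x) $ i * (W r *\<^sub>v y) $ (2 * n - 1 - i) = ?f (wrow i)" .
  qed simp
  also have "\<dots> = (\<Sum>i<2 * n. ?f i)"
    by (rule sum.reindex_bij_betw[OF bij_wrow])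
  also have "\<dots> = - (\<pi> ^ k) * sform n x y"
    unfolding sform_sum[OF x y] sum_distrib_left ..
  finally show ?thesis .
qed

lemma W_simil: "is_simil n (- (\<pi> ^ k)) (W r)"
proof (rule is_similI)
  fix i j assume ij: "i < 2 * n" "j < 2 * n"
  have "sform n (col (W r) i) (col (W r) j)
      = sform n (W r *\<^sub>v unit_vec (2 * n) i) (W r *\<^sub>v unit_vec (2 * n) j)"
    using ij by (simp add: mat_mult_unit_vec[OF W_carrier])
  then show "sform n (col (W r) i) (col (W r) j) = - (\<pi> ^ k) * (if i + j = 2 * n - 1 then (- 1) ^ j else 0)"
    using ij by (simp add: W_col_sform sform_unit_unit)
qed (use \<pi>0 in auto)

text \<open>This is \<pi>^(r+k) times the inverse of w_r, hence the permutation part of \<pi>^r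
  V.\<close>

definition ush :: "nat \<Rightarrow> 'a vec \<Rightarrow> 'a vec" where
  "ush r x = vec (2 * n) (\<lambda>j. if j < n - 1 then \<pi> ^ (2 * r + k) * x $ (j + 1)
     else if j = n - 1 then \<pi> ^ (2 * r + k) * x $ (2 * n - 1)
     else if j = n then (- 1) ^ (n + 1) * x $ 0 else x $ (j - 1))"

lemma ush_carrier [simp]: "ush r x \<in> Car"
  by (simp add: ush_def)

lemma W_ush:
  assumes x: "x \<in> Car"
  shows "W r *\<^sub>v ush r x = \<pi> ^ (r + k) \<cdot>\<^sub>v x"
proof (rule eq_vecI)
  fix i assume "i < dim_vec (\<pi> ^ (r + k) \<cdot>\<^sub>v x)"
  then have i: "i < 2 * n" using x by simp
  have p: "inverse (\<pi> ^ r) * (\<pi> ^ (2 * r + k) * y) = \<pi> ^ (r + k) * y" for y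
    using \<pi>0 by (simp add: power_add mult_2)
  have sgn: "(- 1) ^ n * ((- 1) ^ n * y) = y" for y :: 'a
    by (auto simp: minus_one_power_iff)
  consider "i = 0" | "0 < i" "i < n" | "n \<le> i" "i < 2 * n - 1" | "i = 2 * n - 1" "i \<noteq> 0" using i by linarith
  then have "wcoef r i * ush r x $ wrow i = \<pi> ^ (r + k) * x $ i"
  proof cases
    case 1
    then have "wrow i = n" "ush r x $ n = (- 1) ^ (n + 1) * x $ 0" using n1 by (auto simp: wrow_def ush_def)
    then show ?thesis using 1 by (simp add: wcoef_def sgn algebra_simps)
  next
    case 2
    then have "wrow i = i - 1" "ush r x $ (i - 1) = \<pi> ^ (2 * r + k) * x $ i" by (auto simp: wrow_def ush_def)
    then show ?thesis using 2 p by (simp add: wcoef_def)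
  next
    case 3
    then have "wrow i = i + 1" "ush r x $ (i + 1) = x $ i" using n1 by (auto simp: wrow_def ush_def)
    then show ?thesis using 3 n1 by (simp add: wcoef_def)
  next
    case 4
    then have "wrow i = n - 1" "ush r x $ (n - 1) = \<pi> ^ (2 * r + k) * x $ i" "wcoef r i = inverse (\<pi> ^ r)"
      using n1 by (auto simp: wrow_def ush_def wcoef_def)
    then show ?thesis using p by simp
  qed
  then show "(W r *\<^sub>v ush r x) $ i = (\<pi> ^ (r + k) \<cdot>\<^sub>v x) $ i"
    using W_mult_vec_index[OF ush_carrier i] i x by simp
qed (use x carrier_matD[OF W_carrier[of r]] in auto)

lemma V_smult: "x \<in> Car \<Longrightarrow> V (c \<cdot>\<^sub>v x) = \<tau> c \<cdot>\<^sub>v V x"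
  by (rule F_inj) (simp_all add: F_V F_smult smult_smult_assoc mult.commute[of "\<pi> ^ k"])

end

section \<open>Frobenius and Verschiebung acting on column types\<close>

locale frob_type = symp_frob n k \<sigma> \<pi> b + coltype n D up low
  for n k :: nat and \<sigma> :: "'a::field \<Rightarrow> 'a" and \<pi> :: 'a and b :: "'a mat" and D up low :: "'a set" +
  fixes r :: nat
  assumes c_low: "\<And>x. x \<in> low \<Longrightarrow> \<pi> ^ (2 * r + k) * x \<in> up \<inter> low"
    and c_up: "\<And>x. x \<in> up \<Longrightarrow> \<pi> ^ (2 * r + k) * x \<in> up"
    and \<sigma>_D: "\<And>x. \<sigma> x \<in> D \<longleftrightarrow> x \<in> D" and \<sigma>_up: "\<And>x. \<sigma> x \<in> up \<longleftrightarrow> x \<in> up"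
    and \<sigma>_low: "\<And>x. \<sigma> x \<in> low \<longleftrightarrow> x \<in> low"
begin

lemma \<tau>_D: "\<tau> x \<in> D \<longleftrightarrow> x \<in> D" and \<tau>_up: "\<tau> x \<in> up \<longleftrightarrow> x \<in> up" and \<tau>_low: "\<tau> x \<in> low \<longleftrightarrow> x \<in> low"
  using \<sigma>_D[of "\<tau> x"] \<sigma>_up[of "\<tau> x"] \<sigma>_low[of "\<tau> x"] by auto

lemma col_typ_\<sigma>: "col_typ j x \<Longrightarrow> col_typ j (map_vec \<sigma> x)"
  by (auto simp: col_typ_def \<sigma>_D \<sigma>_up \<sigma>_low)

lemma col_typ_\<tau>: "col_typ j x \<Longrightarrow> col_typ j (map_vec \<tau> x)"
  by (auto simp: col_typ_def \<tau>_D \<tau>_up \<tau>_low)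

lemma sign_up: "x \<in> up \<Longrightarrow> (- 1) ^ i * x \<in> up" and sign_low: "x \<in> low \<Longrightarrow> (- 1) ^ i * x \<in> low"
  using up_minus low_minus by (auto simp: minus_one_power_iff)

lemma sh_index:
  assumes y: "y \<in> Car" and i: "i < 2 * n"
  shows "(\<pi> ^ r \<cdot>\<^sub>v (W r *\<^sub>v y)) $ i = (if i = 0 then (- 1) ^ (n + 1) * (\<pi> ^ (2 * r + k) * y $ n)
    else if i < n then y $ (i - 1) else if i < 2 * n - 1 then \<pi> ^ (2 * r + k) * y $ (i + 1) else y $ (n - 1))"
proof -
  have "(\<pi> ^ r \<cdot>\<^sub>v (W r *\<^sub>v y)) $ i = \<pi> ^ r * (wcoef r i * y $ wrow i)"
    using i carrier_matD[OF W_carrier[of r]] W_mult_vec_index[OF y i] by simp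
  then show ?thesis using \<pi>0 i n1
    by (auto simp: wcoef_def wrow_def power_add mult_2)
qed

text \<open>\<pi>^r w_r moves the diagonal position along 0, 1, ..., n - 1, 2n - 1. The entries 0
  and n, ..., 2n - 2 of the image come from entries below the diagonal and may have to lie above it;
  these are exactly the ones multiplied by \<pi>^(2r+k), which \<open>c_low\<close> requires to send
  \<open>low\<close> into \<open>up\<close>.\<close>

lemma sh_typ:
  assumes y: "col_typ j y" and j: "j < n"
  shows "col_typ (if j = n - 1 then 2 * n - 1 else j + 1) (\<pi> ^ r \<cdot>\<^sub>v (W r *\<^sub>v y))" (is "col_typ ?t ?z")
proof -
  note ys = col_typD[OF y]
  have z: "?z $ i = (if i = 0 then (- 1) ^ (n + 1) * (\<pi> ^ (2 * r + k) * y $ n)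
    else if i < n then y $ (i - 1) else if i < 2 * n - 1 then \<pi> ^ (2 * r + k) * y $ (i + 1) else y $ (n - 1))"
    if "i < 2 * n" for i by (rule sh_index[OF ys(1) that])
  have "(i = ?t \<longrightarrow> ?z $ i \<in> D) \<and> (i < ?t \<longrightarrow> ?z $ i \<in> up) \<and> (?t < i \<longrightarrow> ?z $ i \<in> low)"
    if i: "i < 2 * n" for i
  proof -
    consider "i = 0" | "0 < i" "i < n" | "n \<le> i" "i < 2 * n - 1" | "i = 2 * n - 1" "i \<noteq> 0" using i by linarith
    then show ?thesis
    proof cases
      case 1
      have "?z $ i \<in> up" unfolding z[OF i] using 1 ys(4)[of n] j n1 c_low[of "y $ n"]
          sign_up[of "\<pi> ^ (2 * r + k) * y $ n" "n + 1"] by simp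
      then show ?thesis using 1 n1 by simp
    next
      case 2
      have zi: "?z $ i = y $ (i - 1)" unfolding z[OF i] using 2 by simp
      show ?thesis
      proof (cases "j = n - 1")
        case True
        then have "y $ (i - 1) \<in> up" using 2 by (intro ys(3)) auto
        then show ?thesis unfolding zi using True 2 by auto
      next
        case False
        then have t: "?t = j + 1" by simp
        consider "i - 1 < j" | "i - 1 = j" | "j < i - 1" by linarith
        then show ?thesis unfolding zi t using 2 i ys(2) ys(3)[of "i - 1"] ys(4)[of "i - 1"]
          by cases auto
      qed
    next
      case 3
      have "?z $ i = \<pi> ^ (2 * r + k) * y $ (i + 1)" unfolding z[OF i] using 3 n1 by simp
      moreover have "y $ (i + 1) \<in> low" using 3 j by (intro ys(4)) auto
      ultimately have "?z $ i \<in> up" "?z $ i \<in> low" using c_low by auto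
      moreover have "i \<noteq> ?t" using 3 j by auto
      ultimately show ?thesis by blast
    next
      case 4
      have zi: "?z $ i = y $ (n - 1)" unfolding z[OF i] using 4 n1 by auto
      show ?thesis
      proof (cases "j = n - 1")
        case True
        then show ?thesis unfolding zi using 4 ys(2) j by simp
      next
        case False
        then have "y $ (n - 1) \<in> low" using j by (intro ys(4)) auto
        then show ?thesis unfolding zi using 4 False j by auto
      qed
    qed
  qed
  moreover have "?z \<in> Car" using mult_mat_vec_carrier[OF W_carrier ys(1)] by simp
  ultimately show ?thesis unfolding col_typ_def by blast
qed

text \<open>V moves the diagonal position from 0 to n and from there upwards one by one, the order
  in which the G_i occupy the columns. The sign is the one in the definition of G_1; it cancels the
  sign in w_r.\<close>

lemma ush_typ_0:
  assumes x: "col_typ 0 x"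
  shows "col_typ n ((- 1) ^ (n + 1) \<cdot>\<^sub>v ush r x)"
proof -
  note xs = col_typD[OF x]
  let ?z = "(- 1) ^ (n + 1) \<cdot>\<^sub>v ush r x"
  have "(i = n \<longrightarrow> ?z $ i \<in> D) \<and> (i < n \<longrightarrow> ?z $ i \<in> up) \<and> (n < i \<longrightarrow> ?z $ i \<in> low)"
    if i: "i < 2 * n" for i
  proof -
    have z: "?z $ i = (- 1) ^ (n + 1) * ush r x $ i" using i ush_carrier[of r x] by (simp add: ush_def)
    have sgn: "(- 1) ^ (n + 1) * ((- 1) ^ (n + 1) * y) = y" for y :: 'a by (auto simp: minus_one_power_iff)
    consider "i < n - 1" | "i = n - 1" | "i = n" | "n < i" by linarith
    then show ?thesis
    proof cases
      case 1
      then have "ush r x $ i = \<pi> ^ (2 * r + k) * x $ (i + 1)" using i by (simp add: ush_def)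
      then show ?thesis using 1 i xs(4)[of "i + 1"] c_low[of "x $ (i + 1)"] sign_up[of "ush r x $ i" "n + 1"] unfolding z by auto
    next
      case 2
      then have "ush r x $ i = \<pi> ^ (2 * r + k) * x $ (2 * n - 1)" using i by (simp add: ush_def)
      then show ?thesis using 2 i n1 xs(4)[of "2 * n - 1"] c_low[of "x $ (2 * n - 1)"] sign_up[of "ush r x $ i" "n + 1"] unfolding z by auto
    next
      case 3
      then have "ush r x $ i = (- 1) ^ (n + 1) * x $ 0" using i n1 by (auto simp: ush_def)
      then show ?thesis using 3 i n1 xs(2) unfolding z by (simp only: sgn) auto
    next
      case 4
      then have "ush r x $ i = x $ (i - 1)" using i by (auto simp: ush_def)
      then show ?thesis using 4 i n1 xs(4)[of "i - 1"] sign_low[of "ush r x $ i" "n + 1"] unfolding z by auto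
    qed
  qed
  moreover have "?z \<in> Car" by simp
  ultimately show ?thesis unfolding col_typ_def by blast
qed

lemma ush_typ:
  assumes x: "col_typ j x" and j: "n \<le> j" "j < 2 * n - 1"
  shows "col_typ (j + 1) (ush r x)"
proof -
  note xs = col_typD[OF x]
  let ?z = "ush r x"
  have "(i = j + 1 \<longrightarrow> ?z $ i \<in> D) \<and> (i < j + 1 \<longrightarrow> ?z $ i \<in> up) \<and> (j + 1 < i \<longrightarrow> ?z $ i \<in> low)"
    if i: "i < 2 * n" for i
  proof -
    consider "i < n - 1" | "i = n - 1" | "i = n" | "n < i" by linarith
    then show ?thesis
    proof cases
      case 1
      then have "?z $ i = \<pi> ^ (2 * r + k) * x $ (i + 1)" using i by (simp add: ush_def)
      then show ?thesis using 1 i j xs(3)[of "i + 1"] c_up[of "x $ (i + 1)"] by auto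
    next
      case 2
      then have "?z $ i = \<pi> ^ (2 * r + k) * x $ (2 * n - 1)" using i by (simp add: ush_def)
      then show ?thesis using 2 i j xs(4)[of "2 * n - 1"] c_low[of "x $ (2 * n - 1)"] by auto
    next
      case 3
      then have "?z $ i = (- 1) ^ (n + 1) * x $ 0" using i n1 by (auto simp: ush_def)
      then show ?thesis using 3 j xs(3)[of 0] sign_up[of "x $ 0" "n + 1"] n1 by (simp del: power_Suc)
    next
      case 4
      then have "?z $ i = x $ (i - 1)" using i by (auto simp: ush_def)
      then show ?thesis using 4 i j xs(2) xs(3)[of "i - 1"] xs(4)[of "i - 1"] by auto
    qed
  qed
  then show ?thesis using ush_carrier[of r x] unfolding col_typ_def by blast
qed

text \<open>For j > 0 the entry \<open>y $ 0\<close> lies above the diagonal, so even the summand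
  containing the diagonal entry of z falls into \<open>up\<close>.\<close>

lemma sform_typ_up:
  assumes y: "col_typ j y" "0 < j" and z: "col_typ (2 * n - 1) z"
  shows "sform n y z \<in> up"
proof -
  note ys = col_typD[OF y(1)] and zs = col_typD[OF z]
  show ?thesis unfolding sform_sum[OF ys(1) zs(1)]
  proof (rule up_sum)
    fix i assume "i \<in> {..<2 * n}"
    then have i: "i < 2 * n" by simp
    have "y $ i * z $ (2 * n - 1 - i) \<in> up"
    proof (cases "i = 0")
      case True
      then have "z $ (2 * n - 1 - i) * y $ i \<in> up" using zs(2) ys(3)[of 0] y(2) n1 D_up by auto
      then show ?thesis by (simp add: mult.commute)
    next
      case False
      then have zu: "z $ (2 * n - 1 - i) \<in> up" using i by (intro zs(3)) auto
      consider "i < j" | "i = j" | "j < i" by linarith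
      then show ?thesis
      proof cases
        case 1
        then show ?thesis using ys(3)[of i] i zu up_up by auto
      next
        case 2
        then show ?thesis using ys(2) i zu D_up by auto
      next
        case 3
        then have "z $ (2 * n - 1 - i) * y $ i \<in> up" using ys(4)[of i] i zu up_low by auto
        then show ?thesis by (simp add: mult.commute)
      qed
    qed
    then show "(- 1) ^ Suc i * y $ i * z $ (2 * n - 1 - i) \<in> up"
      using sign_up[of "y $ i * z $ (2 * n - 1 - i)" "Suc i"] by (simp only: mult.assoc)
  qed
qed

text \<open>The entry at 0, where \<open>x\<close> is not small, lies above the diagonal of type j >
  0; all other entries change by a product of an upper and a lower element.\<close>

lemma col_typ_minus_smult:
  assumes y: "col_typ j y" "0 < j" "j < 2 * n" and x: "col_typ 0 x" and c: "c \<in> up"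
  shows "col_typ j (y - c \<cdot>\<^sub>v x)"
proof -
  note ys = col_typD[OF y(1)] and xs = col_typD[OF x]
  have "(i = j \<longrightarrow> (y - c \<cdot>\<^sub>v x) $ i \<in> D) \<and> (i < j \<longrightarrow> (y - c \<cdot>\<^sub>v x) $ i \<in> up) \<and>
      (j < i \<longrightarrow> (y - c \<cdot>\<^sub>v x) $ i \<in> low)" if i: "i < 2 * n" for i
  proof -
    have e: "(y - c \<cdot>\<^sub>v x) $ i = y $ i + c * - (x $ i)" using i ys(1) xs(1) by simp
    show ?thesis
    proof (cases "i = 0")
      case True
      then have "x $ i * c \<in> up" using xs(2) n1 c D_up by auto
      then have "y $ i - x $ i * c \<in> up" using True ys(3)[of i] y(2) n1 up_diff by auto
      then show ?thesis using True y(2) unfolding e by (simp add: mult.commute)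
    next
      case False
      then have l: "- (x $ i) \<in> low" using xs(4)[of i] i low_minus by auto
      then have "c * - (x $ i) \<in> up" "c * - (x $ i) \<in> low" using up_low[OF c] by blast+
      then show ?thesis unfolding e
        by (intro conjI impI D_add[OF _ c l] up_add low_add) (use i ys(2,3,4) in auto)
    qed
  qed
  then show ?thesis using ys(1) xs(1) unfolding col_typ_def by auto
qed

lemma col_typ_smult:
  assumes c: "c \<in> D" and x: "col_typ j x"
  shows "col_typ j (c \<cdot>\<^sub>v x)"
  using col_typD[OF x] c D_mult[OF c] D_up[OF c] D_low[OF c] unfolding col_typ_def by auto

context
  fixes g A :: "'a mat" and l :: 'a
  assumes g: "is_simil n l g" and A: "A \<in> H"
    and rel: "b * map_mat \<sigma> g = g * (W r * A)"
begin

lemma gC: "g \<in> carrier_mat (2 * n) (2 * n)" and AC: "A \<in> carrier_mat (2 * n) (2 * n)"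
  using is_simil_carrier[OF g] H_carrier[OF A] by auto

text \<open>Types are measured in the basis formed by the columns of g, in which F acts as w_r A
  \<sigma> by \<open>rel\<close>.\<close>

definition gT :: "nat \<Rightarrow> 'a vec \<Rightarrow> bool" where
  "gT j y \<longleftrightarrow> (\<exists>x. col_typ j x \<and> y = g *\<^sub>v x)"

lemma gT_carrier: "gT j y \<Longrightarrow> y \<in> Car"
  using gC by (auto simp: gT_def dest: col_typD(1))

lemma F_g:
  assumes x: "x \<in> Car"
  shows "F (g *\<^sub>v x) = g *\<^sub>v (W r *\<^sub>v (A *\<^sub>v map_vec \<sigma> x))"
proof -
  have mx: "map_vec \<sigma> x \<in> Car" using x by simp
  have Ax: "A *\<^sub>v map_vec \<sigma> x \<in> Car" using AC mx by simp
  have gs: "map_mat \<sigma> g \<in> carrier_mat (2 * n) (2 * n)" using gC by simp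
  have "F (g *\<^sub>v x) = (b * map_mat \<sigma> g) *\<^sub>v map_vec \<sigma> x"
    unfolding Frob_def \<sigma>.mult_mat_vec_hom[OF gC x] by (rule assoc_mult_mat_vec[OF b_carrier gs mx, symmetric])
  also have "\<dots> = g *\<^sub>v ((W r * A) *\<^sub>v map_vec \<sigma> x)"
    unfolding rel by (rule assoc_mult_mat_vec[OF gC mult_carrier_mat[OF W_carrier AC] mx])
  also have "(W r * A) *\<^sub>v map_vec \<sigma> x = W r *\<^sub>v (A *\<^sub>v map_vec \<sigma> x)"
    by (rule assoc_mult_mat_vec[OF W_carrier AC mx])
  finally show ?thesis .
qed

lemma gT_F:
  assumes y: "gT j y" and j: "j < n"
  shows "gT (if j = n - 1 then 2 * n - 1 else j + 1) (\<pi> ^ r \<cdot>\<^sub>v F y)"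
proof -
  obtain x where x: "col_typ j x" "y = g *\<^sub>v x" using y by (auto simp: gT_def)
  have xC: "x \<in> Car" using x(1) by (rule col_typD)
  have Ax: "col_typ j (A *\<^sub>v map_vec \<sigma> x)" using H_typ[OF A col_typ_\<sigma>[OF x(1)]] j by simp
  have WC: "W r *\<^sub>v (A *\<^sub>v map_vec \<sigma> x) \<in> Car" using mult_mat_vec_carrier[OF W_carrier col_typD(1)[OF Ax]] .
  have "\<pi> ^ r \<cdot>\<^sub>v F y = g *\<^sub>v (\<pi> ^ r \<cdot>\<^sub>v (W r *\<^sub>v (A *\<^sub>v map_vec \<sigma> x)))"
    unfolding x(2) F_g[OF xC] by (rule mult_mat_vec[OF gC WC, symmetric])
  then show ?thesis using sh_typ[OF Ax j] unfolding gT_def by blast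
qed

lemma gT_Fi:
  assumes y: "gT 0 y"
  shows "j < n \<Longrightarrow> gT j (\<pi> ^ (j * r) \<cdot>\<^sub>v (F ^^ j) y)"
proof (induction j)
  case 0
  then show ?case using y by simp
next
  case (Suc j)
  have yC: "y \<in> Car" using y by (rule gT_carrier)
  have "gT (Suc j) (\<pi> ^ r \<cdot>\<^sub>v F (\<pi> ^ (j * r) \<cdot>\<^sub>v (F ^^ j) y))"
    using gT_F[OF Suc.IH] Suc.prems by (auto split: if_splits)
  then show ?case using yC by (simp add: F_smult smult_smult_assoc power_add)
qed

lemma gT_Fn:
  assumes y: "gT 0 y"
  shows "gT (2 * n - 1) (\<pi> ^ (n * r) \<cdot>\<^sub>v (F ^^ n) y)"
proof -
  obtain j where j: "n = Suc j" using n1 by (cases n) auto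
  have yC: "y \<in> Car" using y by (rule gT_carrier)
  have "gT (2 * n - 1) (\<pi> ^ r \<cdot>\<^sub>v F (\<pi> ^ (j * r) \<cdot>\<^sub>v (F ^^ j) y))"
    using gT_F[OF gT_Fi[OF y, of j]] j by simp
  also have "\<pi> ^ r \<cdot>\<^sub>v F (\<pi> ^ (j * r) \<cdot>\<^sub>v (F ^^ j) y) = \<pi> ^ (n * r) \<cdot>\<^sub>v (F ^^ n) y"
    unfolding j using yC by (simp add: F_smult smult_smult_assoc power_add)
  finally show ?thesis .
qed

lemma l_nonzero: "l \<noteq> 0"
  using g by (rule is_simil_nonzero)

text \<open>After scaling by \<pi>^(n r), \<alpha> pairs a vector of the first column type with one
  of the last; in coordinates this pairing lies in D up to sign, and g contributes its factor
  l.\<close>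

lemma gT_\<alpha>:
  assumes y: "gT 0 y"
  obtains d where "d \<in> D" "\<pi> ^ (n * r) * \<alpha> y = - l * d"
proof -
  obtain x where x: "col_typ 0 x" "y = g *\<^sub>v x" using y by (auto simp: gT_def)
  obtain z where z: "col_typ (2 * n - 1) z" "\<pi> ^ (n * r) \<cdot>\<^sub>v (F ^^ n) y = g *\<^sub>v z"
    using gT_Fn[OF y] by (auto simp: gT_def)
  have yC: "y \<in> Car" using y by (rule gT_carrier)
  have "\<pi> ^ (n * r) * \<alpha> y = sform n y (\<pi> ^ (n * r) \<cdot>\<^sub>v (F ^^ n) y)"
    unfolding alpha_def using yC by (simp add: sform_smult_right)
  also have "\<dots> = l * sform n x z" unfolding z(2) unfolding x(2)
    by (rule sform_simil[OF g col_typD(1)[OF x(1)] col_typD(1)[OF z(1)]])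
  finally show ?thesis using that[of "- sform n x z"] sform_typ[OF x(1) z(1)] by simp
qed

lemma gT_\<alpha>_nonzero: "gT 0 y \<Longrightarrow> \<alpha> y \<noteq> 0"
  using gT_\<alpha>[of y] l_nonzero D0 by (metis mult_eq_0_iff neg_equal_0_iff_equal mult_zero_right)

lemma \<sigma>_l: obtains d where "d \<in> D" "\<sigma> l = l * d"
proof -
  obtain c where c: "is_simil n c A" using A by (auto simp: H_iff GSp_iff)
  have "is_simil n (- (\<pi> ^ k) * \<sigma> l) (b * map_mat \<sigma> g)"
    by (rule is_simil_mult[OF b is_simil_map_\<sigma>[OF g]])
  then have "- (\<pi> ^ k) * \<sigma> l = l * (- (\<pi> ^ k) * c)"
    unfolding rel using is_simil_unique[OF n1] is_simil_mult[OF g is_simil_mult[OF W_simil c]] by blast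
  then have "\<sigma> l = l * c" using \<pi>0 by simp
  then show ?thesis using that H_simil[OF A c] by blast
qed

text \<open>By \<open>gT_\<alpha>\<close>, \<alpha> y is l times an element of D up to sign and a
  power of \<pi> fixed by \<sigma>; comparing similitude factors in \<open>rel\<close> shows that
  \<sigma> changes l by an element of D as well. For D = 1 + p^(m+1) this is the condition in
  \<open>Vsymp_dot\<close>, for D = {1} it is \<sigma>-invariance of \<alpha>.\<close>

lemma \<alpha>_ratio:
  assumes y: "gT 0 y"
  shows "\<sigma> (\<alpha> y) / \<alpha> y \<in> D"
proof -
  obtain d where d: "d \<in> D" "\<pi> ^ (n * r) * \<alpha> y = - l * d" using gT_\<alpha>[OF y] .
  obtain e where e: "e \<in> D" "\<sigma> l = l * e" using \<sigma>_l .
  have "\<pi> ^ (n * r) * \<sigma> (\<alpha> y) = \<sigma> (\<pi> ^ (n * r) * \<alpha> y)" by (simp add: \<sigma>_mult)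
  also have "\<dots> = - (l * e * \<sigma> d)" unfolding d(2) by (simp add: \<sigma>_mult \<sigma>_minus e)
  finally have s: "\<pi> ^ (n * r) * \<sigma> (\<alpha> y) = - (l * e * \<sigma> d)" .
  have "\<sigma> (\<alpha> y) / \<alpha> y = (\<pi> ^ (n * r) * \<sigma> (\<alpha> y)) / (\<pi> ^ (n * r) * \<alpha> y)" using \<pi>0 by simp
  also have "\<dots> = e * (\<sigma> d * inverse d)" unfolding s d(2) using l_nonzero by (simp add: divide_inverse)
  finally show ?thesis using d(1) e(1) by (simp add: D_mult D_inverse \<sigma>_D)
qed

lemma \<alpha>_ratio_\<tau>:
  assumes y: "gT 0 y"
  shows "\<alpha> y / \<tau> (\<alpha> y) \<in> D"
proof -
  have "\<sigma> (\<alpha> y / \<tau> (\<alpha> y)) = \<sigma> (\<alpha> y) / \<alpha> y" by (simp add: \<sigma>_divide)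
  then show ?thesis using \<alpha>_ratio[OF y] \<sigma>_D[of "\<alpha> y / \<tau> (\<alpha> y)"] by simp
qed

text \<open>The coordinates of \<pi>^r V(g x) are \<tau> applied to A^-1 \<open>ush r x\<close>, and
  neither A^-1 nor \<tau> changes a column type. The quantification over the sign lets the first
  step to G_1 and the later steps use the same vector \<open>z\<close>.\<close>

lemma gV:
  assumes x: "x \<in> Car"
  shows "\<exists>z. \<pi> ^ r \<cdot>\<^sub>v V (g *\<^sub>v x) = g *\<^sub>v z \<and> (\<forall>s j. col_typ j ((- 1) ^ s \<cdot>\<^sub>v ush r x) \<longrightarrow>
     j < 2 * n \<longrightarrow> col_typ j ((- 1) ^ s \<cdot>\<^sub>v z)) \<and> z \<in> Car"
proof -
  obtain c where c: "is_simil n c A" using A by (auto simp: H_iff GSp_iff)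
  let ?y = "sinv n c A *\<^sub>v ush r x"
  define z where "z = map_vec \<tau> ?y"
  have yC: "?y \<in> Car" by (rule mult_mat_vec_carrier[OF sinv_carrier ush_carrier])
  then have zC: "z \<in> Car" by (simp add: z_def)
  have gx: "g *\<^sub>v x \<in> Car" "g *\<^sub>v z \<in> Car" using gC x zC by auto
  have "A *\<^sub>v map_vec \<sigma> z = A *\<^sub>v ?y" using yC unfolding z_def by (intro arg_cong[of _ _ "(*\<^sub>v) A"] eq_vecI) auto
  also have "\<dots> = (A * sinv n c A) *\<^sub>v ush r x" by (rule assoc_mult_mat_vec[OF AC sinv_carrier ush_carrier, symmetric])
  also have "\<dots> = ush r x" by (simp add: sinv_right[OF c])
  finally have "F (g *\<^sub>v z) = g *\<^sub>v (\<pi> ^ (r + k) \<cdot>\<^sub>v x)"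
    using F_g[OF zC] W_ush[OF x] by simp
  also have "\<dots> = \<pi> ^ (r + k) \<cdot>\<^sub>v (g *\<^sub>v x)" by (rule mult_mat_vec[OF gC x])
  also have "\<dots> = F (\<pi> ^ r \<cdot>\<^sub>v V (g *\<^sub>v x))"
    using gx by (simp add: F_smult F_V smult_smult_assoc power_add)
  finally have Fz: "F (g *\<^sub>v z) = F (\<pi> ^ r \<cdot>\<^sub>v V (g *\<^sub>v x))" .
  have "\<pi> ^ r \<cdot>\<^sub>v V (g *\<^sub>v x) = g *\<^sub>v z"
    by (rule F_inj[OF _ gx(2) Fz[symmetric]]) (simp add: gx(1))
  moreover have "col_typ j ((- 1) ^ s \<cdot>\<^sub>v z)" if t: "col_typ j ((- 1) ^ s \<cdot>\<^sub>v ush r x)" "j < 2 * n" for s j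
  proof -
    have "col_typ j (map_vec \<tau> (sinv n c A *\<^sub>v ((- 1) ^ s \<cdot>\<^sub>v ush r x)))"
      by (rule col_typ_\<tau>[OF H_typ[OF H_sinv[OF A c] t]])
    also have "sinv n c A *\<^sub>v ((- 1) ^ s \<cdot>\<^sub>v ush r x) = (- 1) ^ s \<cdot>\<^sub>v ?y"
      by (rule mult_mat_vec[OF sinv_carrier ush_carrier])
    also have "map_vec \<tau> ((- 1) ^ s \<cdot>\<^sub>v ?y) = (- 1) ^ s \<cdot>\<^sub>v z"
      unfolding z_def by (simp add: \<tau>.vec_hom_smult)
    finally show ?thesis .
  qed
  ultimately show ?thesis using zC by blast
qed

lemma gT_V:
  assumes y: "gT j y" and j: "j = 0 \<or> n \<le> j" "j < 2 * n - 1"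
  shows "gT (if j = 0 then n else j + 1) ((if j = 0 then (- 1) ^ (n + 1) * \<pi> ^ r else \<pi> ^ r) \<cdot>\<^sub>v V y)"
proof -
  obtain x where x: "col_typ j x" "y = g *\<^sub>v x" using y by (auto simp: gT_def)
  have xC: "x \<in> Car" using x(1) by (rule col_typD)
  obtain z where z: "\<pi> ^ r \<cdot>\<^sub>v V y = g *\<^sub>v z" "z \<in> Car"
    "\<And>s j. col_typ j ((- 1) ^ s \<cdot>\<^sub>v ush r x) \<Longrightarrow> j < 2 * n \<Longrightarrow> col_typ j ((- 1) ^ s \<cdot>\<^sub>v z)"
    using gV[OF xC] unfolding x(2) by blast
  show ?thesis
  proof (cases "j = 0")
    case True
    then have t: "col_typ n ((- 1) ^ (n + 1) \<cdot>\<^sub>v z)" using z(3)[OF ush_typ_0[OF x(1)[unfolded True]]] n1 by simp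
    have "((- 1) ^ (n + 1) * \<pi> ^ r) \<cdot>\<^sub>v V y = (- 1) ^ (n + 1) \<cdot>\<^sub>v (g *\<^sub>v z)"
      unfolding z(1)[symmetric] by (simp only: smult_smult_assoc)
    also have "\<dots> = g *\<^sub>v ((- 1) ^ (n + 1) \<cdot>\<^sub>v z)"
      by (rule mult_mat_vec[OF gC z(2), symmetric])
    finally show ?thesis using True t unfolding gT_def by auto
  next
    case False
    then have "col_typ (j + 1) ((- 1) ^ 0 \<cdot>\<^sub>v ush r x)" using ush_typ[OF x(1)] j by simp
    then have "col_typ (j + 1) z" using z(3)[of "j + 1" 0] j by simp
    then show ?thesis using False z(1) unfolding gT_def by auto
  qed
qed

text \<open>In the quotient the factors \<pi>^(n r) and l cancel. What remains is a pairing in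
  \<open>up\<close> divided by an element of D, so only an \<open>up\<close>-multiple of v is
  subtracted.\<close>

lemma gT_reduce:
  assumes v: "v \<in> Vs" "gT 0 v" and y: "gT j y" "0 < j" "j < 2 * n"
  shows "gT j (y - (sform n y ((F ^^ n) v) / \<alpha> v) \<cdot>\<^sub>v v)"
proof -
  obtain d where d: "d \<in> D" "\<pi> ^ (n * r) * \<alpha> v = - l * d" using gT_\<alpha>[OF v(2)] .
  obtain x where x: "col_typ 0 x" "v = g *\<^sub>v x" using v by (auto simp: gT_def)
  obtain y' where y': "col_typ j y'" "y = g *\<^sub>v y'" using y by (auto simp: gT_def)
  obtain z where z: "col_typ (2 * n - 1) z" "\<pi> ^ (n * r) \<cdot>\<^sub>v (F ^^ n) v = g *\<^sub>v z"
    using gT_Fn[OF v(2)] by (auto simp: gT_def)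
  have C: "x \<in> Car" "y' \<in> Car" "z \<in> Car" "y \<in> Car" "v \<in> Car"
    using x y' z v(1) gT_carrier[OF y(1)] col_typD(1) Vs_carrier by auto
  let ?c = "sform n y ((F ^^ n) v) / \<alpha> v"
  have "\<pi> ^ (n * r) * sform n y ((F ^^ n) v) = sform n y (\<pi> ^ (n * r) \<cdot>\<^sub>v (F ^^ n) v)"
    using C by (simp add: sform_smult_right)
  also have "\<dots> = l * sform n y' z" unfolding z(2) unfolding y'(2) by (rule sform_simil[OF g C(2,3)])
  finally have s: "\<pi> ^ (n * r) * sform n y ((F ^^ n) v) = l * sform n y' z" .
  have "?c = (\<pi> ^ (n * r) * sform n y ((F ^^ n) v)) / (\<pi> ^ (n * r) * \<alpha> v)" using \<pi>0 by simp
  also have "\<dots> = - (inverse d * sform n y' z)" unfolding s d(2) using l_nonzero by (simp add: divide_inverse)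
  finally have c: "?c \<in> up" using D_inverse[OF d(1)] sform_typ_up[OF y'(1) y(2) z(1)] D_up up_minus by auto
  have "g *\<^sub>v (y' - ?c \<cdot>\<^sub>v x) = g *\<^sub>v y' - g *\<^sub>v (?c \<cdot>\<^sub>v x)"
    using C gC by (intro mult_minus_distrib_mat_vec) auto
  also have "g *\<^sub>v (?c \<cdot>\<^sub>v x) = ?c \<cdot>\<^sub>v v" unfolding x(2) by (rule mult_mat_vec[OF gC C(1)])
  finally have "y - ?c \<cdot>\<^sub>v v = g *\<^sub>v (y' - ?c \<cdot>\<^sub>v x)" by (simp add: y'(2))
  then show ?thesis using col_typ_minus_smult[OF y'(1) y(2,3) x(1) c] unfolding gT_def by blast
qed

lemma gT_smult: "c \<in> D \<Longrightarrow> gT j y \<Longrightarrow> gT j (c \<cdot>\<^sub>v y)"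
  unfolding gT_def using col_typ_smult mult_mat_vec[OF gC col_typD(1)] by metis

text \<open>\<open>Gs v y\<close> arises from V y by the reduction of \<open>gT_reduce\<close> and
  the factor \<alpha>/\<tau>(\<alpha>), which lies in D. Both operations are linear in V y, so the
  scalar c can be carried along.\<close>

lemma gT_Gs:
  assumes v: "v \<in> Vs" "gT 0 v" and y: "y \<in> Car" and j: "0 < j" "j < 2 * n"
    and V: "gT j (c \<cdot>\<^sub>v V y)"
  shows "gT j (c \<cdot>\<^sub>v Gs v y)"
proof -
  have vC: "v \<in> Car" using v(1) by (rule Vs_carrier)
  let ?e = "sform n (V y) ((F ^^ n) v) / \<alpha> v" and ?u = "\<alpha> v / \<tau> (\<alpha> v)"
  have "sform n (c \<cdot>\<^sub>v V y) ((F ^^ n) v) / \<alpha> v = c * ?e" using y vC by (simp add: sform_smult_left)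
  then have "gT j (?u \<cdot>\<^sub>v (c \<cdot>\<^sub>v V y - (c * ?e) \<cdot>\<^sub>v v))"
    using gT_smult[OF \<alpha>_ratio_\<tau>[OF v(2)] gT_reduce[OF v V j]] by (simp only:)
  also have "?u \<cdot>\<^sub>v (c \<cdot>\<^sub>v V y - (c * ?e) \<cdot>\<^sub>v v) = c \<cdot>\<^sub>v Gs v y"
    unfolding Gstep_def using V_carrier[OF y] vC by (intro eq_vecI) (auto simp: algebra_simps)
  finally show ?thesis .
qed

lemma gT_Xv:
  assumes v: "v \<in> Vs" "gT 0 v"
  shows "i < n - 1 \<Longrightarrow> gT (n + i) (\<pi> ^ (Suc i * r) \<cdot>\<^sub>v Xv v (Suc i))"
proof (induction i)
  case 0
  have vC: "v \<in> Car" using v(1) by (rule Vs_carrier)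
  have "gT n (((- 1) ^ (n + 1) * \<pi> ^ r) \<cdot>\<^sub>v V v)" using gT_V[OF v(2)] 0 by simp
  then have "gT n (((- 1) ^ (n + 1) * \<pi> ^ r) \<cdot>\<^sub>v Gs v v)"
    using gT_Gs[OF v vC] 0 by simp
  then show ?case using vC by (simp add: Xv_Suc gsgn_def smult_smult_assoc mult.commute)
next
  case (Suc i)
  have vC: "v \<in> Car" using v(1) by (rule Vs_carrier)
  let ?y = "Xv v (Suc i)"
  have y: "gT (n + i) (\<pi> ^ (Suc i * r) \<cdot>\<^sub>v ?y)" using Suc by simp
  have "gT (n + i + 1) (\<pi> ^ r \<cdot>\<^sub>v V (\<pi> ^ (Suc i * r) \<cdot>\<^sub>v ?y))"
  proof -
    have ni: "n + i \<noteq> 0" "n + i < 2 * n - 1" using Suc.prems by auto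
    show ?thesis using gT_V[OF y _ ni(2)] ni(1) by (simp only: le_add1 simp_thms if_False)
  qed
  also have "\<pi> ^ r \<cdot>\<^sub>v V (\<pi> ^ (Suc i * r) \<cdot>\<^sub>v ?y) = \<pi> ^ (Suc (Suc i) * r) \<cdot>\<^sub>v V ?y"
    using vC by (simp add: V_smult smult_smult_assoc power_add \<tau>_mult)
  finally have "gT (n + i + 1) (\<pi> ^ (Suc (Suc i) * r) \<cdot>\<^sub>v Gs v ?y)"
    using Suc.prems vC by (intro gT_Gs[OF v]) auto
  then show ?case using vC Xv_Suc[of v "Suc i"] by (simp add: gsgn_def)
qed

text \<open>
  \<open>\<pi>\<^sup>r F\<close> and \<open>\<pi>\<^sup>r V\<close> carry the column type of one column of \<open>gm r v\<close> to that of the next, so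
  only the first column needs to be checked.
\<close>

lemma gm_factor:
  assumes v: "v \<in> Vs" "gT 0 v"
  shows "\<exists>h\<in>H. gm r v = g * h"
proof -
  have vC: "v \<in> Car" using v(1) by (rule Vs_carrier)
  have cols: "gT j (col (gm r v) j)" if j: "j < 2 * n" for j
  proof -
    consider "j < n" | "n \<le> j" "j < 2 * n - 1" | "j = 2 * n - 1" "n \<le> j" using j by linarith
    then show ?thesis
    proof cases
      case 1
      then show ?thesis using gT_Fi[OF v(2)] by (simp add: gm_col vC j dexp_def base_def)
    next
      case 2
      then show ?thesis using gT_Xv[OF v, of "j - n"] by (simp add: gm_col vC j dexp_def base_def)
    next
      case 3
      then have "\<not> j < n" "\<not> j < 2 * n - 1" by auto
      then show ?thesis using gT_Fn[OF v(2)] 3(1) unfolding gm_col[OF vC j] dexp_def base_def by simp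
    qed
  qed
  let ?h = "sinv n l g * gm r v"
  have hs: "is_simil n (inverse l * - (\<pi> ^ (n * r) * \<alpha> v)) ?h"
    by (rule is_simil_mult[OF is_simil_sinv[OF g] gm_simil[OF v(1)]])
  have hC: "?h \<in> carrier_mat (2 * n) (2 * n)" using hs by (rule is_simil_carrier)
  have "g * ?h = (g * sinv n l g) * gm r v"
    by (rule assoc_mult_mat[OF gC sinv_carrier gm_carrier, symmetric])
  then have gh: "g * ?h = gm r v" by (simp add: sinv_right[OF g] left_mult_one_mat[OF gm_carrier])
  have "col_typ j (col ?h j)" if j: "j < 2 * n" for j
  proof -
    obtain x where x: "col_typ j x" "col (gm r v) j = g *\<^sub>v x" using cols[OF j] by (auto simp: gT_def)
    have xC: "x \<in> Car" using x(1) by (rule col_typD)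
    have "col ?h j = sinv n l g *\<^sub>v col (gm r v) j"
      using j carrier_matD[OF gm_carrier[of r v]] carrier_matD[OF sinv_carrier[of n l g]] by (intro eq_vecI) auto
    also have "\<dots> = (sinv n l g * g) *\<^sub>v x"
      unfolding x(2) by (rule assoc_mult_mat_vec[OF sinv_carrier gC xC, symmetric])
    also have "\<dots> = x" using xC by (simp add: sinv_left[OF g])
    finally show ?thesis using x(1) by simp
  qed
  then have "?h \<in> H" using hs by (auto simp: H_iff GSp_iff)
  then show ?thesis using gh by metis
qed

end

end

section \<open>The matrix of F in the basis g_(b,r)(w)\<close>

lemma sform_mult_mat_vec_left:
  fixes g :: "'f::field mat"
  assumes g: "g \<in> carrier_mat (2 * n) (2 * n)" and x: "x \<in> carrier_vec (2 * n)" and y: "y \<in> carrier_vec (2 * n)"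
  shows "sform n (g *\<^sub>v x) y = (\<Sum>l<2 * n. x $ l * sform n (col g l) y)"
proof -
  have gx: "g *\<^sub>v x \<in> carrier_vec (2 * n)" using g x by simp
  have gi: "(g *\<^sub>v x) $ i = (\<Sum>l<2 * n. g $$ (i, l) * x $ l)" if "i < 2 * n" for i
    using g x that by (rule mult_mat_vec_sum)
  have gl: "sform n (col g l) y = (\<Sum>i<2 * n. (- 1) ^ Suc i * g $$ (i, l) * y $ (2 * n - 1 - i))" if "l < 2 * n" for l
  proof -
    have "col g l \<in> carrier_vec (2 * n)" using g that by auto
    from sform_sum[OF this y] show ?thesis using g that by auto
  qed
  have "sform n (g *\<^sub>v x) y = (\<Sum>i<2 * n. \<Sum>l<2 * n. x $ l * ((- 1) ^ Suc i * g $$ (i, l) * y $ (2 * n - 1 - i)))"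
    unfolding sform_sum[OF gx y]
  proof (rule sum.cong)
    fix i assume "i \<in> {..<2 * n}"
    then show "(- 1) ^ Suc i * (g *\<^sub>v x) $ i * y $ (2 * n - 1 - i)
        = (\<Sum>l<2 * n. x $ l * ((- 1) ^ Suc i * g $$ (i, l) * y $ (2 * n - 1 - i)))"
      by (simp only: gi lessThan_iff sum_distrib_left sum_distrib_right) (simp add: algebra_simps)
  qed simp
  also have "\<dots> = (\<Sum>l<2 * n. \<Sum>i<2 * n. x $ l * ((- 1) ^ Suc i * g $$ (i, l) * y $ (2 * n - 1 - i)))"
    by (rule sum.swap)
  also have "\<dots> = (\<Sum>l<2 * n. x $ l * sform n (col g l) y)"
    by (intro sum.cong refl) (simp only: gl lessThan_iff sum_distrib_left)
  finally show ?thesis .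
qed

lemma is_simil_inj:
  fixes g :: "'f::field mat"
  assumes g: "is_simil n c g" and x: "x \<in> carrier_vec (2 * n)" and y: "y \<in> carrier_vec (2 * n)"
    and eq: "g *\<^sub>v x = g *\<^sub>v y"
  shows "x = y"
proof -
  have "sinv n c g *\<^sub>v (g *\<^sub>v x) = x" if "x \<in> carrier_vec (2 * n)" for x
    using assoc_mult_mat_vec[OF sinv_carrier[of n c g] is_simil_carrier[OF g] that] that by (simp add: sinv_left[OF g])
  then show ?thesis using x y eq by metis
qed

context symp_frob
begin

lemma W_unit:
  assumes "i < 2 * n"
  shows "W r *\<^sub>v unit_vec (2 * n) (wrow i) = wcoef r i \<cdot>\<^sub>v unit_vec (2 * n) i"
proof (rule eq_vecI)
  fix j assume "j < dim_vec (wcoef r i \<cdot>\<^sub>v unit_vec (2 * n) i)"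
  then have j: "j < 2 * n" by simp
  have "wrow i = wrow j \<longleftrightarrow> i = j" using assms j by (auto simp: wrow_def split: if_splits)
  then show "(W r *\<^sub>v unit_vec (2 * n) (wrow i)) $ j = (wcoef r i \<cdot>\<^sub>v unit_vec (2 * n) i) $ j"
    unfolding W_mult_vec_index[OF unit_vec_carrier j] using j assms wrow_less[OF j] by (auto simp: unit_vec_def)
qed (use carrier_matD[OF W_carrier[of r]] in auto)

lemma F_Gs:
  assumes w: "w \<in> Vs" and x: "x \<in> Car"
  shows "F (Gs w x) = (\<sigma> (\<alpha> w) / \<alpha> w) \<cdot>\<^sub>v (\<pi> ^ k \<cdot>\<^sub>v x - \<sigma> (sform n (V x) ((F ^^ n) w) / \<alpha> w) \<cdot>\<^sub>v F w)"
  unfolding Gstep_def using Vs_carrier[OF w] x by (simp add: F_smult F_minus F_V \<sigma>_divide)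

text \<open>F sends each F^j w to the next, which makes the first n columns of A unit vectors; the
  subtraction in \<open>Gstep\<close> adds one entry in row 0 to the columns of the G_i. Since A is
  a similitude, these columns then determine most of the last one: it vanishes in rows n, ..., 2n -
  2, and its rows 1, ..., n - 1 repeat the entries of row 0 up to sign. The final clause is the
  relation for F^(n+1) w, tested against the form, with the powers of \<pi> relating its
  coefficients to the entries of \<open>t\<close>.\<close>

lemma A_exists:
  assumes w: "w \<in> Vs"
  defines "u \<equiv> \<sigma> (\<alpha> w) / \<alpha> w"
  obtains A t where "is_simil n u A" "b * map_mat \<sigma> (gm r w) = gm r w * (W r * A)"
    "\<And>j. j < n \<Longrightarrow> col A j = unit_vec (2 * n) j"
    "\<And>i. i < n - 1 \<Longrightarrow> col A (n + i) = u \<cdot>\<^sub>v unit_vec (2 * n) (n + i)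
        + ((- 1) ^ (n + i + 1) * t $ (n - 1 - i)) \<cdot>\<^sub>v unit_vec (2 * n) 0"
    "col A (2 * n - 1) = t" "t \<in> Car" "t $ (2 * n - 1) = u" "\<And>j. n \<le> j \<Longrightarrow> j < 2 * n - 1 \<Longrightarrow> t $ j = 0"
    "\<And>y. y \<in> Car \<Longrightarrow> sform n (F ((F ^^ n) w)) y = u * \<pi> ^ k * sform n (Xv w (n - 1)) y
       + (\<Sum>l<n. t $ l * inverse (\<pi> ^ ((n - l) * r)) * sform n ((F ^^ Suc l) w) y)"
proof -
  let ?g = "gm r w" and ?l = "- (\<pi> ^ (n * r) * \<alpha> w)"
  let ?e = "\<lambda>j. unit_vec (2 * n) j :: 'a vec"
  have wC: "w \<in> Car" using w by (rule Vs_carrier)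
  have gs: "is_simil n ?l ?g" using w by (rule gm_simil)
  have gC: "?g \<in> carrier_mat (2 * n) (2 * n)" by simp
  have l0: "?l \<noteq> 0" using gs by (rule is_simil_nonzero)
  have u0: "u \<noteq> 0" unfolding u_def using \<alpha>_nonzero[OF w] by (simp add: \<sigma>_eq_0)
  let ?B = "b * map_mat \<sigma> ?g"
  have Bs: "is_simil n (- (\<pi> ^ k) * \<sigma> ?l) ?B" by (rule is_simil_mult[OF b is_simil_map_\<sigma>[OF gs]])
  have BC: "?B \<in> carrier_mat (2 * n) (2 * n)" using Bs by (rule is_simil_carrier)
  have gWs: "is_simil n (?l * - (\<pi> ^ k)) (?g * W r)" by (rule is_simil_mult[OF gs W_simil])
  have gWC: "?g * W r \<in> carrier_mat (2 * n) (2 * n)" using gWs by (rule is_simil_carrier)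
  define A where "A = sinv n (?l * - (\<pi> ^ k)) (?g * W r) * ?B"
  have "inverse (?l * - (\<pi> ^ k)) * (- (\<pi> ^ k) * \<sigma> ?l) = u"
    unfolding u_def using \<pi>0 \<alpha>_nonzero[OF w] by (simp add: \<sigma>_mult \<sigma>_minus field_simps)
  then have As: "is_simil n u A"
    unfolding A_def using is_simil_mult[OF is_simil_sinv[OF gWs] Bs] by simp
  have AC: "A \<in> carrier_mat (2 * n) (2 * n)" using As by (rule is_simil_carrier)
  have rel': "(?g * W r) * A = ?B"
    unfolding A_def using assoc_mult_mat[OF gWC sinv_carrier[of n "?l * - (\<pi> ^ k)" "?g * W r"] BC, symmetric]
    by (simp only: sinv_right[OF gWs] left_mult_one_mat[OF BC])
  then have rel: "?B = ?g * (W r * A)" using assoc_mult_mat[OF gC W_carrier AC] by simp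
  have gW: "(?g * W r) *\<^sub>v x = ?g *\<^sub>v (W r *\<^sub>v x)" if "x \<in> Car" for x
    by (rule assoc_mult_mat_vec[OF gC W_carrier that])
  have Bcol: "col ?B j = F (col ?g j)" if j: "j < 2 * n" for j
  proof -
    have gc: "col (map_mat \<sigma> ?g) j = map_vec \<sigma> (col ?g j)"
      using j carrier_matD[OF gC] by (intro eq_vecI) auto
    have "col ?B j = b *\<^sub>v col (map_mat \<sigma> ?g) j"
      using j b_carrier gC carrier_matD[OF gC] by (intro eq_vecI) auto
    then show ?thesis unfolding gc Frob_def .
  qed
  have AI: "col A j = x" if j: "j < 2 * n" and x: "x \<in> Car" and eq: "F (col ?g j) = ?g *\<^sub>v (W r *\<^sub>v x)" for j x
  proof (rule is_simil_inj[OF gWs])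
    show "col A j \<in> Car" by (rule col_carrier_vec[OF j AC])
    have "(?g * W r) *\<^sub>v col A j = col ((?g * W r) * A) j"
      using j carrier_matD[OF gWC] carrier_matD[OF AC] by (intro eq_vecI) auto
    then show "(?g * W r) *\<^sub>v col A j = (?g * W r) *\<^sub>v x"
      unfolding rel' Bcol[OF j] gW[OF x] eq .
  qed (rule x)
  have ge: "?g *\<^sub>v (c \<cdot>\<^sub>v ?e j) = c \<cdot>\<^sub>v col ?g j" if "j < 2 * n" for c j
    using mult_mat_vec[OF gC, of "?e j" c] mat_mult_unit_vec[OF gC that] by simp
  have gWe: "?g *\<^sub>v (W r *\<^sub>v ?e (wrow i)) = wcoef r i \<cdot>\<^sub>v col ?g i" if "i < 2 * n" for i
    using W_unit[OF that] ge[OF that] by simp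
  have eC: "?e j \<in> Car" for j by simp
  have nr: "n * r = r + (n - 1) * r" using n1 by (cases n) auto
  have p: "inverse (\<pi> ^ r) * (\<pi> ^ r * y) = y" for y using \<pi>0 by simp
  have c1: "col A j = ?e j" if j: "j < n" for j
  proof (rule AI)
    have Fc: "F (col ?g j) = \<pi> ^ (j * r) \<cdot>\<^sub>v (F ^^ Suc j) w"
      using j wC by (simp add: gm_col dexp_def base_def F_smult)
    show "F (col ?g j) = ?g *\<^sub>v (W r *\<^sub>v ?e j)"
    proof (cases "j = n - 1")
      case True
      have i: "wrow (2 * n - 1) = j" "2 * n - 1 < 2 * n" "wcoef r (2 * n - 1) = inverse (\<pi> ^ r)"
        "\<not> 2 * n - 1 < n" using n1 True by (auto simp: wrow_def wcoef_def)
      have "wcoef r (2 * n - 1) \<cdot>\<^sub>v col ?g (2 * n - 1) = \<pi> ^ (j * r) \<cdot>\<^sub>v (F ^^ Suc j) w"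
        using True n1 i wC by (simp add: gm_col dexp_def base_def smult_smult_assoc nr power_add p)
      then show ?thesis unfolding Fc using gWe[OF i(2)] i(1) by simp
    next
      case False
      then have i: "wrow (Suc j) = j" "Suc j < n" "Suc j < 2 * n" "wcoef r (Suc j) = inverse (\<pi> ^ r)"
        using n1 j by (auto simp: wrow_def wcoef_def)
      have "wcoef r (Suc j) \<cdot>\<^sub>v col ?g (Suc j) = \<pi> ^ (j * r) \<cdot>\<^sub>v (F ^^ Suc j) w"
        using i wC by (simp add: gm_col dexp_def base_def smult_smult_assoc power_add p)
      then show ?thesis unfolding Fc using gWe[OF i(3)] i(1) by simp
    qed
  qed (use j in auto)
  \<comment> \<open>The coefficient of F w in F of the column of G_(i+1): F turns the multiple of w
    subtracted in \<open>Gstep\<close> into a multiple of F w, which is the image of the first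
    coordinate vector.\<close>
  define S where "S i = - u * \<pi> ^ (Suc i * r) * gsgn i * \<sigma> (sform n (V (Xv w i)) ((F ^^ n) w) / \<alpha> w)" for i
  have gW0: "?g *\<^sub>v (W r *\<^sub>v ?e 0) = F w"
  proof -
    have "F (col ?g 0) = ?g *\<^sub>v (W r *\<^sub>v col A 0)"
    proof -
      have A0: "col A 0 \<in> Car" by (rule col_carrier_vec[OF _ AC]) (use n1 in auto)
      have "F (col ?g 0) = col ((?g * W r) * A) 0" unfolding rel' using n1 by (simp add: Bcol)
      also have "\<dots> = (?g * W r) *\<^sub>v col A 0"
        using n1 carrier_matD[OF gWC] carrier_matD[OF AC] by (intro eq_vecI) auto
      finally show ?thesis unfolding gW[OF A0] .
    qed
    then show ?thesis using c1[of 0] n1 wC by (simp add: gm_col dexp_def base_def)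
  qed
  have c2: "col A (n + i) = u \<cdot>\<^sub>v ?e (n + i) + S i \<cdot>\<^sub>v ?e 0" if i: "i < n - 1" for i
  proof (rule AI)
    let ?q = "\<sigma> (sform n (V (Xv w i)) ((F ^^ n) w) / \<alpha> w)"
    have ni: "\<not> n + i < n" "n + i < 2 * n - 1" "n + i - n + 1 = Suc i" using i by auto
    have FC: "F w \<in> Car" and XC: "Xv w i \<in> Car" using wC by auto
    have "F (col ?g (n + i)) = F (\<pi> ^ (Suc i * r) \<cdot>\<^sub>v Xv w (Suc i))"
      using ni wC by (simp add: gm_col dexp_def base_def)
    also have "\<dots> = (\<pi> ^ (Suc i * r) * gsgn i) \<cdot>\<^sub>v F (Gs w (Xv w i))"
    proof -
      have "\<sigma> (gsgn i) = gsgn i" unfolding gsgn_def using \<sigma>_sign[of "n + 1"] by (simp add: \<sigma>_1)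
      then show ?thesis using wC by (simp add: Xv_Suc F_smult smult_smult_assoc \<sigma>_mult)
    qed
    also have "\<dots> = (u * (\<pi> ^ (Suc i * r) * gsgn i * \<pi> ^ k)) \<cdot>\<^sub>v Xv w i + S i \<cdot>\<^sub>v F w"
      unfolding F_Gs[OF w XC] u_def[symmetric] S_def using XC FC by (intro eq_vecI) (auto simp: algebra_simps)
    also have "(u * (\<pi> ^ (Suc i * r) * gsgn i * \<pi> ^ k)) \<cdot>\<^sub>v Xv w i = u \<cdot>\<^sub>v (?g *\<^sub>v (W r *\<^sub>v ?e (n + i)))"
    proof (cases "i = 0")
      case True
      have "?g *\<^sub>v (W r *\<^sub>v ?e (n + i)) = ((- 1) ^ (n + 1) * \<pi> ^ (r + k)) \<cdot>\<^sub>v w"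
        using gWe[of 0] n1 True wC by (simp add: wrow_def wcoef_def gm_col dexp_def base_def)
      then show ?thesis using True by (simp add: smult_smult_assoc gsgn_def power_add algebra_simps)
    next
      case False
      let ?j = "n + i - 1"
      have j: "\<not> ?j < n" "?j < 2 * n - 1" "?j < 2 * n" "?j \<noteq> 0" "?j + 1 = n + i" "?j - n + 1 = i" using False i by auto
      then have "wrow ?j = n + i" "wcoef r ?j = \<pi> ^ (r + k)" by (auto simp: wrow_def wcoef_def)
      moreover have "col ?g ?j = \<pi> ^ (i * r) \<cdot>\<^sub>v Xv w i"
        unfolding gm_col[OF wC j(3)] dexp_def base_def using j by simp
      ultimately have "?g *\<^sub>v (W r *\<^sub>v ?e (n + i)) = (\<pi> ^ (r + k) * \<pi> ^ (i * r)) \<cdot>\<^sub>v Xv w i"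
        using gWe[OF j(3)] by (simp add: smult_smult_assoc)
      then show ?thesis using False by (simp add: smult_smult_assoc gsgn_def power_add algebra_simps)
    qed
    also have "u \<cdot>\<^sub>v (?g *\<^sub>v (W r *\<^sub>v ?e (n + i))) + S i \<cdot>\<^sub>v F w
        = (?g * W r) *\<^sub>v (u \<cdot>\<^sub>v ?e (n + i)) + (?g * W r) *\<^sub>v (S i \<cdot>\<^sub>v ?e 0)"
      unfolding mult_mat_vec[OF gWC eC] gW[OF eC] gW0 ..
    also have "\<dots> = (?g * W r) *\<^sub>v (u \<cdot>\<^sub>v ?e (n + i) + S i \<cdot>\<^sub>v ?e 0)"
      by (rule mult_add_distrib_mat_vec[OF gWC, symmetric]) auto
    also have "\<dots> = ?g *\<^sub>v (W r *\<^sub>v (u \<cdot>\<^sub>v ?e (n + i) + S i \<cdot>\<^sub>v ?e 0))" by (rule gW) simp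
    finally show "F (col ?g (n + i)) = ?g *\<^sub>v (W r *\<^sub>v (u \<cdot>\<^sub>v ?e (n + i) + S i \<cdot>\<^sub>v ?e 0))" .
  qed (use i in auto)
  define t where "t = col A (2 * n - 1)"
  have tC: "t \<in> Car" unfolding t_def by (rule col_carrier_vec[OF _ AC]) (use n1 in auto)
  \<comment> \<open>Pairing the last column of a similitude with the known columns reads off the
    entries of \<open>t\<close> one at a time.\<close>
  have gr: "sform n (col A j) t = u * (if j = 0 then - 1 else 0)" if j: "j < 2 * n - 1 \<or> j = 0" for j
    unfolding t_def using is_simil_gram[OF As, of j "2 * n - 1"] j n1
    by (auto simp: minus_one_power_iff)
  have te: "sform n (?e j) t = (- 1) ^ Suc j * t $ (2 * n - 1 - j)" if "j < 2 * n" for j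
    by (rule sform_unit_left[OF tC that])
  have t1: "t $ (2 * n - 1) = u"
    using gr[of 0] te[of 0] c1[of 0] n1 by simp
  have t2: "t $ j = 0" if j: "n \<le> j" "j < 2 * n - 1" for j
  proof -
    let ?j = "2 * n - 1 - j"
    have j': "?j < n" "?j \<noteq> 0" "?j < 2 * n" "2 * n - 1 - ?j = j" using j by auto
    have "(- 1) ^ Suc ?j * t $ j = 0" using gr[of ?j] te[OF j'(3)] c1[OF j'(1)] j' by simp
    then show ?thesis by simp
  qed
  have t3: "S i = (- 1) ^ (n + i + 1) * t $ (n - 1 - i)" if i: "i < n - 1" for i
  proof -
    have ni: "n + i < 2 * n - 1" "n + i \<noteq> 0" using i by auto
    have "0 = sform n (u \<cdot>\<^sub>v ?e (n + i) + S i \<cdot>\<^sub>v ?e 0) t"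
      using gr[of "n + i"] ni unfolding c2[OF i] by (simp only: if_False mult_zero_right simp_thms)
    also have "\<dots> = u * sform n (?e (n + i)) t + S i * sform n (?e 0) t"
      using tC by (simp add: sform_add_left sform_smult_left)
    also have "\<dots> = u * ((- 1) ^ (n + i + 1) * t $ (n - 1 - i)) - S i * u"
      using te[of "n + i"] te[of 0] i t1 by simp
    finally have "u * S i = u * ((- 1) ^ (n + i + 1) * t $ (n - 1 - i))" by (simp add: algebra_simps)
    then show ?thesis by (rule mult_left_cancel[OF u0, THEN iffD1])
  qed
  have rel3: "sform n (F ((F ^^ n) w)) y = u * \<pi> ^ k * sform n (Xv w (n - 1)) y
       + (\<Sum>l<n. t $ l * inverse (\<pi> ^ ((n - l) * r)) * sform n ((F ^^ Suc l) w) y)" if y: "y \<in> Car" for y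
  proof -
    have WC: "W r *\<^sub>v t \<in> Car" using mult_mat_vec_carrier[OF W_carrier tC] .
    have "\<pi> ^ (n * r) \<cdot>\<^sub>v F ((F ^^ n) w) = F (col ?g (2 * n - 1))"
    proof -
      have "\<not> 2 * n - 1 < n \<or> n = 0" by auto
      then show ?thesis using n1 wC by (simp add: gm_col dexp_def base_def F_smult)
    qed
    also have "\<dots> = ?g *\<^sub>v (W r *\<^sub>v t)"
    proof -
      have "F (col ?g (2 * n - 1)) = col ((?g * W r) * A) (2 * n - 1)" unfolding rel' using n1 by (simp add: Bcol)
      also have "\<dots> = (?g * W r) *\<^sub>v t" unfolding t_def
        using n1 carrier_matD[OF gWC] carrier_matD[OF AC] by (intro eq_vecI) auto
      finally show ?thesis unfolding gW[OF tC] .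
    qed
    finally have "\<pi> ^ (n * r) * sform n (F ((F ^^ n) w)) y = sform n (?g *\<^sub>v (W r *\<^sub>v t)) y"
      using wC y by (metis F_carrier Fi_carrier sform_smult_left)
    also have "\<dots> = (\<Sum>i<2 * n. (W r *\<^sub>v t) $ i * sform n (col ?g i) y)"
      by (rule sform_mult_mat_vec_left[OF gC WC y])
    also have "\<dots> = (\<Sum>i<2 * n. wcoef r i * \<pi> ^ (dexp n i * r) * (t $ wrow i * sform n (base w i) y))"
      by (intro sum.cong refl) (simp add: W_mult_vec_index[OF tC] gm_col[OF wC] sform_smult_left[OF base_carrier[OF wC] y])
    \<comment> \<open>The sum over rows of w_r is rewritten as a sum over the entries j =
      \<open>wrow i\<close> of \<open>t\<close>. The powers of \<pi> from w_r and from the columns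
      combine to \<pi>^(n r) divided by \<pi>^((n-j) r), and the range n, ..., 2n - 2 drops out
      because \<open>t\<close> vanishes there.\<close>
    also have "\<dots> = (\<Sum>j<2 * n. (case j of _ \<Rightarrow>
        if j < n then t $ j * \<pi> ^ (n * r) * inverse (\<pi> ^ ((n - j) * r)) * sform n ((F ^^ Suc j) w) y
        else if j = 2 * n - 1 then \<pi> ^ (n * r) * (u * \<pi> ^ k * sform n (Xv w (n - 1)) y) else 0))" (is "_ = sum ?f _")
    proof -
      have "wcoef r i * \<pi> ^ (dexp n i * r) * (t $ wrow i * sform n (base w i) y) = ?f (wrow i)" if i: "i < 2 * n" for i
      proof -
        have pw: "\<pi> ^ (a * r) = \<pi> ^ (n * r) * inverse (\<pi> ^ ((n - a) * r))" if "a \<le> n" for a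
        proof -
          have "n * r = a * r + (n - a) * r" using that by (metis distrib_right le_add_diff_inverse)
          then show ?thesis using \<pi>0 by (simp add: power_add)
        qed
        consider "i = 0" | "0 < i" "i < n" | "n \<le> i" "i < 2 * n - 2" | "n \<le> i" "i = 2 * n - 2" | "i = 2 * n - 1" "i \<noteq> 0" using i by linarith
        then show ?thesis
        proof cases
          case 1
          then have wr: "wrow i = n" by (simp add: wrow_def)
          show ?thesis
          proof (cases "n = 1")
            \<comment> \<open>For n = 1 there are no G_i, w itself is X_(n-1), and
              \<open>wrow 0\<close> is the last index, so row 0 supplies the term that otherwise
              comes from row 2n - 2.\<close>
            case True
            have ev: "even (n + 1)" and n0: "n - 1 = 0" using True by simp_all
            have "wcoef r i = \<pi> ^ (r + k)" unfolding wcoef_def using ev 1 by (simp del: power_Suc)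
            moreover have "base w i = w" using n1 1 by (simp add: base_def)
            moreover have "Xv w (n - 1) = w" unfolding n0 by simp
            moreover have "dexp n i = 0" "2 * n - 1 = n" "n * r = r" "t $ n = u"
              using True 1 t1 by (auto simp: dexp_def)
            ultimately have e: "wcoef r i = \<pi> ^ (r + k)" "dexp n i = 0" "base w i = w" "Xv w (n - 1) = w"
              "2 * n - 1 = n" "n * r = r" "t $ n = u" by blast+
            show ?thesis unfolding wr e by (simp add: power_add)
          next
            case False
            then have "t $ n = 0" using n1 by (intro t2) auto
            then show ?thesis using False wr n1 by simp
          qed
        next
          case 2
          then have wr: "wrow i = i - 1" "wcoef r i = inverse (\<pi> ^ r)" "dexp n i = i" "Suc (i - 1) = i"
            "base w i = (F ^^ i) w" "i - 1 < n" "n - (i - 1) = Suc (n - i)"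
            by (auto simp: wrow_def wcoef_def dexp_def base_def)
          show ?thesis using wr(6) \<pi>0 unfolding wr pw[OF less_imp_le[OF 2(2)]] by (simp add: power_add)
        next
          case 3
          then have wr: "wrow i = i + 1" using n1 by (auto simp: wrow_def)
          have "t $ (i + 1) = 0" using 3 by (intro t2) auto
          then show ?thesis unfolding wr using 3 by simp
        next
          case 4
          then have wr: "wrow i = 2 * n - 1" "wcoef r i = \<pi> ^ (r + k)" "dexp n i = n - 1" "base w i = Xv w (n - 1)"
            "i \<noteq> 0" "\<not> 2 * n - 1 < n"
            using i n1 by (auto simp: wrow_def wcoef_def dexp_def base_def intro!: arg_cong[of _ _ "Xv w"])
          have "n * r = r + (n - 1) * r" using n1 by (cases n) auto
          then show ?thesis unfolding wr t1 using wr(6) by (simp add: power_add)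
        next
          case 5
          then have wr: "wrow i = n - 1" "wcoef r i = inverse (\<pi> ^ r)" "dexp n i = n" "Suc (n - 1) = n"
            "base w i = (F ^^ n) w" "n - 1 < n" "n - (n - 1) = 1"
            using n1 by (auto simp: wrow_def wcoef_def dexp_def base_def)
          show ?thesis unfolding wr using wr(6) by simp
        qed
      qed
      then have "(\<Sum>i<2 * n. wcoef r i * \<pi> ^ (dexp n i * r) * (t $ wrow i * sform n (base w i) y)) = (\<Sum>i<2 * n. ?f (wrow i))"
        by (intro sum.cong) auto
      also have "\<dots> = sum ?f {..<2 * n}"
      by (rule sum.reindex_bij_betw[OF bij_wrow])
      finally show ?thesis .
    qed
    also have "\<dots> = sum ?f {..<n} + sum ?f {n..<2 * n}"
    proof -
      have "{..<2 * n} = {..<n} \<union> {n..<2 * n}" by auto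
      then have "sum ?f {..<2 * n} = sum ?f ({..<n} \<union> {n..<2 * n})" by (rule arg_cong)
      also have "\<dots> = sum ?f {..<n} + sum ?f {n..<2 * n}" by (rule sum.union_disjoint) auto
      finally show ?thesis .
    qed
    also have "sum ?f {n..<2 * n} = (\<Sum>j\<in>{n..<2 * n}. if j = 2 * n - 1 then \<pi> ^ (n * r) * (u * \<pi> ^ k * sform n (Xv w (n - 1)) y) else 0)"
      by (rule sum.cong) auto
    also have "\<dots> = \<pi> ^ (n * r) * (u * \<pi> ^ k * sform n (Xv w (n - 1)) y)"
      using n1 by simp
    also have "sum ?f {..<n} = \<pi> ^ (n * r) * (\<Sum>l<n. t $ l * inverse (\<pi> ^ ((n - l) * r)) * sform n ((F ^^ Suc l) w) y)"
      unfolding sum_distrib_left by (rule sum.cong) auto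
    finally show ?thesis using \<pi>0 by (simp flip: distrib_left add: add.commute)
  qed
  show thesis
    by (rule that[OF As rel c1 _ t_def[symmetric] tC t1 t2 rel3]) (auto simp: c2 t3)
qed

end

section \<open>A Newton polygon bound for isoclinic recurrences\<close>

context disc_val
begin

lemma finite_P_bound:
  assumes "finite S"
  obtains B where "\<And>x. x \<in> S \<Longrightarrow> x \<in> P B"
proof -
  have "x \<in> P (Min (insert 0 (v ` S)))" if "x \<in> S" for x
    using assms that by (cases "x = 0") (auto simp: P_iff intro!: Min_le)
  then show ?thesis using that by blast
qed

text \<open>
  If some coefficient lies below the segment of slope \<open>k / 2\<close>, let \<open>i\<^sub>0\<close> be the last index where
  \<open>2 v(a\<^sub>i) + i k\<close> is minimal and \<open>\<phi>\<close> a solution of the recurrence starting at \<open>i\<^sub>0\<close>. At the first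
  \<open>j\<close> minimising \<open>2 v(\<phi>\<^sub>j) - j k\<close>, the term with index \<open>i\<^sub>0\<close> has strictly the smallest valuation.
\<close>

lemma newton_bound:
  fixes a :: "nat \<Rightarrow> 'a" and c :: "nat \<Rightarrow> nat \<Rightarrow> 'a" and \<phi> :: "nat \<Rightarrow> nat \<Rightarrow> 'a" and k :: int
  assumes c0: "\<And>j i. c j i = 0 \<longleftrightarrow> a i = 0" and cv: "\<And>j i. a i \<noteq> 0 \<Longrightarrow> v (c j i) = v (a i)"
    and rec: "\<And>i0 j. i0 < d \<Longrightarrow> \<phi> i0 (j + d) = (\<Sum>i<d. c j i * \<phi> i0 (j + i))"
    and zero: "\<And>i0 j. i0 < d \<Longrightarrow> j < i0 \<Longrightarrow> \<phi> i0 j = 0"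
    and nonzero: "\<And>i0. i0 < d \<Longrightarrow> \<phi> i0 i0 \<noteq> 0"
    and bounded: "\<And>i0. i0 < d \<Longrightarrow> \<exists>C. \<forall>j. \<phi> i0 j \<noteq> 0 \<longrightarrow> 2 * v (\<phi> i0 j) \<ge> int j * k - C"
    and i: "i < d" "a i \<noteq> 0"
  shows "2 * v (a i) \<ge> int (d - i) * k"
proof (rule ccontr)
  assume neg: "\<not> 2 * v (a i) \<ge> int (d - i) * k"
  define f where "f i = 2 * v (a i) + int i * k" for i
  define I where "I = {i. i < d \<and> a i \<noteq> 0}"
  have finI: "finite I" and iI: "i \<in> I" using i by (auto simp: I_def)
  define \<mu> where "\<mu> = Min (f ` I)"
  have \<mu>_le: "\<mu> \<le> f j" if "j \<in> I" for j using that finI by (simp add: \<mu>_def)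
  have "f i < int d * k" using neg i(1) by (simp add: f_def of_nat_diff algebra_simps)
  then have \<mu>_lt: "\<mu> < int d * k" using \<mu>_le[OF iI] by simp
  define i0 where "i0 = Max {j \<in> I. f j = \<mu>}"
  have "\<mu> \<in> f ` I" unfolding \<mu>_def using finI iI by (intro Min_in) auto
  then have "{j \<in> I. f j = \<mu>} \<noteq> {}" by auto
  then have i0: "i0 \<in> I" "f i0 = \<mu>" using Max_in[of "{j \<in> I. f j = \<mu>}"] finI by (auto simp: i0_def)
  have i0_max: "f j > \<mu>" if "j \<in> I" "i0 < j" for j
  proof -
    have "f j \<noteq> \<mu>"
    proof
      assume "f j = \<mu>"
      then have "j \<le> i0" unfolding i0_def by (intro Max_ge) (use finI that in auto)
      with that show False by simp
    qed
    then show ?thesis using \<mu>_le[OF that(1)] by simp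
  qed
  have i0d: "i0 < d" and ai0: "a i0 \<noteq> 0" using i0 by (auto simp: I_def)
  let ?\<phi> = "\<phi> i0"
  obtain C where C: "\<And>j. ?\<phi> j \<noteq> 0 \<Longrightarrow> 2 * v (?\<phi> j) \<ge> int j * k - C" using bounded[OF i0d] by blast
  \<comment> \<open>Adding the constant C makes the weighted valuation a natural number, so that a
    least value and a first index attaining it exist.\<close>
  define \<nu> where "\<nu> j = nat (2 * v (?\<phi> j) - int j * k + C)" for j
  have \<nu>: "int (\<nu> j) = 2 * v (?\<phi> j) - int j * k + C" if "?\<phi> j \<noteq> 0" for j
    using C[OF that] by (simp add: \<nu>_def)
  define M where "M = (LEAST m. \<exists>j. ?\<phi> j \<noteq> 0 \<and> \<nu> j = m)"
  have "\<exists>m j. ?\<phi> j \<noteq> 0 \<and> \<nu> j = m" using nonzero[OF i0d] by blast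
  then have exM: "\<exists>j. ?\<phi> j \<noteq> 0 \<and> \<nu> j = M" unfolding M_def by (rule LeastI_ex)
  have M_le: "M \<le> \<nu> j" if "?\<phi> j \<noteq> 0" for j unfolding M_def by (rule Least_le) (use that in blast)
  define js where "js = (LEAST j. ?\<phi> j \<noteq> 0 \<and> \<nu> j = M)"
  have js: "?\<phi> js \<noteq> 0" "\<nu> js = M" using LeastI_ex[OF exM] by (auto simp: js_def)
  have js_first: "\<nu> j > M" if "?\<phi> j \<noteq> 0" "j < js" for j
    using not_less_Least[of j "\<lambda>j. ?\<phi> j \<noteq> 0 \<and> \<nu> j = M"] that M_le[OF that(1)] by (auto simp: js_def)
  have "i0 \<le> js" using zero[OF i0d, of js] js(1) by linarith
  then obtain j where j: "js = j + i0" by (metis le_iff_add add.commute)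
  have w: "2 * v (?\<phi> js) = int M + int (j + i0) * k - C" using \<nu>[OF js(1)] js(2) j by simp
  have L0: "c j i0 * ?\<phi> js \<noteq> 0" using js(1) ai0 c0 by simp
  let ?N = "v (c j i0 * ?\<phi> js)"
  have N: "2 * ?N = \<mu> + int M + int j * k - C"
  proof -
    have "?N = v (a i0) + v (?\<phi> js)" using v_mult[of "c j i0" "?\<phi> js"] L0 cv[OF ai0] by auto
    then show ?thesis using w i0(2) unfolding f_def by (simp add: algebra_simps)
  qed
  \<comment> \<open>For i < i0 the inequality is strict because \<open>js\<close> is the first
    minimising index, for i > i0 because \<open>i0\<close> is the last index with minimal
    \<open>f\<close>.\<close>
  have term_i: "c j i * ?\<phi> (j + i) \<in> P (?N + 1)" if i: "i < d" "i \<noteq> i0" for i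
  proof (cases "c j i * ?\<phi> (j + i) = 0")
    case False
    then have nz: "a i \<noteq> 0" "?\<phi> (j + i) \<noteq> 0" using c0 by auto
    then have iI: "i \<in> I" using i by (simp add: I_def)
    have vt: "2 * v (c j i * ?\<phi> (j + i)) = f i + int (\<nu> (j + i)) + int j * k - C"
      using v_mult[of "c j i" "?\<phi> (j + i)"] False cv[OF nz(1), of j] \<nu>[OF nz(2)] unfolding f_def
      by (auto simp: algebra_simps)
    have "f i + int (\<nu> (j + i)) > \<mu> + int M"
    proof (cases "i < i0")
      case True
      then have "\<nu> (j + i) > M" using js_first[OF nz(2)] j by simp
      then show ?thesis using \<mu>_le[OF iI] by linarith
    next
      case False
      then have "f i > \<mu>" using i0_max[OF iI] i(2) by simp
      then show ?thesis using M_le[OF nz(2)] by linarith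
    qed
    then have "v (c j i * ?\<phi> (j + i)) \<ge> ?N + 1" using vt N by linarith
    then show ?thesis using False by (simp add: P_iff)
  qed (simp only: P_zero)
  \<comment> \<open>Here the assumed violation of the bound is used: it makes \<mu> smaller than d
    k, the weight of the leading coefficient 1.\<close>
  have term_d: "?\<phi> (j + d) \<in> P (?N + 1)"
  proof (cases "?\<phi> (j + d) = 0")
    case False
    have "2 * v (?\<phi> (j + d)) = int (\<nu> (j + d)) + int j * k + int d * k - C"
      using \<nu>[OF False] by (simp add: algebra_simps)
    then have "v (?\<phi> (j + d)) \<ge> ?N + 1" using N \<mu>_lt M_le[OF False] by linarith
    then show ?thesis using False by (simp add: P_iff)
  qed simp
  have "c j i0 * ?\<phi> js = ?\<phi> (j + d) - (\<Sum>i\<in>{..<d} - {i0}. c j i * ?\<phi> (j + i))"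
    using rec[OF i0d, of j] i0d by (simp add: sum.remove j)
  also have "\<dots> \<in> P (?N + 1)" by (intro P_diff term_d P_sum term_i) auto
  finally show False using L0 by (simp add: P_iff)
qed

end

section \<open>Basic Frobenius structures\<close>

locale val_frob = symp_frob n k \<sigma> \<pi> b + disc_val v
  for n k :: nat and \<sigma> :: "'a::field \<Rightarrow> 'a" and \<pi> :: 'a and b :: "'a mat" and v :: "'a \<Rightarrow> int" +
  assumes v\<sigma>: "\<And>x. x \<noteq> 0 \<Longrightarrow> v (\<sigma> x) = v x" and v\<pi>: "v \<pi> = 1"
    and k01: "k \<in> {0, 1}" and basic: "basic n \<sigma> \<pi> b" and complete: "val_complete v"
begin

lemma \<sigma>_P: "\<sigma> x \<in> P N \<longleftrightarrow> x \<in> P N"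
  using \<sigma>_eq_0[of x] v\<sigma>[of x] by (cases "x = 0") (auto simp: P_iff)

lemma \<pi>_power_P: "\<pi> ^ i \<in> P (int i)"
  using \<pi>0 by (simp add: P_iff v_power v\<pi>)

lemma \<sigma>i_eq_0: "(\<sigma> ^^ i) x = 0 \<longleftrightarrow> x = 0"
  by (induction i) (auto simp: \<sigma>_eq_0)

lemma v\<sigma>i: "x \<noteq> 0 \<Longrightarrow> v ((\<sigma> ^^ i) x) = v x"
  by (induction i) (auto simp: \<sigma>i_eq_0 v\<sigma>)

lemma \<sigma>i_P: "(\<sigma> ^^ i) x \<in> P N \<longleftrightarrow> x \<in> P N"
  by (induction i) (auto simp: \<sigma>_P)

lemma \<sigma>i_mult: "(\<sigma> ^^ i) (x * y) = (\<sigma> ^^ i) x * (\<sigma> ^^ i) y"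
  by (induction i) (auto simp: \<sigma>_mult)

lemma \<sigma>i_sum: "(\<sigma> ^^ i) (sum f A) = (\<Sum>j\<in>A. (\<sigma> ^^ i) (f j))"
  by (induction i) (auto simp: \<sigma>_sum)

lemma sigma_norm_simil: "is_simil n ((- (\<pi> ^ k)) ^ s) (sigma_norm n \<sigma> b s)"
proof (induction s)
  case (Suc s)
  have "\<sigma> ((- (\<pi> ^ k)) ^ s) = (- (\<pi> ^ k)) ^ s" by (simp add: \<sigma>_power \<sigma>_minus \<sigma>_\<pi>)
  then show ?case using is_simil_mult[OF b is_simil_map_\<sigma>[OF Suc]] by simp
qed (use is_simil_one in simp)

lemma Fs_norm: "x \<in> Car \<Longrightarrow> (F ^^ s) x = sigma_norm n \<sigma> b s *\<^sub>v map_vec (\<sigma> ^^ s) x"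
proof (induction s)
  case 0
  have "map_vec id x = x" by (intro eq_vecI) auto
  then show ?case using 0 by (simp add: id_def)
next
  case (Suc s)
  let ?N = "sigma_norm n \<sigma> b s"
  have NC: "?N \<in> carrier_mat (2 * n) (2 * n)" by (rule is_simil_carrier[OF sigma_norm_simil])
  have mx: "map_vec (\<sigma> ^^ s) x \<in> Car" "map_vec \<sigma> (map_vec (\<sigma> ^^ s) x) \<in> Car" using Suc.prems by auto
  have "(F ^^ Suc s) x = F (?N *\<^sub>v map_vec (\<sigma> ^^ s) x)"
    using Suc by simp
  also have "\<dots> = b *\<^sub>v map_vec \<sigma> (?N *\<^sub>v map_vec (\<sigma> ^^ s) x)"
    by (rule Frob_def)
  also have "\<dots> = b *\<^sub>v (map_mat \<sigma> ?N *\<^sub>v map_vec \<sigma> (map_vec (\<sigma> ^^ s) x))"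
    by (simp only: \<sigma>.mult_mat_vec_hom[OF NC mx(1)])
  also have "\<dots> = (b * map_mat \<sigma> ?N) *\<^sub>v map_vec \<sigma> (map_vec (\<sigma> ^^ s) x)"
    by (rule assoc_mult_mat_vec[OF b_carrier _ mx(2), symmetric]) (use NC in auto)
  also have "map_vec \<sigma> (map_vec (\<sigma> ^^ s) x) = map_vec (\<sigma> ^^ Suc s) x" by (intro eq_vecI) auto
  finally show ?case by (simp add: o_def)
qed

lemma is_simil_map_\<sigma>i: "is_simil n l g \<Longrightarrow> is_simil n ((\<sigma> ^^ s) l) (map_mat (\<sigma> ^^ s) g)"
proof (induction s)
  case 0
  have "map_mat id g = g" by (intro eq_matI) auto
  then show ?case using 0 by (simp add: id_def)
next
  case (Suc s)
  have "map_mat \<sigma> (map_mat (\<sigma> ^^ s) g) = map_mat (\<sigma> ^^ Suc s) g" by (intro eq_matI) auto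
  then show ?case using is_simil_map_\<sigma>[OF Suc.IH[OF Suc.prems]] by (simp add: o_def)
qed

lemma map_\<sigma>i_mult:
  assumes g: "g \<in> carrier_mat (2 * n) (2 * n)" and x: "x \<in> Car"
  shows "map_vec (\<sigma> ^^ s) (g *\<^sub>v x) = map_mat (\<sigma> ^^ s) g *\<^sub>v map_vec (\<sigma> ^^ s) x"
  by (rule eq_vecI) (use g x in \<open>auto simp: scalar_prod_def \<sigma>i_sum \<sigma>i_mult intro!: sum.cong\<close>)

lemma smult_mat_mult_vec: "g \<in> carrier_mat (2 * n) (2 * n) \<Longrightarrow> x \<in> Car \<Longrightarrow> (c \<cdot>\<^sub>m g) *\<^sub>v x = c \<cdot>\<^sub>v (g *\<^sub>v x)"
  by (intro eq_vecI) auto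

text \<open>Being basic says that F^s becomes \<pi>^j \<sigma>^s in the coordinates given by c. The
  exponent is forced: the similitude factors of the two sides have equal valuation and \<sigma>
  preserves valuations, whence 2j = s k.\<close>

lemma basic_isoclinic:
  obtains s l c j where "s > 0" "is_simil n l c" "2 * j = int (s * k)"
    "\<forall>x\<in>Car. c *\<^sub>v (F ^^ s) x = \<pi> powi j \<cdot>\<^sub>v map_vec (\<sigma> ^^ s) (c *\<^sub>v x)"
proof -
  obtain s j c where s: "s > 0" and c: "c \<in> carrier (GSp n)"
    and eq: "c * sigma_norm n \<sigma> b s * inv\<^bsub>GSp n\<^esub> (map_mat (\<sigma> ^^ s) c) = (\<pi> powi j) \<cdot>\<^sub>m 1\<^sub>m (2 * n)"
    using basic by (auto simp: basic_def)
  obtain l where l: "is_simil n l c" using c by (auto simp: GSp_iff)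
  let ?N = "sigma_norm n \<sigma> b s" and ?c = "map_mat (\<sigma> ^^ s) c"
  have cs: "is_simil n ((\<sigma> ^^ s) l) ?c" using l by (rule is_simil_map_\<sigma>i)
  have C: "c \<in> carrier_mat (2 * n) (2 * n)" "?N \<in> carrier_mat (2 * n) (2 * n)" "?c \<in> carrier_mat (2 * n) (2 * n)"
    using is_simil_carrier l sigma_norm_simil cs by blast+
  then have cN: "c * ?N \<in> carrier_mat (2 * n) (2 * n)" by auto
  have "c * ?N = (c * ?N) * (sinv n ((\<sigma> ^^ s) l) ?c * ?c)"
    using right_mult_one_mat[OF cN] by (simp add: sinv_left[OF cs])
  also have "\<dots> = (c * ?N * inv\<^bsub>GSp n\<^esub> ?c) * ?c"
    unfolding GSp_inv[OF cs] by (rule assoc_mult_mat[OF cN sinv_carrier C(3), symmetric])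
  also have "\<dots> = (\<pi> powi j) \<cdot>\<^sub>m ?c"
    unfolding eq using C(3) by (simp add: mult_smult_assoc_mat[of _ "2 * n" "2 * n"])
  finally have cNe: "c * ?N = (\<pi> powi j) \<cdot>\<^sub>m ?c" .
  have p0: "\<pi> powi j \<noteq> 0" using \<pi>0 by simp
  have fact: "c *\<^sub>v (F ^^ s) x = \<pi> powi j \<cdot>\<^sub>v map_vec (\<sigma> ^^ s) (c *\<^sub>v x)" if x: "x \<in> Car" for x
  proof -
    have mx: "map_vec (\<sigma> ^^ s) x \<in> Car" using x by simp
    have "c *\<^sub>v (F ^^ s) x = (c * ?N) *\<^sub>v map_vec (\<sigma> ^^ s) x"
      unfolding Fs_norm[OF x] by (rule assoc_mult_mat_vec[OF C(1,2) mx, symmetric])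
    also have "\<dots> = \<pi> powi j \<cdot>\<^sub>v (?c *\<^sub>v map_vec (\<sigma> ^^ s) x)"
      unfolding cNe by (rule smult_mat_mult_vec[OF C(3) mx])
    finally show ?thesis unfolding map_\<sigma>i_mult[OF C(1) x] .
  qed
  have "is_simil n (l * (- (\<pi> ^ k)) ^ s) ((\<pi> powi j) \<cdot>\<^sub>m ?c)"
    using is_simil_mult[OF l sigma_norm_simil[of s]] unfolding cNe .
  moreover have "is_simil n ((\<pi> powi j * \<pi> powi j) * (\<sigma> ^^ s) l) ((\<pi> powi j) \<cdot>\<^sub>m ?c)"
  proof (rule is_similI)
    fix i i' assume ii: "i < 2 * n" "i' < 2 * n"
    have "col ((\<pi> powi j) \<cdot>\<^sub>m ?c) i = \<pi> powi j \<cdot>\<^sub>v col ?c i" if "i < 2 * n" for i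
      using that C(3) by (intro eq_vecI) auto
    moreover have "col ?c i \<in> Car" if "i < 2 * n" for i by (rule col_carrier_vec[OF that C(3)])
    ultimately show "sform n (col ((\<pi> powi j) \<cdot>\<^sub>m ?c) i) (col ((\<pi> powi j) \<cdot>\<^sub>m ?c) i')
      = \<pi> powi j * \<pi> powi j * (\<sigma> ^^ s) l * (if i + i' = 2 * n - 1 then (- 1) ^ i' else 0)"
      using ii is_simil_gram[OF cs ii] by (simp add: sform_smult_left sform_smult_right)
  qed (use C p0 is_simil_nonzero[OF cs] in auto)
  ultimately have leq: "l * (- (\<pi> ^ k)) ^ s = (\<pi> powi j * \<pi> powi j) * (\<sigma> ^^ s) l"
    using is_simil_unique[OF n1] by blast
  have l0: "l \<noteq> 0" using l by (rule is_simil_nonzero)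
  have "v (l * (- (\<pi> ^ k)) ^ s) = v l + int s * int k"
    using l0 \<pi>0 by (simp add: v_mult v_power v\<pi>)
  moreover have "v ((\<pi> powi j * \<pi> powi j) * (\<sigma> ^^ s) l) = 2 * j + v l"
    using l0 \<pi>0 p0 \<sigma>i_eq_0[of s l] by (simp add: v_mult v_powi v\<pi> v\<sigma>i)
  ultimately have "2 * j = int (s * k)" using leq by simp
  from that[OF s l this] fact show ?thesis by blast
qed

text \<open>In the coordinates of \<open>basic_isoclinic\<close>, s applications of F raise the
  valuations of all entries by s k / 2; the fewer than s remaining applications and the pairing with
  y affect the bound only by a constant.\<close>

lemma isoclinic_bounded:
  assumes z: "z \<in> Car" and y: "y \<in> Car"
  shows "\<exists>C. \<forall>j. sform n ((F ^^ j) z) y \<noteq> 0 \<longrightarrow> 2 * v (sform n ((F ^^ j) z) y) \<ge> int j * int k - C"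
proof -
  obtain s l c e where s: "s > 0" and c: "is_simil n l c" and e: "2 * e = int (s * k)"
    and cF: "\<forall>x\<in>Car. c *\<^sub>v (F ^^ s) x = \<pi> powi e \<cdot>\<^sub>v map_vec (\<sigma> ^^ s) (c *\<^sub>v x)"
    using basic_isoclinic .
  have cC: "c \<in> carrier_mat (2 * n) (2 * n)" using c by (rule is_simil_carrier)
  have l0: "l \<noteq> 0" using c by (rule is_simil_nonzero)
  have "finite ((\<lambda>(i, q). (c *\<^sub>v (F ^^ q) z) $ i) ` ({..<2 * n} \<times> {..<s}))" by simp
  then obtain B where "\<And>x. x \<in> (\<lambda>(i, q). (c *\<^sub>v (F ^^ q) z) $ i) ` ({..<2 * n} \<times> {..<s}) \<Longrightarrow> x \<in> P B"
    using finite_P_bound by blast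
  then have B: "(c *\<^sub>v (F ^^ q) z) $ i \<in> P B" if "i < 2 * n" "q < s" for i q using that by blast
  have "finite ((\<lambda>i. (c *\<^sub>v y) $ i) ` {..<2 * n})" by simp
  then obtain B' where "\<And>x. x \<in> (\<lambda>i. (c *\<^sub>v y) $ i) ` {..<2 * n} \<Longrightarrow> x \<in> P B'"
    using finite_P_bound by blast
  then have B': "(c *\<^sub>v y) $ i \<in> P B'" if "i < 2 * n" for i using that by blast
  have ent: "(c *\<^sub>v (F ^^ (t * s + q)) z) $ i \<in> P (int t * e + B)" if i: "i < 2 * n" and q: "q < s" for t q i
  proof (induction t)
    case 0
    then show ?case using B[OF i q] by simp
  next
    case (Suc t)
    let ?x = "(F ^^ (t * s + q)) z"
    have xC: "?x \<in> Car" "c *\<^sub>v ?x \<in> Car" using z cC by auto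
    have "(F ^^ (Suc t * s + q)) z = (F ^^ s) ?x" by (simp add: add.assoc flip: funpow_add[unfolded o_def fun_eq_iff, rule_format])
    then have "(c *\<^sub>v (F ^^ (Suc t * s + q)) z) $ i = \<pi> powi e * (\<sigma> ^^ s) ((c *\<^sub>v ?x) $ i)"
      using bspec[OF cF xC(1)] i xC cC by simp
    also have "\<dots> \<in> P (e + (int t * e + B))"
      using Suc \<pi>0 by (intro P_mult) (auto simp: P_iff v_powi v\<pi> \<sigma>i_P)
    finally show ?case by (simp add: algebra_simps)
  qed
  \<comment> \<open>The term s k pays for rounding j down to a multiple of s. B and B' bound the
    transformed entries of the first s iterates and of y, and v l appears because c multiplies the
    form by l.\<close>
  define C where "C = int (s * k) - 2 * (B + B' - v l)"
  have "2 * v (sform n ((F ^^ j) z) y) \<ge> int j * int k - C" if nz: "sform n ((F ^^ j) z) y \<noteq> 0" for j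
  proof -
    define t q where "t = j div s" and "q = j mod s"
    have j: "j = t * s + q" and q: "q < s" using s by (auto simp: t_def q_def)
    have xC: "(F ^^ j) z \<in> Car" "c *\<^sub>v (F ^^ j) z \<in> Car" "c *\<^sub>v y \<in> Car" using z y cC by auto
    have "l * sform n ((F ^^ j) z) y = sform n (c *\<^sub>v (F ^^ j) z) (c *\<^sub>v y)"
      by (rule sform_simil[OF c xC(1) y, symmetric])
    also have "\<dots> \<in> P ((int t * e + B) + B')"
      unfolding sform_sum[OF xC(2,3)]
    proof (rule P_sum)
      fix i assume i: "i \<in> {..<2 * n}"
      then have "(c *\<^sub>v (F ^^ j) z) $ i * (c *\<^sub>v y) $ (2 * n - 1 - i) \<in> P ((int t * e + B) + B')"
        using ent[of i q t] B'[of "2 * n - 1 - i"] q unfolding j by (intro P_mult) auto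
      then show "(- 1) ^ Suc i * (c *\<^sub>v (F ^^ j) z) $ i * (c *\<^sub>v y) $ (2 * n - 1 - i) \<in> P ((int t * e + B) + B')"
        unfolding mult.assoc P_sign_mult .
    qed
    finally have "(int t * e + B) + B' \<le> v l + v (sform n ((F ^^ j) z) y)"
      using l0 nz by (simp add: P_iff v_mult)
    moreover have "2 * (int t * e) = int (t * s) * int k"
    proof -
      have "2 * (int t * e) = int t * (2 * e)" by simp
      then show ?thesis unfolding e by simp
    qed
    moreover have "int (t * s) * int k \<ge> int j * int k - int (s * k)"
    proof -
      have "int q * int k \<le> int s * int k" using q by (intro mult_right_mono) auto
      then show ?thesis unfolding j by (simp add: algebra_simps)
    qed
    moreover have "2 * y \<ge> J - (S - 2 * (B + B' - L))"
      if "a + B + B' \<le> L + y" "2 * a = Q" "Q \<ge> J - S" for a y L Q J S :: int using that by arith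
    ultimately show ?thesis unfolding C_def by blast
  qed
  then show ?thesis by blast
qed

text \<open>Linear combinations are tested against the form, which avoids sums of vectors.\<close>

definition lincomb :: "(nat \<Rightarrow> 'a vec) \<Rightarrow> nat \<Rightarrow> (nat \<Rightarrow> 'a) \<Rightarrow> 'a vec \<Rightarrow> bool" where
  "lincomb u N c x \<longleftrightarrow> (\<forall>y\<in>Car. sform n x y = (\<Sum>i<N. c i * sform n (u i) y))"

lemma lincomb_F:
  assumes "lincomb u N c x" "x \<in> Car" "\<And>i. u i \<in> Car"
  shows "lincomb (\<lambda>i. F (u i)) N (\<lambda>i. \<sigma> (c i)) (F x)"
  unfolding lincomb_def
proof
  fix y assume y: "y \<in> Car"
  have F: "sform n (F x) y = - (\<pi> ^ k) * \<sigma> (sform n x (Finv y))" if "x \<in> Car" for x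
    using sform_F[OF that, of "Finv y"] y by simp
  have "sform n (F x) y = - (\<pi> ^ k) * \<sigma> (\<Sum>i<N. c i * sform n (u i) (Finv y))"
    using assms y by (simp add: F lincomb_def)
  also have "\<dots> = (\<Sum>i<N. \<sigma> (c i) * sform n (F (u i)) y)"
    unfolding \<sigma>_sum sum_distrib_left using assms by (intro sum.cong) (auto simp: F \<sigma>_mult)
  finally show "sform n (F x) y = (\<Sum>i<N. \<sigma> (c i) * sform n (F (u i)) y)" .
qed

lemma lincomb_Fi:
  assumes "lincomb u N c x" "x \<in> Car" "\<And>i. u i \<in> Car"
  shows "lincomb (\<lambda>i. (F ^^ j) (u i)) N (\<lambda>i. (\<sigma> ^^ j) (c i)) ((F ^^ j) x)"
proof (induction j)
  case (Suc j)
  show ?case using lincomb_F[OF Suc] assms by simp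
qed (use assms in simp)

context
  fixes w assumes w: "w \<in> Vs"
begin

lemma wC: "w \<in> Car"
  using w by (rule Vs_carrier)

text \<open>Going back n - 1 steps from w places every vector of the relation on one F-orbit:
  X_(n-1) is a combination of its first n members, and F^(l+1) w is the member with index n +
  l.\<close>

definition cyc where "cyc = (Finv ^^ (n - 1)) w"

lemma Finvi_carrier [simp]: "x \<in> Car \<Longrightarrow> (Finv ^^ i) x \<in> Car"
  by (induction i) auto

lemma Fi_Finvi: "x \<in> Car \<Longrightarrow> (F ^^ i) ((Finv ^^ i) x) = x"
proof (induction i)
  case (Suc i)
  have "(F ^^ Suc i) ((Finv ^^ Suc i) x) = (F ^^ i) (F (Finv ((Finv ^^ i) x)))"
    by (simp add: funpow_swap1)
  then show ?case using Suc by simp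
qed simp

lemma cyc_carrier [simp]: "cyc \<in> Car"
  using wC by (simp add: cyc_def)

lemma Fi_cyc: "(F ^^ (n - 1)) cyc = w"
  using wC by (simp add: cyc_def Fi_Finvi)

lemma Fi_cyc_Suc: "(F ^^ (n + l)) cyc = (F ^^ Suc l) w"
proof -
  have "n + l = Suc l + (n - 1)" using n1 by simp
  then have "(F ^^ (n + l)) cyc = (F ^^ Suc l) ((F ^^ (n - 1)) cyc)" by (simp only: funpow_add o_apply)
  then show ?thesis by (simp only: Fi_cyc)
qed

text \<open>V lowers the index on the orbit of \<open>cyc\<close> by one at the cost of \<pi>^k. The
  clause on vanishing coefficients carries the induction: it keeps index 0 free until the last step,
  so V never leaves the first n members.\<close>

lemma Xv_lincomb:
  "i < n \<Longrightarrow> \<exists>c. lincomb (\<lambda>m. (F ^^ m) cyc) n c (Xv w i) \<and> (\<forall>m. m + i < n - 1 \<longrightarrow> c m = 0)"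
proof (induction i)
  case 0
  have "lincomb (\<lambda>m. (F ^^ m) cyc) n (\<lambda>m. if m = n - 1 then 1 else 0) w"
    unfolding lincomb_def
  proof
    fix y
    have "(\<Sum>i<n. (if i = n - 1 then 1 else 0) * sform n ((F ^^ i) cyc) y)
        = (\<Sum>i<n. if i = n - 1 then sform n w y else 0)"
      by (intro sum.cong) (auto simp: Fi_cyc[simplified])
    then show "sform n w y = (\<Sum>i<n. (if i = n - 1 then 1 else 0) * sform n ((F ^^ i) cyc) y)"
      using n1 by simp
  qed
  then show ?case by (intro exI[of _ "\<lambda>m. if m = n - 1 then 1 else 0"]) auto
next
  case (Suc i)
  then obtain c where c: "lincomb (\<lambda>m. (F ^^ m) cyc) n c (Xv w i)" "\<And>m. m + i < n - 1 \<Longrightarrow> c m = 0" by auto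
  let ?x = "Xv w i"
  let ?e = "sform n (V ?x) ((F ^^ n) w) / \<alpha> w" and ?u = "gsgn i * (\<alpha> w / \<tau> (\<alpha> w))"
  define d where "d m = (if m = n - 1 then - ?u * ?e else ?u * (\<tau> (c (Suc m)) * \<pi> ^ k))" for m
  have "lincomb (\<lambda>m. (F ^^ m) cyc) n d (Xv w (Suc i))"
    unfolding lincomb_def
  proof
    fix y assume y: "y \<in> Car"
    have xC: "?x \<in> Car" using wC by simp
    obtain n' where n': "n = Suc n'" using n1 by (cases n) auto
    have c0: "c 0 = 0" using c(2)[of 0] Suc.prems by simp
    have "sform n (V ?x) y = - \<tau> (\<Sum>m<n. c m * sform n ((F ^^ m) cyc) (F y))"
      using c(1) y xC by (simp add: sform_V_left lincomb_def)
    also have "\<dots> = (\<Sum>m<n. \<tau> (c m) * - \<tau> (sform n ((F ^^ m) cyc) (F y)))"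
    proof -
      have "\<tau> (sum f A) = (\<Sum>i\<in>A. \<tau> (f i))" for f and A :: "nat set"
        by (induction A rule: infinite_finite_induct) (auto simp: \<tau>_add)
      then show ?thesis by (simp add: sum_negf \<tau>_mult)
    qed
    also have "\<dots> = (\<Sum>m<n. \<tau> (c m) * sform n (V ((F ^^ m) cyc)) y)"
      using y by (intro sum.cong) (auto simp: sform_V_left)
    also have "\<dots> = (\<Sum>m<n'. \<tau> (c (Suc m)) * sform n (V ((F ^^ Suc m) cyc)) y)"
      using c0 unfolding n' by (subst sum.lessThan_Suc_shift) simp
    also have "\<dots> = (\<Sum>m<n'. \<tau> (c (Suc m)) * \<pi> ^ k * sform n ((F ^^ m) cyc) y)"
      using y by (intro sum.cong) (auto simp: V_Finv sform_smult_left)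
    finally have Vx: "sform n (V ?x) y = (\<Sum>m<n'. \<tau> (c (Suc m)) * \<pi> ^ k * sform n ((F ^^ m) cyc) y)" .
    have Fz: "(F ^^ n') cyc = w" using Fi_cyc n' by simp
    have "sform n (Xv w (Suc i)) y = ?u * (sform n (V ?x) y - ?e * sform n w y)"
      using y xC wC by (simp add: Xv_Suc Gstep_def sform_smult_left sform_minus_left)
    also have "\<dots> = (\<Sum>m<n'. ?u * (\<tau> (c (Suc m)) * \<pi> ^ k) * sform n ((F ^^ m) cyc) y) - ?u * ?e * sform n w y"
      unfolding Vx by (simp add: sum_distrib_left right_diff_distrib mult.assoc)
    also have "\<dots> = (\<Sum>m<n. d m * sform n ((F ^^ m) cyc) y)"
    proof -
      have "(\<Sum>m<n. d m * sform n ((F ^^ m) cyc) y) = (\<Sum>m<n'. d m * sform n ((F ^^ m) cyc) y) + d n' * sform n ((F ^^ n') cyc) y"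
        unfolding n' by simp
      moreover have "(\<Sum>m<n'. d m * sform n ((F ^^ m) cyc) y) = (\<Sum>m<n'. ?u * (\<tau> (c (Suc m)) * \<pi> ^ k) * sform n ((F ^^ m) cyc) y)"
        by (intro sum.cong) (auto simp: d_def n')
      moreover have "d n' = - ?u * ?e" by (simp add: d_def n')
      ultimately show ?thesis unfolding Fz by simp
    qed
    finally show "sform n (Xv w (Suc i)) y = (\<Sum>m<n. d m * sform n ((F ^^ m) cyc) y)" .
  qed
  moreover have "\<forall>m. m + Suc i < n - 1 \<longrightarrow> d m = 0" using c(2) by (auto simp: d_def)
  ultimately show ?case by blast
qed

text \<open>Expanding X_(n-1) turns the relation into a recurrence of order 2n for the orbit of
  \<open>cyc\<close>, in which c_l is the coefficient with index n + l. Its distance n - l from the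
  top is the weight in the bound of \<open>newton_bound\<close>.\<close>

lemma relation_bound:
  assumes rel: "\<And>y. y \<in> Car \<Longrightarrow> sform n (F ((F ^^ n) w)) y = u * sform n (Xv w (n - 1)) y
       + (\<Sum>l<n. c l * sform n ((F ^^ Suc l) w) y)"
    and l: "l < n" "c l \<noteq> 0"
  shows "2 * v (c l) \<ge> int (n - l) * int k"
proof -
  obtain d where d: "lincomb (\<lambda>m. (F ^^ m) cyc) n d (Xv w (n - 1))" using Xv_lincomb[of "n - 1"] n1 by auto
  define a where "a i = (if i < n then u * d i else c (i - n))" for i
  have "lincomb (\<lambda>m. (F ^^ m) cyc) (2 * n) a ((F ^^ (2 * n)) cyc)"
    unfolding lincomb_def
  proof
    fix y assume y: "y \<in> Car"
    have "(F ^^ (2 * n)) cyc = F ((F ^^ n) w)" using Fi_cyc_Suc[of n] by (simp add: mult_2)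
    then have "sform n ((F ^^ (2 * n)) cyc) y = u * sform n (Xv w (n - 1)) y + (\<Sum>l<n. c l * sform n ((F ^^ Suc l) w) y)"
      using rel[OF y] by simp
    also have "u * sform n (Xv w (n - 1)) y = (\<Sum>i<n. a i * sform n ((F ^^ i) cyc) y)"
      using d y by (simp add: lincomb_def sum_distrib_left a_def mult.assoc)
    also have "(\<Sum>l<n. c l * sform n ((F ^^ Suc l) w) y) = (\<Sum>i<n. a (n + i) * sform n ((F ^^ (n + i)) cyc) y)"
      unfolding Fi_cyc_Suc by (simp add: a_def)
    also have "\<dots> = (\<Sum>i\<in>{n..<2 * n}. a i * sform n ((F ^^ i) cyc) y)"
      by (rule sum.reindex_bij_witness[of _ "\<lambda>i. i - n" "\<lambda>i. n + i"]) auto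
    also have "(\<Sum>i<n. a i * sform n ((F ^^ i) cyc) y) + \<dots> = (\<Sum>i<2 * n. a i * sform n ((F ^^ i) cyc) y)"
      by (subst sum.union_disjoint[symmetric]) (auto intro!: sum.cong)
    finally show "sform n ((F ^^ (2 * n)) cyc) y = (\<Sum>i<2 * n. a i * sform n ((F ^^ i) cyc) y)" .
  qed
  then have R: "lincomb (\<lambda>m. (F ^^ j) ((F ^^ m) cyc)) (2 * n) (\<lambda>i. (\<sigma> ^^ j) (a i)) ((F ^^ j) ((F ^^ (2 * n)) cyc))" for j
    by (rule lincomb_Fi) auto
  \<comment> \<open>The test vectors must make the solution \<phi> start exactly at index i0. Moving
    both arguments forward by F^(2n-1) yields the pairing of F^(n+j) w with F^i0 w, which vanishes
    for j < i0 by the orthogonality in \<open>Vsymp\<close> and is nonzero for j = i0 because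
    \<alpha> w is.\<close>
  let ?cyc = "(Finv ^^ n) cyc"
  define \<phi> where "\<phi> i0 j = sform n ((F ^^ j) cyc) ((F ^^ i0) ?cyc)" for i0 j
  have key: "\<phi> i0 j = 0 \<longleftrightarrow> sform n ((F ^^ (n + j)) w) ((F ^^ i0) w) = 0" for i0 j
  proof -
    have zz: "(F ^^ n) ?cyc = cyc" by (simp add: Fi_Finvi)
    have s: "(F ^^ (2 * n - 1)) ((F ^^ i) ?cyc) = (F ^^ i) w" for i
    proof -
      have "(F ^^ (2 * n - 1)) ((F ^^ i) ?cyc) = (F ^^ i) ((F ^^ (n - 1)) ((F ^^ n) ?cyc))"
      proof -
        have "2 * n - 1 + i = i + ((n - 1) + n)" using n1 by simp
        then show ?thesis by (metis comp_apply funpow_add)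
      qed
      then show ?thesis by (simp only: zz Fi_cyc)
    qed
    have "(F ^^ j) cyc = (F ^^ (n + j)) ?cyc" using zz by (metis add.commute comp_apply funpow_add)
    then have "\<phi> i0 j = 0 \<longleftrightarrow> sform n ((F ^^ (n + j)) ?cyc) ((F ^^ i0) ?cyc) = 0" by (simp add: \<phi>_def)
    also have "\<dots> \<longleftrightarrow> sform n ((F ^^ (2 * n - 1)) ((F ^^ (n + j)) ?cyc)) ((F ^^ (2 * n - 1)) ((F ^^ i0) ?cyc)) = 0"
      by (rule sform_Fi_eq_0[symmetric]) auto
    finally show ?thesis unfolding s .
  qed
  have "2 * v (a (n + l)) \<ge> int (2 * n - (n + l)) * int k"
  proof (rule newton_bound[where c = "\<lambda>j i. (\<sigma> ^^ j) (a i)" and \<phi> = \<phi>])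
    fix i0 j :: nat assume i0: "i0 < 2 * n"
    show "\<phi> i0 (j + 2 * n) = (\<Sum>i<2 * n. (\<sigma> ^^ j) (a i) * \<phi> i0 (j + i))"
      using R[of j] by (simp add: lincomb_def \<phi>_def funpow_add)
    show "\<phi> i0 j = 0" if "j < i0"
      unfolding key using sform_Fi_Fj[OF w, of "n + j" i0] that i0 by simp
    have "sform n ((F ^^ (n + i0)) w) ((F ^^ i0) w) = 0 \<longleftrightarrow> sform n ((F ^^ i0) ((F ^^ n) w)) ((F ^^ i0) w) = 0"
      by (metis add.commute comp_apply funpow_add)
    also have "\<dots> \<longleftrightarrow> sform n ((F ^^ n) w) w = 0" using wC by (intro sform_Fi_eq_0) auto
    also have "\<dots> \<longleftrightarrow> False" using \<alpha>_nonzero[OF w] sform_swap[of w n "(F ^^ n) w"] wC by (simp add: alpha_def)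
    finally show "\<phi> i0 i0 \<noteq> 0" unfolding key by simp
    show "\<exists>C. \<forall>j. \<phi> i0 j \<noteq> 0 \<longrightarrow> 2 * v (\<phi> i0 j) \<ge> int j * int k - C"
      unfolding \<phi>_def by (rule isoclinic_bounded) auto
  qed (use l in \<open>auto simp: \<sigma>i_eq_0 v\<sigma>i a_def\<close>)
  then show ?thesis by (simp add: a_def)
qed

end

end

section \<open>Cosets attached to vectors\<close>

lemma GSp_lcoset_eq_iff:
  assumes "subgroup K (GSp n)" "g \<in> carrier (GSp n)" "h \<in> carrier (GSp n)"
  shows "g <#\<^bsub>GSp n\<^esub> K = h <#\<^bsub>GSp n\<^esub> K \<longleftrightarrow> (\<exists>a\<in>K. h = g * a)"
proof -
  interpret group "GSp n :: 'a mat monoid" by (rule group_GSp)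
  interpret K: subgroup K "GSp n" by (rule assms)
  show ?thesis
  proof
    assume "g <#\<^bsub>GSp n\<^esub> K = h <#\<^bsub>GSp n\<^esub> K"
    moreover have "h \<in> h <#\<^bsub>GSp n\<^esub> K"
      using K.one_closed GSp_carrier_mat[OF assms(3)] by (force simp: l_coset_def)
    ultimately show "\<exists>a\<in>K. h = g * a" by (auto simp: l_coset_def)
  next
    assume "\<exists>a\<in>K. h = g * a"
    then have "h \<in> g <#\<^bsub>GSp n\<^esub> K" by (auto simp: l_coset_def)
    then show "g <#\<^bsub>GSp n\<^esub> K = h <#\<^bsub>GSp n\<^esub> K" using l_repr_independence assms by blast
  qed
qed

locale val_frob_type = val_frob n k \<sigma> \<pi> b v + frob_type n k \<sigma> \<pi> b D up low r
  for n k :: nat and \<sigma> :: "'a::field \<Rightarrow> 'a" and \<pi> :: 'a and b :: "'a mat" and v :: "'a \<Rightarrow> int"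
    and D up low :: "'a set" and r :: nat +
  assumes P_up: "P (int (r + k)) \<subseteq> up"
begin

text \<open>In the shape found by \<open>A_exists\<close> the only entries left to bound are t_l
  with l < n, in the last column and, up to sign, in row 0, all above the diagonal. They are
  rescaled coefficients of the relation for F^(n+1) w, to which \<open>relation_bound\<close>
  applies.\<close>

lemma A_in_H:
  assumes w: "w \<in> Vs" and u: "\<sigma> (\<alpha> w) / \<alpha> w \<in> D"
  shows "\<exists>A\<in>H. b * map_mat \<sigma> (gm r w) = gm r w * (W r * A)"
proof (rule A_exists[OF w, of r])
  let ?u = "\<sigma> (\<alpha> w) / \<alpha> w"
  fix A t assume A: "is_simil n ?u A" and rel: "b * map_mat \<sigma> (gm r w) = gm r w * (W r * A)"
    and c1: "\<And>j. j < n \<Longrightarrow> col A j = unit_vec (2 * n) j"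
    and c2: "\<And>i. i < n - 1 \<Longrightarrow> col A (n + i) = ?u \<cdot>\<^sub>v unit_vec (2 * n) (n + i)
        + ((- 1) ^ (n + i + 1) * t $ (n - 1 - i)) \<cdot>\<^sub>v unit_vec (2 * n) 0"
    and c3: "col A (2 * n - 1) = t" and t: "t \<in> Car" "t $ (2 * n - 1) = ?u" "\<And>j. n \<le> j \<Longrightarrow> j < 2 * n - 1 \<Longrightarrow> t $ j = 0"
    and R: "\<And>y. y \<in> Car \<Longrightarrow> sform n (F ((F ^^ n) w)) y = ?u * \<pi> ^ k * sform n (Xv w (n - 1)) y
       + (\<Sum>l<n. t $ l * inverse (\<pi> ^ ((n - l) * r)) * sform n ((F ^^ Suc l) w) y)"
  have tl: "t $ l \<in> up" if l: "l < n" for l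
  proof (cases "t $ l = 0")
    case False
    let ?c = "t $ l * inverse (\<pi> ^ ((n - l) * r))"
    have c0: "?c \<noteq> 0" using False \<pi>0 by simp
    have "2 * v ?c \<ge> int (n - l) * int k"
      using relation_bound[OF w R l c0] .
    moreover have "v ?c = v (t $ l) - int (n - l) * int r"
      using False \<pi>0 by (simp add: v_mult v_inverse v_power v\<pi>)
    ultimately have "2 * v (t $ l) \<ge> int (n - l) * int k + 2 * (int (n - l) * int r)" by simp
    moreover have "int (n - l) * int k + 2 * (int (n - l) * int r) \<ge> int k + 2 * int r"
    proof -
      have "int (n - l) \<ge> 1" using l by simp
      then have "int (n - l) * (int k + 2 * int r) \<ge> 1 * (int k + 2 * int r)" by (intro mult_right_mono) auto
      then show ?thesis by (simp add: algebra_simps)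
    qed
    ultimately have "2 * v (t $ l) \<ge> int k + 2 * int r" by linarith
    \<comment> \<open>For k = 1 an even number is bounded below by the odd number 2r + 1, which
      gains the missing half.\<close>
    then have "v (t $ l) \<ge> int (r + k)" using k01 by auto
    then have "t $ l \<in> P (int (r + k))" using False by (simp add: P_iff)
    then show ?thesis using P_up by blast
  qed (simp add: up0)
  have "col_typ j (col A j)" if j: "j < 2 * n" for j
  proof -
    consider "j < n" | i where "j = n + i" "i < n - 1" | "j = 2 * n - 1" "n \<le> j"
      by (cases "j < n"; cases "j = 2 * n - 1") (use j in \<open>force simp: le_iff_add not_less\<close>)+
    then show ?thesis
    proof cases
      case 1
      then show ?thesis using j by (auto simp: c1 col_typ_def unit_vec_def D1 up0 low0)
    next
      case 2
      have "(- 1) ^ (n + i + 1) * t $ (n - 1 - i) \<in> up" by (rule sign_up[OF tl]) (use n1 in simp)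
      then show ?thesis unfolding 2(1) c2[OF 2(2)] using 2 n1 u by (auto simp: col_typ_def unit_vec_def up0 low0)
    next
      case 3
      have "t $ i \<in> up" if "i < 2 * n - 1" for i
        using that tl[of i] t(3)[of i] up0 by (cases "i < n") auto
      then show ?thesis unfolding 3(1) c3 using t u by (auto simp: col_typ_def)
    qed
  qed
  then have "A \<in> H" using A by (auto simp: H_iff GSp_iff)
  then show ?thesis using rel by blast
qed

text \<open>\<open>A_in_H\<close> makes g = g_(b,r)(w) itself a matrix to which
  \<open>gm_factor\<close> applies, so the first column alone decides the coset.\<close>

lemma gm_coset_eqI:
  assumes w: "w \<in> Vs" "\<sigma> (\<alpha> w) / \<alpha> w \<in> D" and y: "y \<in> Vs" and x: "col_typ 0 x" "y = gm r w *\<^sub>v x"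
  shows "gm r w <#\<^bsub>GSp n\<^esub> H = gm r y <#\<^bsub>GSp n\<^esub> H"
proof -
  obtain A where A: "A \<in> H" "b * map_mat \<sigma> (gm r w) = gm r w * (W r * A)" using A_in_H[OF w] by blast
  have "gT (gm r w) 0 y" unfolding gT_def[OF gm_simil[OF w(1)] A] using x by blast
  then have "\<exists>h\<in>H. gm r y = gm r w * h" by (rule gm_factor[OF gm_simil[OF w(1)] A y])
  then show ?thesis using GSp_lcoset_eq_iff[OF H_subgroup gm_GSp[OF w(1)] gm_GSp[OF y]] by simp
qed

lemma gm_coset_eqD:
  assumes w: "w \<in> Vs" and y: "y \<in> Vs" and eq: "gm r w <#\<^bsub>GSp n\<^esub> H = gm r y <#\<^bsub>GSp n\<^esub> H"
  shows "\<exists>x. col_typ 0 x \<and> y = gm r w *\<^sub>v x"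
proof -
  obtain h where h: "h \<in> H" "gm r y = gm r w * h"
    using eq GSp_lcoset_eq_iff[OF H_subgroup gm_GSp[OF w] gm_GSp[OF y]] by blast
  have yC: "y \<in> Car" using y by (rule Vs_carrier)
  have hC: "h \<in> carrier_mat (2 * n) (2 * n)" using h(1) by (rule H_carrier)
  have "y = col (gm r y) 0" using n1 yC by (simp add: gm_col dexp_def base_def)
  also have "\<dots> = gm r w *\<^sub>v col h 0" unfolding h(2)
    using n1 hC carrier_matD[OF gm_carrier[of r w]] by (intro eq_vecI) auto
  finally have "y = gm r w *\<^sub>v col h 0" .
  moreover have "col_typ 0 (col h 0)" using h(1) n1 by (simp add: H_iff)
  ultimately show ?thesis by blast
qed

lemma DL_I:
  assumes g: "g \<in> carrier (GSp n)" and A: "A \<in> H" and rel: "b * map_mat \<sigma> g = g * (W r * A)"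
  shows "g <#\<^bsub>GSp n\<^esub> H \<in> DL n \<sigma> b H (W r)"
proof -
  obtain l where l: "is_simil n l g" using g by (auto simp: GSp_iff)
  have gC: "g \<in> carrier_mat (2 * n) (2 * n)" and AC: "A \<in> carrier_mat (2 * n) (2 * n)"
    using is_simil_carrier[OF l] H_carrier[OF A] by auto
  have gs: "map_mat \<sigma> g \<in> carrier_mat (2 * n) (2 * n)" using gC by simp
  have WA: "W r * A \<in> carrier_mat (2 * n) (2 * n)" using mult_carrier_mat[OF W_carrier AC] .
  have "inv\<^bsub>GSp n\<^esub> g * b * map_mat \<sigma> g = sinv n l g * (b * map_mat \<sigma> g)"
    unfolding GSp_inv[OF l] by (rule assoc_mult_mat[OF sinv_carrier b_carrier gs])
  also have "\<dots> = (sinv n l g * g) * (W r * A)"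
    unfolding rel by (rule assoc_mult_mat[OF sinv_carrier gC WA, symmetric])
  also have "\<dots> = W r * A" unfolding sinv_left[OF l] using WA by (rule left_mult_one_mat)
  finally have eq: "inv\<^bsub>GSp n\<^esub> g * b * map_mat \<sigma> g = W r * A" .
  have "1\<^sub>m (2 * n) \<otimes>\<^bsub>GSp n\<^esub> W r \<in> H <#>\<^bsub>GSp n\<^esub> {W r}"
    unfolding set_mult_def using one_H by blast
  then have "W r \<in> H <#>\<^bsub>GSp n\<^esub> {W r}" by (simp add: left_mult_one_mat[OF W_carrier])
  then have "W r \<otimes>\<^bsub>GSp n\<^esub> A \<in> H <#>\<^bsub>GSp n\<^esub> {W r} <#>\<^bsub>GSp n\<^esub> H"
    unfolding set_mult_def using A by blast
  then have "W r * A \<in> H <#>\<^bsub>GSp n\<^esub> {W r} <#>\<^bsub>GSp n\<^esub> H" by simp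
  then show ?thesis unfolding DL_def using g eq by auto
qed

text \<open>If g^-1 b \<sigma>(g) = h1 w_r h2, replacing g by g h1 keeps the coset and moves the
  left factor to the right as \<sigma>(h1), which is again in \<open>H\<close> because \<sigma>
  preserves the three sets of entries.\<close>

lemma DL_E:
  assumes "C \<in> DL n \<sigma> b H (W r)"
  obtains g A where "g \<in> carrier (GSp n)" "A \<in> H" "b * map_mat \<sigma> g = g * (W r * A)" "C = g <#\<^bsub>GSp n\<^esub> H"
proof -
  obtain g where g: "g \<in> carrier (GSp n)" "C = g <#\<^bsub>GSp n\<^esub> H"
    and m: "inv\<^bsub>GSp n\<^esub> g * b * map_mat \<sigma> g \<in> H <#>\<^bsub>GSp n\<^esub> {W r} <#>\<^bsub>GSp n\<^esub> H"
    using assms by (auto simp: DL_def)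
  obtain h1 h2 where h: "h1 \<in> H" "h2 \<in> H" "inv\<^bsub>GSp n\<^esub> g * b * map_mat \<sigma> g = h1 * W r * h2"
    using m by (auto simp: set_mult_def)
  obtain l where l: "is_simil n l g" using g by (auto simp: GSp_iff)
  have C: "g \<in> carrier_mat (2 * n) (2 * n)" "h1 \<in> carrier_mat (2 * n) (2 * n)" "h2 \<in> carrier_mat (2 * n) (2 * n)"
    using is_simil_carrier[OF l] H_carrier h by auto
  have C': "map_mat \<sigma> g \<in> carrier_mat (2 * n) (2 * n)" "map_mat \<sigma> h1 \<in> carrier_mat (2 * n) (2 * n)" using C by auto
  have s1: "map_mat \<sigma> h1 \<in> H"
  proof -
    obtain c where "is_simil n c h1" using h(1) by (auto simp: H_iff GSp_iff)
    then have "map_mat \<sigma> h1 \<in> carrier (GSp n)" using is_simil_map_\<sigma> by (auto simp: GSp_iff)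
    then show ?thesis using h(1) C(2) by (auto simp: H_def \<sigma>_D \<sigma>_up \<sigma>_low)
  qed
  have bg: "b * map_mat \<sigma> g \<in> carrier_mat (2 * n) (2 * n)" using b_carrier C'(1) by (rule mult_carrier_mat)
  have hWh: "h1 * W r \<in> carrier_mat (2 * n) (2 * n)" using mult_carrier_mat[OF C(2) W_carrier] .
  have "b * map_mat \<sigma> g = (g * sinv n l g) * (b * map_mat \<sigma> g)"
    using left_mult_one_mat[OF bg] by (simp only: sinv_right[OF l])
  also have "\<dots> = g * (sinv n l g * (b * map_mat \<sigma> g))"
    by (rule assoc_mult_mat[OF C(1) sinv_carrier bg])
  also have "sinv n l g * (b * map_mat \<sigma> g) = h1 * W r * h2"
    unfolding h(3)[symmetric] GSp_inv[OF l] by (rule assoc_mult_mat[OF sinv_carrier b_carrier C'(1), symmetric])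
  finally have e: "b * map_mat \<sigma> g = g * (h1 * W r * h2)" .
  let ?g = "g * h1" and ?A = "h2 * map_mat \<sigma> h1"
  have "b * map_mat \<sigma> ?g = (b * map_mat \<sigma> g) * map_mat \<sigma> h1"
    unfolding \<sigma>.mat_hom_mult[OF C(1,2)] by (rule assoc_mult_mat[OF b_carrier C', symmetric])
  also have "\<dots> = g * ((h1 * W r * h2) * map_mat \<sigma> h1)"
    unfolding e by (rule assoc_mult_mat[OF C(1) mult_carrier_mat[OF hWh C(3)] C'(2)])
  also have "(h1 * W r * h2) * map_mat \<sigma> h1 = (h1 * W r) * ?A"
    by (rule assoc_mult_mat[OF hWh C(3) C'(2)])
  also have "\<dots> = h1 * (W r * ?A)"
    by (rule assoc_mult_mat[OF C(2) W_carrier mult_carrier_mat[OF C(3) C'(2)]])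
  also have "g * (h1 * (W r * ?A)) = ?g * (W r * ?A)"
    by (rule assoc_mult_mat[OF C(1,2) mult_carrier_mat[OF W_carrier mult_carrier_mat[OF C(3) C'(2)]], symmetric])
  finally have rel: "b * map_mat \<sigma> ?g = ?g * (W r * ?A)" .
  have h1G: "h1 \<in> carrier (GSp n)" using h(1) by (simp add: H_iff)
  have gG: "?g \<in> carrier (GSp n)"
  proof -
    interpret group "GSp n :: 'a mat monoid" by (rule group_GSp)
    show ?thesis using m_closed[OF g(1) h1G] by simp
  qed
  have "C = ?g <#\<^bsub>GSp n\<^esub> H" unfolding g(2) using GSp_lcoset_eq_iff[OF H_subgroup g(1) gG] h(1) by blast
  then show ?thesis using that[OF gG H_mult[OF h(2) s1] rel] by blast
qed

lemma gm_DL: "w \<in> Vs \<Longrightarrow> \<sigma> (\<alpha> w) / \<alpha> w \<in> D \<Longrightarrow> gm r w <#\<^bsub>GSp n\<^esub> H \<in> DL n \<sigma> b H (W r)"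
  using A_in_H[of w] DL_I[OF gm_GSp] by blast

lemma gm_represents:
  assumes g: "g \<in> carrier (GSp n)" and A: "A \<in> H" and rel: "b * map_mat \<sigma> g = g * (W r * A)"
    and x: "col_typ 0 x" "g *\<^sub>v x \<in> Vs"
  shows "gm r (g *\<^sub>v x) <#\<^bsub>GSp n\<^esub> H = g <#\<^bsub>GSp n\<^esub> H" "\<sigma> (\<alpha> (g *\<^sub>v x)) / \<alpha> (g *\<^sub>v x) \<in> D"
proof -
  obtain l where l: "is_simil n l g" using g by (auto simp: GSp_iff)
  have t: "gT g 0 (g *\<^sub>v x)" unfolding gT_def[OF l A rel] using x by blast
  have "\<exists>h\<in>H. gm r (g *\<^sub>v x) = g * h" by (rule gm_factor[OF l A rel x(2) t])
  then show "gm r (g *\<^sub>v x) <#\<^bsub>GSp n\<^esub> H = g <#\<^bsub>GSp n\<^esub> H"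
    using GSp_lcoset_eq_iff[OF H_subgroup g gm_GSp[OF x(2), of r]] by simp
  show "\<sigma> (\<alpha> (g *\<^sub>v x)) / \<alpha> (g *\<^sub>v x) \<in> D" by (rule \<alpha>_ratio[OF l A rel t])
qed

text \<open>The vector need not be known to lie in \<open>Vsymp\<close>. This is how the limit of a
  sequence of vectors is later seen to have nonzero \<alpha>.\<close>

lemma gm_typ_\<alpha>:
  assumes w: "w \<in> Vs" "\<sigma> (\<alpha> w) / \<alpha> w \<in> D" and x: "col_typ 0 x"
  shows "\<alpha> (gm r w *\<^sub>v x) \<noteq> 0" "\<sigma> (\<alpha> (gm r w *\<^sub>v x)) / \<alpha> (gm r w *\<^sub>v x) \<in> D"
proof -
  obtain A where A: "A \<in> H" "b * map_mat \<sigma> (gm r w) = gm r w * (W r * A)" using A_in_H[OF w] by blast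
  note l = gm_simil[OF w(1)]
  have t: "gT (gm r w) 0 (gm r w *\<^sub>v x)" unfolding gT_def[OF l A] using x by blast
  show "\<alpha> (gm r w *\<^sub>v x) \<noteq> 0" "\<sigma> (\<alpha> (gm r w *\<^sub>v x)) / \<alpha> (gm r w *\<^sub>v x) \<in> D"
    using gT_\<alpha>_nonzero[OF l A t] \<alpha>_ratio[OF l A t] by auto
qed

end

section \<open>A fixed point theorem\<close>

context disc_val
begin

text \<open>
  The weight \<open>(N + l) div n\<close> lets component \<open>l\<close> lag behind component \<open>l + 1\<close>, so that a map whose
  linear part is upper triangular with unit diagonal still counts as a contraction.
\<close>

lemma fixpoint_levels:
  fixes T :: "(nat \<Rightarrow> 'a) \<Rightarrow> nat \<Rightarrow> 'a" and n m :: nat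
  defines "J \<equiv> {1..<n}" and "L \<equiv> \<lambda>N l. int ((N + l) div n)"
  assumes complete: "val_complete v"
    and stable: "\<And>z. (\<forall>l\<in>J. z l \<in> P (int m)) \<Longrightarrow> \<forall>l\<in>J. T z l \<in> P (int m)"
    and contr: "\<And>z z' N. \<forall>l\<in>J. z l \<in> P (int m) \<Longrightarrow> \<forall>l\<in>J. z' l \<in> P (int m) \<Longrightarrow>
       \<forall>l\<in>J. z l - z' l \<in> P (L N l) \<Longrightarrow> \<forall>l\<in>J. T z l - T z' l \<in> P (L (Suc N) l)"
  shows "\<exists>z. (\<forall>l\<in>J. z l \<in> P (int m)) \<and> (\<forall>l\<in>J. T z l = z l)"
proof -
  define zs where "zs t = (T ^^ t) (\<lambda>_. 0)" for t
  have zs_Suc: "zs (Suc t) = T (zs t)" for t by (simp add: zs_def)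
  have S: "\<forall>l\<in>J. zs t l \<in> P (int m)" for t
    by (induction t) (auto simp: zs_Suc stable simp del: atLeastLessThan_iff, simp add: zs_def)
  have step: "\<forall>l\<in>J. zs (Suc t) l - zs t l \<in> P (L t l)" for t
  proof (induction t)
    \<comment> \<open>At the start the required level is l div n = 0, so stability under T
      suffices.\<close>
    case 0
    have "zs (Suc 0) l - zs 0 l \<in> P (L 0 l)" if "l \<in> J" for l
      using S[of "Suc 0"] that P_mono[of "zs (Suc 0) l" "int m" 0] by (auto simp: zs_def L_def J_def)
    then show ?case by blast
  next
    case (Suc t)
    show ?case using contr[OF S S Suc] by (simp only: zs_Suc)
  qed
  have L_mono: "t \<le> t' \<Longrightarrow> L t l \<le> L t' l" for t t' l by (simp add: L_def div_le_mono)
  have diff: "zs (t + d) l - zs t l \<in> P (L t l)" if l: "l \<in> J" for t d l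
  proof (induction d)
    case (Suc d)
    have "zs (t + Suc d) l - zs t l = (zs (Suc (t + d)) l - zs (t + d) l) + (zs (t + d) l - zs t l)" by simp
    also have "\<dots> \<in> P (L t l)"
      using Suc P_mono[OF bspec[OF step l] L_mono[of t "t + d"]] by (intro P_add) auto
    finally show ?case .
  qed simp
  have L_ge: "int N \<le> L t l" if "t \<ge> N * n" "l \<in> J" for N t l
  proof -
    have "N * n div n \<le> (t + l) div n" using that(1) by (intro div_le_mono) simp
    then show ?thesis using that(2) by (auto simp: L_def J_def)
  qed
  have "\<exists>x. \<forall>N. \<exists>M. \<forall>i\<ge>M. zs i l - x \<in> P N" if l: "l \<in> J" for l
  proof (rule complete[unfolded val_complete_def, rule_format])
    fix N :: int
    have "zs i l - zs j l \<in> P N" if ij: "i \<ge> nat N * n" "j \<ge> nat N * n" for i j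
    proof -
      let ?t = "nat N * n"
      have a: "zs i l - zs ?t l \<in> P (L ?t l)" if "i \<ge> ?t" for i using diff[OF l, of ?t "i - ?t"] that by simp
      have "N \<le> L ?t l" using L_ge[OF order.refl l, of "nat N"] by linarith
      moreover have "zs i l - zs j l = (zs i l - zs ?t l) - (zs j l - zs ?t l)" by simp
      ultimately show ?thesis using P_mono P_diff[OF a[OF ij(1)] a[OF ij(2)]] by metis
    qed
    then show "\<exists>M. \<forall>i\<ge>M. \<forall>j\<ge>M. zs i l - zs j l \<in> P N" by blast
  qed
  then obtain z where z: "\<And>l N. l \<in> J \<Longrightarrow> \<exists>M. \<forall>i\<ge>M. zs i l - z l \<in> P N" by metis
  have near: "z l - zs t l \<in> P (L t l)" if l: "l \<in> J" for l t
  proof -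
    obtain M where M: "\<And>i. i \<ge> M \<Longrightarrow> zs i l - z l \<in> P (L t l)" using z[OF l] by blast
    have "z l - zs t l = (zs (t + M) l - zs t l) - (zs (t + M) l - z l)" by simp
    then show ?thesis using P_diff[OF diff[OF l, of t M] M[of "t + M"]] by simp
  qed
  have zS: "\<forall>l\<in>J. z l \<in> P (int m)"
  proof
    fix l assume l: "l \<in> J"
    have "z l = zs (m * n) l + (z l - zs (m * n) l)" by simp
    then show "z l \<in> P (int m)"
      using P_add[OF bspec[OF S l] P_mono[OF near[OF l] L_ge[OF order.refl l]]] by metis
  qed
  have "T z l = z l" if l: "l \<in> J" for l
  proof -
    have "T z l - z l \<in> P (int N)" for N
    proof -
      let ?t = "N * n"
      have a: "T z l - T (zs ?t) l \<in> P (L (Suc ?t) l)" using contr[OF zS S, of ?t ?t] near l by blast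
      have "T z l - z l = (T z l - T (zs ?t) l) - (z l - zs (Suc ?t) l)" by (simp add: zs_Suc)
      also have "\<dots> \<in> P (L (Suc ?t) l)" by (rule P_diff[OF a near[OF l]])
      finally show ?thesis using P_mono[OF _ L_ge[OF _ l, of N "Suc ?t"]] by simp
    qed
    then show ?thesis using P_all_zero[of "T z l - z l"] by simp
  qed
  then show ?thesis using zS by blast
qed

end

section \<open>The groups I^m, their dotted variants and U as instances\<close>

context val_frob
begin

abbreviation OneP :: "int \<Rightarrow> 'a set" where "OneP N \<equiv> {x. x - 1 \<in> P N}"

lemma frob_typeI:
  assumes "coltype n D (P (int m + 1)) (P (int m))" and r: "r + k \<ge> m + 1"
    and D: "\<And>x. \<sigma> x \<in> D \<longleftrightarrow> x \<in> D"
  shows "val_frob_type n k \<sigma> \<pi> b v D (P (int m + 1)) (P (int m)) r"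
proof -
  interpret C: coltype n D "P (int m + 1)" "P (int m)" by fact
  \<comment> \<open>From r + k >= 1 also 2r + k >= 1, and a single power of \<pi> carries p^m into
    p^(m+1).\<close>
  have "\<pi> ^ (2 * r + k) \<in> P 1" using P_mono[OF \<pi>_power_P[of "2 * r + k"]] r by simp
  then have c: "\<pi> ^ (2 * r + k) * x \<in> P (N + 1)" if "x \<in> P N" for x N
    using P_mult_le[OF _ that, of "\<pi> ^ (2 * r + k)" 1 "N + 1"] by simp
  show ?thesis
  proof unfold_locales
    fix x assume "x \<in> P (int m)"
    then show "\<pi> ^ (2 * r + k) * x \<in> P (int m + 1) \<inter> P (int m)"
      using c[of x "int m"] P_mono[of _ "int m + 1" "int m"] by auto
  next
    fix x assume "x \<in> P (int m + 1)"
    then show "\<pi> ^ (2 * r + k) * x \<in> P (int m + 1)"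
      using c[of x "int m + 1"] P_mono[of _ "int m + 1 + 1" "int m + 1"] by auto
  next
    show "P (int (r + k)) \<subseteq> P (int m + 1)" using r by (auto intro: P_mono)
  qed (use D \<sigma>_P in auto)
qed

lemma coltype_P:
  assumes "1 \<in> D" "0 \<notin> D" "\<And>x y. x \<in> D \<Longrightarrow> y \<in> D \<Longrightarrow> x * y \<in> D" "\<And>x. x \<in> D \<Longrightarrow> inverse x \<in> D"
    "D \<subseteq> P 0" "\<And>x y. x \<in> D \<Longrightarrow> y \<in> P (int m + 1) \<Longrightarrow> x + y \<in> D"
  shows "coltype n D (P (int m + 1)) (P (int m))"
proof
  show "x * y \<in> P (int m + 1)" if "x \<in> D" "y \<in> P (int m + 1)" for x y
    using that assms(5) by (intro P_mult_le[of x 0 y "int m + 1"]) auto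
  show "x * y \<in> P (int m)" if "x \<in> D" "y \<in> P (int m)" for x y
    using that assms(5) by (intro P_mult_le[of x 0 y "int m"]) auto
  show "x * y \<in> P (int m + 1) \<inter> P (int m)" if "x \<in> P (int m + 1)" "y \<in> P (int m)" for x y
    using P_mult_le[OF that, of "int m + 1"] P_mult_le[OF that, of "int m"] by simp
  show "x + y * z \<in> D" if "x \<in> D" "y \<in> P (int m + 1)" "z \<in> P (int m)" for x y z
    using that assms(6) P_mult_le[OF that(2,3), of "int m + 1"] by simp
  show "x * y \<in> P (int m + 1)" if "x \<in> P (int m + 1)" "y \<in> P (int m + 1)" for x y
    using P_mult_le[OF that] by simp
  show "x * y \<in> P (int m)" if "x \<in> P (int m)" "y \<in> P (int m)" for x y
    using P_mult_le[OF that] by simp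
qed (use assms n1 in \<open>auto intro: P_add\<close>)

lemma type_Iw:
  assumes "r + k \<ge> m + 1"
  shows "val_frob_type n k \<sigma> \<pi> b v (val_units v) (P (int m + 1)) (P (int m)) r"
proof (rule frob_typeI[OF coltype_P assms])
  show "\<sigma> x \<in> val_units v \<longleftrightarrow> x \<in> val_units v" for x
    using v\<sigma>[of x] by (auto simp: val_units_def \<sigma>_eq_0)
  show "x + y \<in> val_units v" if "x \<in> val_units v" "y \<in> P (int m + 1)" for x y
    using that P_mono[of y "int m + 1" 1] by (intro units_add) auto
  show "1 \<in> val_units v" "0 \<notin> val_units v" by (simp_all add: val_units_def)
  show "val_units v \<subseteq> P 0" using units_P[of _ 0] by blast
qed (fact units_mult units_inverse)+

lemma type_dot:
  assumes "r + k \<ge> m + 1"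
  shows "val_frob_type n k \<sigma> \<pi> b v (OneP (int m + 1)) (P (int m + 1)) (P (int m)) r"
proof (rule frob_typeI[OF coltype_P assms])
  show "\<sigma> x \<in> OneP (int m + 1) \<longleftrightarrow> x \<in> OneP (int m + 1)" for x
    using \<sigma>_P[of "x - 1" "int m + 1"] by (simp add: \<sigma>_diff \<sigma>_1)
  show "x + y \<in> OneP (int m + 1)" if "x \<in> OneP (int m + 1)" "y \<in> P (int m + 1)" for x y
    using P_add[of "x - 1" "int m + 1" y] that by (simp add: algebra_simps)
  show "0 \<notin> OneP (int m + 1)" using P_minus_iff[of 1] by (simp add: P_one)
  show "OneP (int m + 1) \<subseteq> P 0"
  proof
    fix x assume "x \<in> OneP (int m + 1)"
    then have "x \<in> val_units v" using one_units_P[of x "int m + 1"] by simp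
    then show "x \<in> P 0" by (rule units_P) simp
  qed
  show "x * y \<in> OneP (int m + 1)" if "x \<in> OneP (int m + 1)" "y \<in> OneP (int m + 1)" for x y
    using one_units_mult[of x "int m + 1" y] that by simp
  show "inverse x \<in> OneP (int m + 1)" if "x \<in> OneP (int m + 1)" for x
    using one_units_inverse[of x "int m + 1"] that by simp
qed simp

text \<open>With D = {1} and \<open>low\<close> = {0} the column types are those of unipotent upper
  triangular matrices. As \<open>up\<close> is the whole field, the bound on the entries of A holds
  already for r = 0, the level that defines w.\<close>

lemma type_U: "val_frob_type n k \<sigma> \<pi> b v {1} UNIV {0} 0"
proof -
  have \<sigma>1: "\<sigma> x = 1 \<longleftrightarrow> x = 1" for x using \<sigma>_inj[of x 1] by (simp add: \<sigma>_1)
  show ?thesis by unfold_locales (use n1 in \<open>auto simp: \<sigma>1 \<sigma>_eq_0\<close>)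
qed

lemma H_Iw:
  assumes "r + k \<ge> m + 1"
  shows "coltype.H n (val_units v) (P (int m + 1)) (P (int m)) = Iw n v m"
proof -
  interpret T: val_frob_type n k \<sigma> \<pi> b v "val_units v" "P (int m + 1)" "P (int m)" r
    by (rule type_Iw[OF assms])
  show ?thesis by (simp add: T.H_def Iw_def)
qed

lemma H_dot:
  assumes "r + k \<ge> m + 1"
  shows "coltype.H n (OneP (int m + 1)) (P (int m + 1)) (P (int m)) = Iw_dot n v m"
proof -
  interpret T: val_frob_type n k \<sigma> \<pi> b v "OneP (int m + 1)" "P (int m + 1)" "P (int m)" r
    by (rule type_dot[OF assms])
  show ?thesis by (simp add: T.H_def Iw_dot_def)
qed

lemma H_U: "coltype.H n {1} UNIV {0 :: 'a} = Unip n"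
  by (subst coltype.H_def[OF frob_type.axioms(2)[OF val_frob_type.axioms(2)[OF type_U]]]) (auto simp: Unip_def)

section \<open>Successive approximation of the orthogonality relations\<close>

definition trial :: "(nat \<Rightarrow> 'a) \<Rightarrow> 'a vec" where
  "trial z = vec (2 * n) (\<lambda>i. if i = 0 then 1 else if n \<le> i \<and> i < 2 * n - 1 then z (2 * n - 1 - i) else 0)"

lemma trial_carrier [simp]: "trial z \<in> Car"
  by (simp add: trial_def)

text \<open>The n - 1 unknowns are placed opposite the coordinates 1, ..., n - 1, one for each
  relation. When y has column type i, its entry i is a unit, so the i-th relation can be solved for
  \<open>z i\<close>; the last entry of y is the inhomogeneous term.\<close>

lemma sform_trial:
  assumes y: "y \<in> Car"
  shows "sform n (trial z) y = (\<Sum>l\<in>{1..<n}. (- 1) ^ l * (z l * y $ l)) - y $ (2 * n - 1)"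
proof -
  let ?f = "\<lambda>i. (- 1) ^ Suc i * trial z $ i * y $ (2 * n - 1 - i)"
  have "{..<2 * n} = insert 0 ({n..<2 * n - 1} \<union> ({1..<n} \<union> ({2 * n - 1} - {0})))" using n1 by auto
  moreover have "2 * n - 1 \<noteq> 0" using n1 by simp
  ultimately have "sform n (trial z) y = ?f 0 + (sum ?f {n..<2 * n - 1} + sum ?f ({1..<n} \<union> ({2 * n - 1} - {0})))"
    unfolding sform_sum[OF trial_carrier y] using n1
    by (simp only:) (subst sum.insert, simp, simp, subst sum.union_disjoint, auto)
  also have "?f 0 = - y $ (2 * n - 1)" using n1 by (simp add: trial_def)
  also have "sum ?f ({1..<n} \<union> ({2 * n - 1} - {0})) = 0"
    by (rule sum.neutral) (use n1 in \<open>auto simp: trial_def\<close>)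
  also have "sum ?f {n..<2 * n - 1} = (\<Sum>l\<in>{1..<n}. (- 1) ^ l * (z l * y $ l))"
  proof (rule sum.reindex_bij_witness[of _ "\<lambda>l. 2 * n - 1 - l" "\<lambda>i. 2 * n - 1 - i"])
    fix i assume i: "i \<in> {n..<2 * n - 1}"
    then have "trial z $ i = z (2 * n - 1 - i)" by (auto simp: trial_def)
    moreover have "(- 1 :: 'a) ^ (2 * n - 1 - i) = (- 1) ^ Suc i" using i by (auto simp: minus_one_power_iff)
    ultimately show "(- 1) ^ (2 * n - 1 - i) * (z (2 * n - 1 - i) * y $ (2 * n - 1 - i)) = ?f i" by simp
  qed auto
  finally show ?thesis by simp
qed

lemma quotient_diff_P:
  assumes "a - a' \<in> P N" "a' \<in> P 0" "y - y' \<in> P N" "y \<in> val_units v" "y' \<in> val_units v"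
  shows "a / y - a' / y' \<in> P N"
proof -
  have nz: "y \<noteq> 0" "y' \<noteq> 0" using assms by (auto simp: val_units_def)
  have "a / y - a' / y' = inverse y * (a - a') - (inverse y * inverse y') * (a' * (y - y'))"
    using nz by (simp add: field_simps)
  moreover have "inverse y * (a - a') \<in> P N"
    using P_mult_le[OF units_P[OF units_inverse[OF assms(4)] order.refl] assms(1)] by simp
  moreover have "a' * (y - y') \<in> P N" using P_mult_le[OF assms(2,3)] by simp
  then have "(inverse y * inverse y') * (a' * (y - y')) \<in> P N"
    using P_mult_le[OF units_P[OF units_mult[OF units_inverse[OF assms(4)] units_inverse[OF assms(5)]] order.refl]] by simp
  ultimately show ?thesis using P_diff by metis
qed

text \<open>
  With \<open>\<Phi> = \<pi>\<^sup>r w A \<sigma>\<close> one needs \<open>sform n x (\<Phi>\<^sup>i x) = 0\<close> for \<open>1 \<le> i < n\<close>. Given the vectors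
  \<open>\<Phi>\<^sup>i x\<close>, these equations are triangular in the coordinates \<open>z\<close> of \<open>trial z\<close>; since \<open>A\<close> is lower
  triangular modulo \<open>\<pi>\<close>, changing \<open>z\<close> affects the relevant coordinates of \<open>\<Phi>\<^sup>i x\<close> only to
  higher order. Hence no Lang-type argument over the residue field is required.
\<close>

lemma orthogonalise:
  assumes rm: "r + k \<ge> m + 1" and g: "is_simil n c g" and A: "A \<in> Iw n v m"
    and rel: "b * map_mat \<sigma> g = g * (W r * A)"
  shows "\<exists>x. x \<in> Car \<and> x $ 0 = 1 \<and> (\<forall>i<2 * n. 0 < i \<longrightarrow> x $ i \<in> P (int m)) \<and> g *\<^sub>v x \<in> Vs"
proof -
  interpret I: val_frob_type n k \<sigma> \<pi> b v "val_units v" "P (int m + 1)" "P (int m)" r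
    by (rule type_Iw[OF rm])
  have AH: "A \<in> I.H" using A H_Iw[OF rm] by simp
  have AC: "A \<in> carrier_mat (2 * n) (2 * n)" using AH by (rule I.H_carrier)
  have gC: "g \<in> carrier_mat (2 * n) (2 * n)" using g by (rule is_simil_carrier)
  define \<Phi> where "\<Phi> x = \<pi> ^ r \<cdot>\<^sub>v (W r *\<^sub>v (A *\<^sub>v map_vec \<sigma> x))" for x
  have AmC: "A *\<^sub>v map_vec \<sigma> x \<in> Car" if "x \<in> Car" for x using AC that by simp
  have WC: "W r *\<^sub>v (A *\<^sub>v map_vec \<sigma> x) \<in> Car" if "x \<in> Car" for x
    using mult_mat_vec_carrier[OF W_carrier AmC[OF that]] .
  have \<Phi>C: "\<Phi> x \<in> Car" if "x \<in> Car" for x using WC[OF that] by (simp add: \<Phi>_def)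
  have \<Phi>iC: "(\<Phi> ^^ i) x \<in> Car" if "x \<in> Car" for x i by (induction i) (auto simp: that \<Phi>C)
  have F\<Phi>: "\<pi> ^ (i * r) \<cdot>\<^sub>v (F ^^ i) (g *\<^sub>v x) = g *\<^sub>v (\<Phi> ^^ i) x" if x: "x \<in> Car" for x i
  proof (induction i)
    case (Suc i)
    have gx: "(F ^^ i) (g *\<^sub>v x) \<in> Car" using gC x by simp
    have "\<pi> ^ (Suc i * r) \<cdot>\<^sub>v (F ^^ Suc i) (g *\<^sub>v x) = \<pi> ^ r \<cdot>\<^sub>v F (\<pi> ^ (i * r) \<cdot>\<^sub>v (F ^^ i) (g *\<^sub>v x))"
      using gx by (simp add: F_smult smult_smult_assoc power_add)
    also have "\<dots> = \<pi> ^ r \<cdot>\<^sub>v (g *\<^sub>v (W r *\<^sub>v (A *\<^sub>v map_vec \<sigma> ((\<Phi> ^^ i) x))))"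
      unfolding Suc I.F_g[OF g AH rel \<Phi>iC[OF x]] ..
    also have "\<dots> = g *\<^sub>v \<Phi> ((\<Phi> ^^ i) x)"
      unfolding \<Phi>_def[of "(\<Phi> ^^ i) x"] by (rule mult_mat_vec[OF gC WC[OF \<Phi>iC[OF x]], symmetric])
    finally show ?case by simp
  qed (use gC x in simp)
  have \<Phi>_typ: "i < n \<Longrightarrow> I.col_typ i ((\<Phi> ^^ i) x)" if x: "I.col_typ 0 x" for x i
  proof (induction i)
    case (Suc i)
    have "I.col_typ i (A *\<^sub>v map_vec \<sigma> ((\<Phi> ^^ i) x))"
      using I.H_typ[OF AH I.col_typ_\<sigma>] Suc by simp
    from I.sh_typ[OF this] Suc.prems have "I.col_typ (Suc i) (\<Phi> ((\<Phi> ^^ i) x))"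
      unfolding \<Phi>_def[of "(\<Phi> ^^ i) x"] by (auto split: if_splits)
    then show ?case by simp
  qed (use x in simp)
  \<comment> \<open>Trial vectors agree in their first n coordinates. The better precision recorded
    there survives multiplication by A, because the entries of A above the diagonal are divisible by
    \<pi>.\<close>
  define near where "near N x x' \<longleftrightarrow> (\<forall>i<2 * n. x $ i - x' $ i \<in> P N) \<and> (\<forall>i<n. x $ i - x' $ i \<in> P (N + 1))"
    for N and x x' :: "'a vec"
  have eA: "A $$ (i, l) \<in> P 0" "i < l \<Longrightarrow> A $$ (i, l) \<in> P 1" if "i < 2 * n" "l < 2 * n" for i l
  proof -
    have A': "i = l \<Longrightarrow> A $$ (i, l) \<in> val_units v" "i < l \<Longrightarrow> A $$ (i, l) \<in> P (int m + 1)" "l < i \<Longrightarrow> A $$ (i, l) \<in> P (int m)"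
      using A that by (auto simp: Iw_def)
    then show "A $$ (i, l) \<in> P 0" using units_P P_mono[of "A $$ (i, l)"] by (cases i l rule: linorder_cases) auto
    show "i < l \<Longrightarrow> A $$ (i, l) \<in> P 1" using A' P_mono[of "A $$ (i, l)" "int m + 1" 1] by auto
  qed
  have nearA: "near N (A *\<^sub>v map_vec \<sigma> x) (A *\<^sub>v map_vec \<sigma> x')" if nr: "near N x x'" and x: "x \<in> Car" "x' \<in> Car" for N x x'
  proof -
    have d: "(A *\<^sub>v map_vec \<sigma> x) $ i - (A *\<^sub>v map_vec \<sigma> x') $ i = (\<Sum>l<2 * n. A $$ (i, l) * \<sigma> (x $ l - x' $ l))"
      if i: "i < 2 * n" for i
    proof -
      have mx: "map_vec \<sigma> x \<in> Car" "map_vec \<sigma> x' \<in> Car" using x by auto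
      show ?thesis unfolding mult_mat_vec_sum[OF AC mx(1) i] mult_mat_vec_sum[OF AC mx(2) i] sum_subtractf[symmetric]
        using x by (intro sum.cong) (auto simp: \<sigma>_diff algebra_simps)
    qed
    have s: "\<sigma> (x $ l - x' $ l) \<in> P N" "l < n \<Longrightarrow> \<sigma> (x $ l - x' $ l) \<in> P (N + 1)" if "l < 2 * n" for l
      using nr that by (auto simp: near_def \<sigma>_P)
    show ?thesis unfolding near_def
    proof (intro conjI allI impI)
      fix i assume i: "i < 2 * n"
      show "(A *\<^sub>v map_vec \<sigma> x) $ i - (A *\<^sub>v map_vec \<sigma> x') $ i \<in> P N"
        unfolding d[OF i] using P_mult_le[OF eA(1) s(1), of i _ _ N] i by (intro P_sum) auto
    next
      fix i assume i: "i < n"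
      then have i2: "i < 2 * n" by simp
      show "(A *\<^sub>v map_vec \<sigma> x) $ i - (A *\<^sub>v map_vec \<sigma> x') $ i \<in> P (N + 1)"
        unfolding d[OF i2]
      proof (rule P_sum)
        fix l assume l: "l \<in> {..<2 * n}"
        show "A $$ (i, l) * \<sigma> (x $ l - x' $ l) \<in> P (N + 1)"
        proof (cases "l < n")
          case True
          then show ?thesis using P_mult_le[OF eA(1)[of i l] s(2)[of l], of "N + 1"] l i2 by simp
        next
          case False
          then show ?thesis using P_mult_le[OF eA(2)[of i l] s(1)[of l], of "N + 1"] l i i2 by simp
        qed
      qed
    qed
  qed
  have c1: "\<pi> ^ (2 * r + k) * y \<in> P (N + 1)" if "y \<in> P N" for y N
  proof -
    have "\<pi> ^ (2 * r + k) \<in> P 1" using P_mono[OF \<pi>_power_P[of "2 * r + k"], of 1] rm by simp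
    then show ?thesis using P_mult_le[OF _ that, of "\<pi> ^ (2 * r + k)" 1 "N + 1"] by simp
  qed
  \<comment> \<open>Every coordinate of the image is either one of the first n coordinates of A
    \<sigma>(x) or carries the factor \<pi>^(2r+k), so it gains an order. The last coordinate is
    recorded separately, being the inhomogeneous term of the relations.\<close>
  have near\<Phi>: "near N (\<Phi> x) (\<Phi> x') \<and> \<Phi> x $ (2 * n - 1) - \<Phi> x' $ (2 * n - 1) \<in> P (N + 1)"
    if nr: "near N x x'" and x: "x \<in> Car" "x' \<in> Car" for N x x'
  proof -
    let ?y = "A *\<^sub>v map_vec \<sigma> x" and ?y' = "A *\<^sub>v map_vec \<sigma> x'"
    have na: "?y $ i - ?y' $ i \<in> P N" if "i < 2 * n" for i using nearA[OF nr x] that by (simp add: near_def)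
    have na': "?y $ i - ?y' $ i \<in> P (N + 1)" if "i < n" for i using nearA[OF nr x] that by (simp add: near_def)
    note sh = I.sh_index[OF AmC[OF x(1)]] I.sh_index[OF AmC[OF x(2)]]
    have c2: "\<pi> ^ (2 * r + k) * ?y $ i - \<pi> ^ (2 * r + k) * ?y' $ i \<in> P (N + 1)" if "i < 2 * n" for i
      using c1[OF na[OF that]] by (simp add: right_diff_distrib)
    have e: "\<Phi> x $ i - \<Phi> x' $ i = (if i = 0 then (- 1) ^ (n + 1) * (\<pi> ^ (2 * r + k) * ?y $ n - \<pi> ^ (2 * r + k) * ?y' $ n)
        else if i < n then ?y $ (i - 1) - ?y' $ (i - 1)
        else if i < 2 * n - 1 then \<pi> ^ (2 * r + k) * ?y $ (i + 1) - \<pi> ^ (2 * r + k) * ?y' $ (i + 1)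
        else ?y $ (n - 1) - ?y' $ (n - 1))" if "i < 2 * n" for i
      unfolding \<Phi>_def sh(1)[OF that] sh(2)[OF that] by (simp add: right_diff_distrib)
    have "\<Phi> x $ i - \<Phi> x' $ i \<in> P (N + 1)" if "i < 2 * n" for i
      unfolding e[OF that] using that n1 c2[of n] na'[of "i - 1"] c2[of "i + 1"] na'[of "n - 1"]
      by (simp only: P_sign_mult split: if_split) auto
    then show ?thesis using P_mono[of _ "N + 1" N] n1 by (auto simp: near_def)
  qed
  have near\<Phi>i: "near N ((\<Phi> ^^ i) x) ((\<Phi> ^^ i) x')" if nr: "near N x x'" and x: "x \<in> Car" "x' \<in> Car" for N x x' i
    by (induction i) (auto simp: nr near\<Phi> \<Phi>iC x)
  let ?J = "{1..<n}"
  define Y where "Y z i = (\<Phi> ^^ i) (trial z)" for z i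
  have YC: "Y z i \<in> Car" for z i unfolding Y_def by (rule \<Phi>iC) simp
  have trial_m: "trial z $ 0 = 1" "0 < i \<Longrightarrow> i < 2 * n \<Longrightarrow> trial z $ i \<in> P (int m)"
    if z: "\<forall>l\<in>?J. z l \<in> P (int m)" for z i
  proof -
    show "trial z $ 0 = 1" using n1 by (simp add: trial_def)
    assume i: "0 < i" "i < 2 * n"
    have "z (2 * n - 1 - i) \<in> P (int m)" if "n \<le> i" "i < 2 * n - 1"
      by (rule bspec[OF z]) (use that in auto)
    then show "trial z $ i \<in> P (int m)" using i by (simp add: trial_def)
  qed
  have trial_typ: "I.col_typ 0 (trial z)" if z: "\<forall>l\<in>?J. z l \<in> P (int m)" for z
    unfolding I.col_typ_def using trial_m[OF z] trial_carrier[of z] by (simp add: val_units_def)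
  have Y_typ: "I.col_typ i (Y z i)" if "\<forall>l\<in>?J. z l \<in> P (int m)" "i < n" for z i
    unfolding Y_def by (rule \<Phi>_typ[OF trial_typ that(2)]) (use that in auto)
  have Yu: "Y z i $ i \<in> val_units v" "j < i \<Longrightarrow> Y z i $ j \<in> P (int m + 1)"
      "i < j \<Longrightarrow> j < 2 * n \<Longrightarrow> Y z i $ j \<in> P (int m)" "j < 2 * n \<Longrightarrow> Y z i $ j \<in> P 0"
    if z: "\<forall>l\<in>?J. z l \<in> P (int m)" and i: "i < n" for z i j
  proof -
    note t = I.col_typD[OF Y_typ[OF z i]]
    show a: "Y z i $ i \<in> val_units v" "j < i \<Longrightarrow> Y z i $ j \<in> P (int m + 1)"
      "i < j \<Longrightarrow> j < 2 * n \<Longrightarrow> Y z i $ j \<in> P (int m)" using t i by auto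
    then show "j < 2 * n \<Longrightarrow> Y z i $ j \<in> P 0"
      using units_P[of "Y z i $ j" 0] P_mono[of "Y z i $ j" _ 0] by (cases i j rule: linorder_cases) auto
  qed
  \<comment> \<open>\<open>T z i\<close> solves the i-th relation for its own unknown, with the
    other unknowns and the vectors \<open>Y\<close> frozen at \<open>z\<close>; the division is by a
    unit.\<close>
  define num where "num z i = Y z i $ (2 * n - 1) - (\<Sum>l\<in>?J - {i}. (- 1) ^ l * (z l * Y z i $ l))" for z i
  define T where "T z i = (- 1) ^ i * (num z i / Y z i $ i)" for z i
  have num_m: "num z i \<in> P (int m)" if z: "\<forall>l\<in>?J. z l \<in> P (int m)" and i: "i \<in> ?J" for z i
  proof -
    have "z l * Y z i $ l \<in> P (int m)" if "l \<in> ?J" for l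
      using P_mult_le[OF bspec[OF z that] Yu(4)[OF z, of i l]] i that by simp
    then show ?thesis unfolding num_def using Yu(3)[OF z, of i "2 * n - 1"] i
      by (intro P_diff P_sum) auto
  qed
  have "\<exists>z. (\<forall>l\<in>?J. z l \<in> P (int m)) \<and> (\<forall>l\<in>?J. T z l = z l)"
  proof (rule fixpoint_levels[OF complete])
    fix z assume z: "\<forall>l\<in>?J. z l \<in> P (int m)"
    show "\<forall>l\<in>?J. T z l \<in> P (int m)"
    proof
      fix i assume i: "i \<in> ?J"
      then have "inverse (Y z i $ i) \<in> P 0" using units_P[OF units_inverse[OF Yu(1)[OF z]]] by auto
      then have "num z i * inverse (Y z i $ i) \<in> P (int m)"
        using P_mult_le[OF num_m[OF z i]] by simp
      then show "T z i \<in> P (int m)" by (simp add: T_def divide_inverse)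
    qed
  next
    fix z z' :: "nat \<Rightarrow> 'a" and N
    assume z: "\<forall>l\<in>?J. z l \<in> P (int m)" and z': "\<forall>l\<in>?J. z' l \<in> P (int m)"
      and d: "\<forall>l\<in>?J. z l - z' l \<in> P (int ((N + l) div n))"
    show "\<forall>l\<in>?J. T z l - T z' l \<in> P (int ((Suc N + l) div n))"
    proof
      fix i assume i: "i \<in> ?J"
      \<comment> \<open>M is the lowest level among the components at stage N, attained at component
        1. The level demanded at the next stage is at most M + 1, so a gain of one order is
        enough.\<close>
      let ?M = "int ((N + 1) div n)" and ?L = "int ((Suc N + i) div n)"
      have "(Suc N + i) div n \<le> (N + 1 + n) div n" using i by (intro div_le_mono) simp
      also have "\<dots> = (N + 1) div n + 1" using div_add_self2[of n "N + 1"] n1 by simp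
      finally have LM: "?L \<le> ?M + 1" by simp
      have "near ?M (trial z) (trial z')"
      proof -
        have zd: "z l - z' l \<in> P ?M" if "l \<in> ?J" for l
        proof -
          have "(N + 1) div n \<le> (N + l) div n" using that by (intro div_le_mono) simp
          then show ?thesis using P_mono[OF bspec[OF d that], of ?M] by simp
        qed
        have "trial z $ i - trial z' $ i \<in> P ?M" if i: "i < 2 * n" for i
        proof (cases "n \<le> i \<and> i < 2 * n - 1")
          case True
          then have "2 * n - 1 - i \<in> ?J" by auto
          then show ?thesis using zd True i n1 by (simp add: trial_def)
        qed (use i in \<open>auto simp: trial_def\<close>)
        moreover have "trial z $ i - trial z' $ i = 0" if "i < n" for i
          using that by (simp add: trial_def)
        ultimately show ?thesis by (simp add: near_def)
      qed
      then have nY: "near ?M (Y z j) (Y z' j)" for j unfolding Y_def by (rule near\<Phi>i) auto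
      obtain i' where i': "i = Suc i'" using i by (cases i) auto
      have last: "Y z i $ (2 * n - 1) - Y z' i $ (2 * n - 1) \<in> P ?L"
        using near\<Phi>[OF nY[of i'] YC YC] P_mono[OF _ LM] unfolding i' by (simp add: Y_def)
      have dY: "Y z i $ l - Y z' i $ l \<in> P ?L" if "l < n" for l
        using nY[of i] that P_mono[OF _ LM] by (simp add: near_def)
      have term_l: "z l * Y z i $ l - z' l * Y z' i $ l \<in> P ?L" if l: "l \<in> ?J - {i}" for l
      proof -
        have lJ: "l \<in> ?J" "l < n" "l < 2 * n" "i < n" using l i by auto
        \<comment> \<open>For l > i the unknown \<open>z l\<close> already has the level that
          \<open>z i\<close> is to reach. For l < i it may be one level short, but its coefficient
          lies above the diagonal and supplies the missing order.\<close>
        have a: "(z l - z' l) * Y z i $ l \<in> P ?L"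
        proof (cases "i < l")
          case True
          then have "(Suc N + i) div n \<le> (N + l) div n" by (intro div_le_mono) simp
          then show ?thesis using P_mult_le[OF bspec[OF d lJ(1)] Yu(4)[OF z lJ(4,3)]] by simp
        next
          case False
          then have li: "l < i" using l by auto
          have "(Suc N + i) div n \<le> (N + l + n) div n" using lJ by (intro div_le_mono) auto
          then have "?L \<le> int ((N + l) div n) + (int m + 1)" using n1 by simp
          then show ?thesis by (rule P_mult_le[OF bspec[OF d lJ(1)] Yu(2)[OF z lJ(4) li]])
        qed
        have b: "z' l * (Y z i $ l - Y z' i $ l) \<in> P ?L"
          using P_mult_le[OF bspec[OF z' lJ(1)] dY[OF lJ(2)], of ?L] by simp
        have "z l * Y z i $ l - z' l * Y z' i $ l = (z l - z' l) * Y z i $ l + z' l * (Y z i $ l - Y z' i $ l)"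
          by (simp add: algebra_simps)
        then show ?thesis using P_add[OF a b] by simp
      qed
      have dn: "num z i - num z' i \<in> P ?L"
      proof -
        have "num z i - num z' i = (Y z i $ (2 * n - 1) - Y z' i $ (2 * n - 1))
            - (\<Sum>l\<in>?J - {i}. (- 1) ^ l * (z l * Y z i $ l - z' l * Y z' i $ l))"
          by (simp add: num_def sum_subtractf right_diff_distrib)
        also have "\<dots> \<in> P ?L" by (intro P_diff last P_sum) (simp only: P_sign_mult term_l)
        finally show ?thesis .
      qed
      have ii: "i < n" using i by simp
      have "num z i / Y z i $ i - num z' i / Y z' i $ i \<in> P ?L"
        using num_m[OF z' i] P_mono[of _ "int m" 0]
        by (intro quotient_diff_P dn dY Yu(1)[OF z ii] Yu(1)[OF z' ii] ii) auto
      then show "T z i - T z' i \<in> P ?L"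
        unfolding T_def right_diff_distrib[symmetric] P_sign_mult .
    qed
  qed
  then obtain z where z: "\<forall>l\<in>?J. z l \<in> P (int m)" and fx: "\<forall>l\<in>?J. T z l = z l" by blast
  let ?x = "trial z"
  have orth: "sform n ?x ((\<Phi> ^^ i) ?x) = 0" if i: "i \<in> ?J" for i
  proof -
    have u: "Y z i $ i \<noteq> 0" using Yu(1)[OF z, of i] i by (simp add: val_units_def)
    have "(- 1) ^ i * (z i * Y z i $ i) = (- 1) ^ i * (T z i * Y z i $ i)" using fx i by simp
    also have "\<dots> = num z i" using u by (auto simp: T_def minus_one_power_iff)
    finally have e: "(- 1) ^ i * (z i * Y z i $ i) = num z i" .
    have "(\<Sum>l\<in>?J. (- 1) ^ l * (z l * Y z i $ l)) = num z i + (\<Sum>l\<in>?J - {i}. (- 1) ^ l * (z l * Y z i $ l))"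
      using i e by (simp add: sum.remove)
    then show ?thesis unfolding Y_def[symmetric] sform_trial[OF YC] by (simp add: num_def)
  qed
  have x_typ: "I.col_typ 0 ?x" by (rule trial_typ[OF z])
  have gx: "g *\<^sub>v ?x \<in> Car" using gC by simp
  have "sform n (g *\<^sub>v ?x) ((F ^^ i) (g *\<^sub>v ?x)) = 0" if i: "i \<in> ?J" for i
  proof -
    have "\<pi> ^ (i * r) * sform n (g *\<^sub>v ?x) ((F ^^ i) (g *\<^sub>v ?x)) = sform n (g *\<^sub>v ?x) (g *\<^sub>v (\<Phi> ^^ i) ?x)"
      using F\<Phi>[of ?x i] gx by (metis Fi_carrier sform_smult_right trial_carrier)
    also have "\<dots> = c * sform n ?x ((\<Phi> ^^ i) ?x)" by (rule sform_simil[OF g trial_carrier \<Phi>iC]) simp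
    finally show ?thesis using orth[OF i] \<pi>0 by simp
  qed
  moreover have "\<alpha> (g *\<^sub>v ?x) \<noteq> 0"
    by (rule I.gT_\<alpha>_nonzero[OF g AH rel]) (use x_typ in \<open>auto simp: I.gT_def[OF g AH rel]\<close>)
  ultimately have "g *\<^sub>v ?x \<in> Vs" using gx unfolding Vsymp_def alpha_def by blast
  moreover have "?x $ 0 = 1" "\<forall>i<2 * n. 0 < i \<longrightarrow> ?x $ i \<in> P (int m)"
    using trial_m[OF z] by auto
  ultimately show ?thesis using trial_carrier by blast
qed

end

section \<open>Independence of choices and the transition maps in r\<close>

context val_frob
begin

definition shift :: "nat \<Rightarrow> 'a vec \<Rightarrow> 'a vec" where
  "shift s x = vec (2 * n) (\<lambda>i. \<pi> ^ (dexp n i * s) * x $ i)"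

lemma shift_carrier [simp]: "shift s x \<in> Car"
  by (simp add: shift_def)

lemma gm_shift:
  assumes w: "w \<in> Car" and x: "x \<in> Car"
  shows "gm (r + s) w *\<^sub>v x = gm r w *\<^sub>v shift s x"
proof (rule eq_vecI)
  fix i assume "i < dim_vec (gm r w *\<^sub>v shift s x)"
  then have i: "i < 2 * n" using carrier_matD[OF gm_carrier[of r w]] by simp
  show "(gm (r + s) w *\<^sub>v x) $ i = (gm r w *\<^sub>v shift s x) $ i"
    unfolding mult_mat_vec_sum[OF gm_carrier x i] mult_mat_vec_sum[OF gm_carrier shift_carrier i]
    by (intro sum.cong refl) (simp add: gm_index[OF w i] shift_def distrib_left power_add)
qed (use carrier_matD[OF gm_carrier[of r w]] carrier_matD[OF gm_carrier[of "r + s" w]] in simp)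

lemma gm_e0: "w \<in> Car \<Longrightarrow> gm r w *\<^sub>v unit_vec (2 * n) 0 = w"
  using n1 by (simp add: mat_mult_unit_vec[OF gm_carrier] gm_col dexp_def base_def)

lemma dexp_0 [simp]: "dexp n 0 = 0"
  using n1 by (simp add: dexp_def)

lemma \<pi>_power_mult_P: "x \<in> P N \<Longrightarrow> \<pi> ^ i * x \<in> P N"
  using P_mult_le[OF \<pi>_power_P[of i], of x N N] by simp

text \<open>The first coordinate is left alone because \<open>dexp n 0\<close> = 0, and the
  remaining ones lie in the ideal \<open>P N\<close>, which is stable under powers of \<pi>; hence
  the type 0 of the coordinate vector survives the change of level.\<close>

lemma coset_step:
  assumes T1: "val_frob_type n k \<sigma> \<pi> b v D Up (P N) (Suc r)" and T0: "val_frob_type n k \<sigma> \<pi> b v D Up (P N) r"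
    and w: "w \<in> Vs" "\<sigma> (\<alpha> w) / \<alpha> w \<in> D" and y: "y \<in> Vs"
    and eq: "gm (Suc r) w <#\<^bsub>GSp n\<^esub> coltype.H n D Up (P N) = gm (Suc r) y <#\<^bsub>GSp n\<^esub> coltype.H n D Up (P N)"
  shows "gm r w <#\<^bsub>GSp n\<^esub> coltype.H n D Up (P N) = gm r y <#\<^bsub>GSp n\<^esub> coltype.H n D Up (P N)"
proof -
  interpret T0: val_frob_type n k \<sigma> \<pi> b v D Up "P N" r by (rule T0)
  obtain x where x: "T0.col_typ 0 x" "y = gm (Suc r) w *\<^sub>v x"
    using val_frob_type.gm_coset_eqD[OF T1 w(1) y eq] by blast
  have xC: "x \<in> Car" using x(1) by (rule T0.col_typD)
  have "y = gm r w *\<^sub>v shift 1 x"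
    using gm_shift[OF Vs_carrier[OF w(1)] xC, of r 1] x(2) by simp
  moreover have "T0.col_typ 0 (shift 1 x)"
    using T0.col_typD[OF x(1)] by (auto simp: T0.col_typ_def shift_def \<pi>_power_mult_P)
  ultimately show ?thesis by (intro T0.gm_coset_eqI[OF w y])
qed

lemma \<alpha>_ratio_units: "w \<in> Vs \<Longrightarrow> \<sigma> (\<alpha> w) / \<alpha> w \<in> val_units v"
  using \<alpha>_nonzero[of w] by (simp add: val_units_def v_divide v\<sigma> \<sigma>_eq_0)

abbreviation Vd :: "nat \<Rightarrow> 'a vec set" where "Vd \<equiv> Vsymp_dot n v \<sigma> b"

lemma Vd_iff: "w \<in> Vd m \<longleftrightarrow> w \<in> Vs \<and> \<sigma> (\<alpha> w) / \<alpha> w \<in> OneP (int m + 1)"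
  by (auto simp: Vsymp_dot_def)

lemma Vd_mono: "w \<in> Vd m' \<Longrightarrow> m \<le> m' \<Longrightarrow> w \<in> Vd m"
  using P_mono[of _ "int m' + 1" "int m + 1"] by (auto simp: Vd_iff)

lemma level_step:
  assumes "r + k \<ge> m + 1" "w \<in> Vs" "y \<in> Vs"
    and "gm (Suc r) w <#\<^bsub>GSp n\<^esub> Iw n v m = gm (Suc r) y <#\<^bsub>GSp n\<^esub> Iw n v m"
  shows "gm r w <#\<^bsub>GSp n\<^esub> Iw n v m = gm r y <#\<^bsub>GSp n\<^esub> Iw n v m"
  using coset_step[OF type_Iw type_Iw[OF assms(1)] assms(2) \<alpha>_ratio_units[OF assms(2)] assms(3)] assms
  by (simp add: H_Iw[OF assms(1)])

lemma level_step_dot: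
  assumes "r + k \<ge> m + 1" "w \<in> Vd m" "y \<in> Vd m"
    and "gm (Suc r) w <#\<^bsub>GSp n\<^esub> Iw_dot n v m = gm (Suc r) y <#\<^bsub>GSp n\<^esub> Iw_dot n v m"
  shows "gm r w <#\<^bsub>GSp n\<^esub> Iw_dot n v m = gm r y <#\<^bsub>GSp n\<^esub> Iw_dot n v m"
proof -
  have w: "w \<in> Vs" "\<sigma> (\<alpha> w) / \<alpha> w \<in> OneP (int m + 1)" and y: "y \<in> Vs" using assms by (auto simp: Vd_iff)
  have "Suc r + k \<ge> m + 1" using assms(1) by simp
  from coset_step[OF type_dot[OF this] type_dot[OF assms(1)] w y]
  show ?thesis using assms(4) unfolding H_dot[OF assms(1)] by blast
qed

lemma Iw_dot_Iw: "Iw_dot n v m \<subseteq> Iw n v m"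
  using one_units_P[of _ "int m + 1"] by (auto simp: Iw_def Iw_dot_def)

lemma Iw_represented:
  assumes rm: "r + k \<ge> m + 1" and C: "C \<in> Xset n v \<sigma> \<pi> k b m r"
  shows "\<exists>x\<in>Vs. gm r x <#\<^bsub>GSp n\<^esub> Iw n v m = C"
proof -
  interpret T: val_frob_type n k \<sigma> \<pi> b v "val_units v" "P (int m + 1)" "P (int m)" r by (rule type_Iw[OF rm])
  have H: "T.H = Iw n v m" by (rule H_Iw[OF rm])
  obtain g A where g: "g \<in> carrier (GSp n)" and A: "A \<in> T.H" and rel: "b * map_mat \<sigma> g = g * (W r * A)"
    and Cg: "C = g <#\<^bsub>GSp n\<^esub> T.H"
    using C T.DL_E[of C] unfolding Xset_def H by blast
  obtain c where c: "is_simil n c g" using g by (auto simp: GSp_iff)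
  obtain x where x: "x \<in> Car" "x $ 0 = 1" "\<forall>i<2 * n. 0 < i \<longrightarrow> x $ i \<in> P (int m)" "g *\<^sub>v x \<in> Vs"
    using orthogonalise[OF rm c _ rel] A H by blast
  have "1 \<in> val_units v" by (simp add: val_units_def)
  then have "T.col_typ 0 x" using x by (simp add: T.col_typ_def)
  from T.gm_represents(1)[OF g A rel this x(4)] have "gm r (g *\<^sub>v x) <#\<^bsub>GSp n\<^esub> Iw n v m = C"
    by (simp only: Cg H)
  then show ?thesis using x(4) by blast
qed

text \<open>The solution from \<open>orthogonalise\<close> has first coordinate exactly 1, so it is
  also a column type for the dotted group. The congruence on \<alpha> comes with
  \<open>gm_represents\<close>.\<close>

lemma dot_represented:
  assumes rm: "r + k \<ge> m + 1" and C: "C \<in> Xset_dot n v \<sigma> \<pi> k b m r"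
  shows "\<exists>x\<in>Vd m. gm r x <#\<^bsub>GSp n\<^esub> Iw_dot n v m = C"
proof -
  interpret T: val_frob_type n k \<sigma> \<pi> b v "OneP (int m + 1)" "P (int m + 1)" "P (int m)" r by (rule type_dot[OF rm])
  have H: "T.H = Iw_dot n v m" by (rule H_dot[OF rm])
  obtain g A where g: "g \<in> carrier (GSp n)" and A: "A \<in> T.H" and rel: "b * map_mat \<sigma> g = g * (W r * A)"
    and Cg: "C = g <#\<^bsub>GSp n\<^esub> T.H"
    using C T.DL_E[of C] unfolding Xset_dot_def H by blast
  obtain c where c: "is_simil n c g" using g by (auto simp: GSp_iff)
  obtain x where x: "x \<in> Car" "x $ 0 = 1" "\<forall>i<2 * n. 0 < i \<longrightarrow> x $ i \<in> P (int m)" "g *\<^sub>v x \<in> Vs"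
    using orthogonalise[OF rm c _ rel] A H Iw_dot_Iw by blast
  have "T.col_typ 0 x" using x by (simp add: T.col_typ_def)
  from T.gm_represents[OF g A rel this x(4)]
  have "gm r (g *\<^sub>v x) <#\<^bsub>GSp n\<^esub> Iw_dot n v m = C" "g *\<^sub>v x \<in> Vd m"
    using x(4) by (simp_all only: Cg H Vd_iff simp_thms)
  then show ?thesis by blast
qed

lemma gm_Xset:
  assumes "r + k \<ge> m + 1" "w \<in> Vs"
  shows "gm r w <#\<^bsub>GSp n\<^esub> Iw n v m \<in> Xset n v \<sigma> \<pi> k b m r"
  using val_frob_type.gm_DL[OF type_Iw[OF assms(1)] assms(2) \<alpha>_ratio_units[OF assms(2)]]
  unfolding Xset_def H_Iw[OF assms(1)] .

lemma gm_Xset_dot: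
  assumes "r + k \<ge> m + 1" "w \<in> Vd m"
  shows "gm r w <#\<^bsub>GSp n\<^esub> Iw_dot n v m \<in> Xset_dot n v \<sigma> \<pi> k b m r"
proof -
  have w: "w \<in> Vs" "\<sigma> (\<alpha> w) / \<alpha> w \<in> OneP (int m + 1)" using assms by (auto simp: Vd_iff)
  show ?thesis
    using val_frob_type.gm_DL[OF type_dot[OF assms(1)] w] unfolding Xset_dot_def H_dot[OF assms(1)] .
qed

text \<open>By \<open>level_step\<close>, any vector chosen in \<open>transition\<close> yields the
  same coset at level r.\<close>

lemma transition_gm:
  assumes rm: "r + k \<ge> m + 1" and x: "x \<in> Vs"
  shows "transition n v \<sigma> \<pi> k b m r (gm (Suc r) x <#\<^bsub>GSp n\<^esub> Iw n v m) = gm r x <#\<^bsub>GSp n\<^esub> Iw n v m"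
proof -
  let ?Q = "\<lambda>y. y \<in> Vs \<and> gm (Suc r) y <#\<^bsub>GSp n\<^esub> Iw n v m = gm (Suc r) x <#\<^bsub>GSp n\<^esub> Iw n v m"
  have "?Q (SOME y. ?Q y)" by (rule someI[of ?Q x]) (use x in simp)
  then show ?thesis unfolding transition_def using level_step[OF rm _ x] by blast
qed

lemma transition_dot_gm:
  assumes rm: "r + k \<ge> m + 1" and x: "x \<in> Vd m"
  shows "transition_dot n v \<sigma> \<pi> k b m r (gm (Suc r) x <#\<^bsub>GSp n\<^esub> Iw_dot n v m) = gm r x <#\<^bsub>GSp n\<^esub> Iw_dot n v m"
proof -
  let ?Q = "\<lambda>y. y \<in> Vd m \<and> gm (Suc r) y <#\<^bsub>GSp n\<^esub> Iw_dot n v m = gm (Suc r) x <#\<^bsub>GSp n\<^esub> Iw_dot n v m"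
  have "?Q (SOME y. ?Q y)" by (rule someI[of ?Q x]) (use x in simp)
  then show ?thesis unfolding transition_dot_def using level_step_dot[OF rm _ x] by blast
qed

lemma transition_Xset:
  assumes rm: "r + k \<ge> m + 1" and C: "C \<in> Xset n v \<sigma> \<pi> k b m (Suc r)"
  shows "transition n v \<sigma> \<pi> k b m r C \<in> Xset n v \<sigma> \<pi> k b m r"
proof -
  have "Suc r + k \<ge> m + 1" using rm by simp
  from Iw_represented[OF this C] obtain x where "x \<in> Vs" "gm (Suc r) x <#\<^bsub>GSp n\<^esub> Iw n v m = C" by blast
  then show ?thesis using transition_gm[OF rm] gm_Xset[OF rm] by metis
qed

lemma transition_dot_Xset:
  assumes rm: "r + k \<ge> m + 1" and C: "C \<in> Xset_dot n v \<sigma> \<pi> k b m (Suc r)"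
  shows "transition_dot n v \<sigma> \<pi> k b m r C \<in> Xset_dot n v \<sigma> \<pi> k b m r"
proof -
  have "Suc r + k \<ge> m + 1" using rm by simp
  from dot_represented[OF this C] obtain x where "x \<in> Vd m" "gm (Suc r) x <#\<^bsub>GSp n\<^esub> Iw_dot n v m = C" by blast
  then show ?thesis using transition_dot_gm[OF rm] gm_Xset_dot[OF rm] by metis
qed

section \<open>Vectors with \<sigma>-fixed \<alpha> as parameters of X_w^(U)(b)\<close>

definition Vfix :: "'a vec set" where
  "Vfix = {w \<in> Vs. \<sigma> (\<alpha> w) = \<alpha> w}"

lemma Vfix_ratio: "w \<in> Vfix \<Longrightarrow> \<sigma> (\<alpha> w) / \<alpha> w = 1"
  using \<alpha>_nonzero by (auto simp: Vfix_def)

lemma Vfix_Vd: "w \<in> Vfix \<Longrightarrow> w \<in> Vd m"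
  using Vfix_ratio[of w] by (simp add: Vd_iff Vfix_def)

text \<open>For U the only vector of column type 0 is the first unit vector, so a coset determines
  w. Conversely the first column of a representative g already satisfies the relations: for 1 \<le>
  i < n its image under F^i has column type i, whose last coordinate is 0. Finally D = {1} forces
  \<sigma>(\<alpha>) = \<alpha>.\<close>

lemma bij_XU: "bij_betw (\<lambda>w. gm 0 w <#\<^bsub>GSp n\<^esub> Unip n) Vfix (XU n \<sigma> \<pi> k b)"
proof -
  interpret T: val_frob_type n k \<sigma> \<pi> b v "{1}" UNIV "{0}" 0 by (rule type_U)
  have H: "T.H = Unip n" by (rule H_U)
  have inj: "w = y" if w: "w \<in> Vfix" and y: "y \<in> Vfix"
    and eq: "gm 0 w <#\<^bsub>GSp n\<^esub> Unip n = gm 0 y <#\<^bsub>GSp n\<^esub> Unip n" for w y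
  proof -
    have "w \<in> Vs" "y \<in> Vs" using w y by (auto simp: Vfix_def)
    then obtain x where x: "T.col_typ 0 x" "y = gm 0 w *\<^sub>v x"
      using T.gm_coset_eqD[of w y] eq unfolding H by blast
    have "x = unit_vec (2 * n) 0" using T.col_typD[OF x(1)] n1 by (intro eq_vecI) (auto simp: unit_vec_def)
    then show "w = y" using x(2) gm_e0[OF Vs_carrier[OF \<open>w \<in> Vs\<close>]] by simp
  qed
  have mem: "gm 0 w <#\<^bsub>GSp n\<^esub> Unip n \<in> XU n \<sigma> \<pi> k b" if "w \<in> Vfix" for w
    using T.gm_DL[of w] Vfix_ratio[OF that] that unfolding XU_def H by (simp add: Vfix_def)
  have surj: "\<exists>w\<in>Vfix. C = gm 0 w <#\<^bsub>GSp n\<^esub> Unip n" if C: "C \<in> XU n \<sigma> \<pi> k b" for C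
  proof -
    obtain g A where g: "g \<in> carrier (GSp n)" and A: "A \<in> T.H" and rel: "b * map_mat \<sigma> g = g * (W 0 * A)"
      and Cg: "C = g <#\<^bsub>GSp n\<^esub> T.H"
      using C T.DL_E[of C] unfolding XU_def H by blast
    obtain c where c: "is_simil n c g" using g by (auto simp: GSp_iff)
    let ?e = "unit_vec (2 * n) 0 :: 'a vec"
    let ?w = "g *\<^sub>v ?e"
    have e: "T.col_typ 0 ?e" using n1 by (auto simp: T.col_typ_def unit_vec_def)
    have t: "T.gT g 0 ?w" unfolding T.gT_def[OF c A rel] using e by blast
    have wC: "?w \<in> Car" using is_simil_carrier[OF c] by simp
    have "sform n ?w ((F ^^ i) ?w) = 0" if i: "i \<in> {1..<n}" for i
    proof -
      have "T.gT g i ((F ^^ i) ?w)" using T.gT_Fi[OF c A rel t, of i] i by simp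
      then obtain y where y: "T.col_typ i y" "(F ^^ i) ?w = g *\<^sub>v y" unfolding T.gT_def[OF c A rel] by blast
      have yC: "y \<in> Car" using y(1) by (rule T.col_typD)
      have "i < 2 * n - 1" using i by auto
      then have "y $ (2 * n - 1) \<in> {0}" using T.col_typD(4)[OF y(1), of "2 * n - 1"] by simp
      moreover have "sform n ?e y = - y $ (2 * n - 1)" using n1 yC by (subst sform_unit_left) auto
      moreover have "sform n ?w ((F ^^ i) ?w) = c * sform n ?e y"
        unfolding y(2) by (rule sform_simil[OF c unit_vec_carrier yC])
      ultimately show ?thesis by simp
    qed
    moreover have "\<alpha> ?w \<noteq> 0" by (rule T.gT_\<alpha>_nonzero[OF c A rel t])
    ultimately have w: "?w \<in> Vs" using wC unfolding Vsymp_def alpha_def by blast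
    from T.gm_represents[OF g A rel e w] have "gm 0 ?w <#\<^bsub>GSp n\<^esub> Unip n = C" "\<sigma> (\<alpha> ?w) / \<alpha> ?w = 1"
      unfolding Cg H by auto
    moreover then have "?w \<in> Vfix" using w \<alpha>_nonzero[OF w] by (simp add: Vfix_def)
    ultimately show ?thesis by blast
  qed
  show ?thesis unfolding bij_betw_def inj_on_def using inj mem surj by blast
qed

section \<open>Convergence of vectors\<close>

definition vconv :: "(nat \<Rightarrow> 'a vec) \<Rightarrow> 'a vec \<Rightarrow> bool" where
  "vconv S x \<longleftrightarrow> (\<forall>t. S t \<in> Car) \<and> x \<in> Car \<and> (\<forall>N. \<exists>M. \<forall>t\<ge>M. \<forall>i<2 * n. S t $ i - x $ i \<in> P N)"

lemma vconv_mult: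
  assumes A: "A \<in> carrier_mat (2 * n) (2 * n)" and S: "vconv S x"
  shows "vconv (\<lambda>t. A *\<^sub>v S t) (A *\<^sub>v x)"
proof -
  have C: "S t \<in> Car" "x \<in> Car" for t using S by (auto simp: vconv_def)
  have "finite ((\<lambda>(i, l). A $$ (i, l)) ` ({..<2 * n} \<times> {..<2 * n}))" by simp
  then obtain B where "\<And>x. x \<in> (\<lambda>(i, l). A $$ (i, l)) ` ({..<2 * n} \<times> {..<2 * n}) \<Longrightarrow> x \<in> P B"
    using finite_P_bound by blast
  then have B: "A $$ (i, l) \<in> P B" if "i < 2 * n" "l < 2 * n" for i l using that by blast
  have "\<exists>M. \<forall>t\<ge>M. \<forall>i<2 * n. (A *\<^sub>v S t) $ i - (A *\<^sub>v x) $ i \<in> P N" for N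
  proof -
    obtain M where M: "\<And>t i. t \<ge> M \<Longrightarrow> i < 2 * n \<Longrightarrow> S t $ i - x $ i \<in> P (N - B)" using S unfolding vconv_def by blast
    have "(A *\<^sub>v S t) $ i - (A *\<^sub>v x) $ i \<in> P N" if t: "t \<ge> M" and i: "i < 2 * n" for t i
    proof -
      have "(A *\<^sub>v S t) $ i - (A *\<^sub>v x) $ i = (\<Sum>l<2 * n. A $$ (i, l) * (S t $ l - x $ l))"
        unfolding mult_mat_vec_sum[OF A C(1) i] mult_mat_vec_sum[OF A C(2) i] by (simp add: sum_subtractf right_diff_distrib)
      also have "\<dots> \<in> P N" by (rule P_sum, rule P_mult_le[OF B[OF i] M[OF t]]) auto
      finally show ?thesis .
    qed
    then show ?thesis by blast
  qed
  then show ?thesis unfolding vconv_def using A C by auto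
qed

lemma vconv_F:
  assumes S: "vconv S x"
  shows "vconv (\<lambda>t. F (S t)) (F x)"
  unfolding Frob_def
proof (rule vconv_mult[OF b_carrier])
  have C: "S t \<in> Car" "x \<in> Car" for t using S by (auto simp: vconv_def)
  have "map_vec \<sigma> (S t) $ i - map_vec \<sigma> x $ i \<in> P N \<longleftrightarrow> S t $ i - x $ i \<in> P N" if "i < 2 * n" for t i N
    using C(1)[of t] C(2) that by (simp add: \<sigma>_P flip: \<sigma>_diff)
  then show "vconv (\<lambda>t. map_vec \<sigma> (S t)) (map_vec \<sigma> x)" using S unfolding vconv_def by simp
qed

lemma vconv_Fi: "vconv S x \<Longrightarrow> vconv (\<lambda>t. (F ^^ i) (S t)) ((F ^^ i) x)"
  by (induction i) (auto dest: vconv_F)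

text \<open>Continuity of the form, restricted to the case by which orthogonality relations pass to
  a limit.\<close>

lemma vconv_sform_zero:
  assumes S: "vconv S x" and S': "vconv S' y" and z: "\<And>t. sform n (S t) (S' t) = 0"
  shows "sform n x y = 0"
proof (rule P_all_zero)
  fix N0 :: nat
  have C: "S t \<in> Car" "x \<in> Car" "S' t \<in> Car" "y \<in> Car" for t using S S' by (auto simp: vconv_def)
  have bd: "\<exists>B. \<forall>i<2 * n. u $ i \<in> P B" for u :: "'a vec"
  proof -
    have "finite ((\<lambda>i. u $ i) ` {..<2 * n})" by simp
    then obtain B where "\<And>c. c \<in> (\<lambda>i. u $ i) ` {..<2 * n} \<Longrightarrow> c \<in> P B"
      using finite_P_bound by blast
    then show ?thesis by blast
  qed
  obtain B1 where B1: "\<forall>i<2 * n. x $ i \<in> P B1" using bd by blast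
  obtain B2 where B2: "\<forall>i<2 * n. y $ i \<in> P B2" using bd by blast
  define B where "B = min B1 B2"
  have B: "x $ i \<in> P B" "y $ i \<in> P B" if "i < 2 * n" for i
    using that B1 B2 P_mono[of "x $ i" B1 B] P_mono[of "y $ i" B2 B] by (auto simp: B_def)
  \<comment> \<open>N >= N0 >= 0 controls the product of the two errors, N >= N0 - B the mixed terms
    in which one factor is only known to lie in p^B.\<close>
  define N where "N = max (int N0) (int N0 - B)"
  have NB: "int N0 \<le> N" "int N0 - B \<le> N" by (auto simp: N_def)
  obtain M where M: "\<And>t i. t \<ge> M \<Longrightarrow> i < 2 * n \<Longrightarrow> S t $ i - x $ i \<in> P N" using S unfolding vconv_def by blast
  obtain M' where M': "\<And>t i. t \<ge> M' \<Longrightarrow> i < 2 * n \<Longrightarrow> S' t $ i - y $ i \<in> P N" using S' unfolding vconv_def by blast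
  let ?t = "max M M'"
  have "S ?t $ i * S' ?t $ j - x $ i * y $ j \<in> P (int N0)" if ij: "i < 2 * n" "j < 2 * n" for i j
  proof -
    let ?a = "S ?t $ i - x $ i" and ?c = "S' ?t $ j - y $ j"
    have ac: "?a \<in> P N" "?c \<in> P N" using M[of ?t i] M'[of ?t j] ij by auto
    have "S ?t $ i * S' ?t $ j - x $ i * y $ j = ?a * ?c + (?a * y $ j + x $ i * ?c)" by (simp add: algebra_simps)
    also have "\<dots> \<in> P (int N0)"
      by (intro P_add P_mult_le[OF ac] P_mult_le[OF ac(1) B(2)[OF ij(2)]] P_mult_le[OF B(1)[OF ij(1)] ac(2)])
        (use NB in linarith)+
    finally show ?thesis .
  qed
  then have d: "x $ i * y $ j - S ?t $ i * S' ?t $ j \<in> P (int N0)" if "i < 2 * n" "j < 2 * n" for i j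
    using that P_diff_swap by blast
  have "sform n x y = sform n x y - sform n (S ?t) (S' ?t)" using z by simp
  also have "\<dots> = (\<Sum>i<2 * n. (- 1) ^ Suc i * (x $ i * y $ (2 * n - 1 - i) - S ?t $ i * S' ?t $ (2 * n - 1 - i)))"
    unfolding sform_sum[OF C(2,4)] sform_sum[OF C(1,3)] sum_subtractf[symmetric]
    by (intro sum.cong refl) (simp add: algebra_simps)
  also have "\<dots> \<in> P (int N0)" by (rule P_sum, unfold P_sign_mult, rule d) auto
  finally show "sform n x y \<in> P (int N0)" .
qed

end

section \<open>The inverse limit\<close>

lemma lcoset_set_mult:
  assumes K: "subgroup K (GSp n)" and L: "subgroup L (GSp n)" and KL: "K \<subseteq> L" and g: "g \<in> carrier (GSp n)"
  shows "(g <#\<^bsub>GSp n\<^esub> K) <#>\<^bsub>GSp n\<^esub> L = g <#\<^bsub>GSp n\<^esub> L"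
proof -
  interpret G: group "GSp n :: 'a mat monoid" by (rule group_GSp)
  interpret K: subgroup K "GSp n" by (rule K)
  interpret L: subgroup L "GSp n" by (rule L)
  have "K <#>\<^bsub>GSp n\<^esub> L = L"
  proof
    show "K <#>\<^bsub>GSp n\<^esub> L \<subseteq> L" using KL L.m_closed unfolding set_mult_def by blast
    show "L \<subseteq> K <#>\<^bsub>GSp n\<^esub> L"
    proof
      fix x assume x: "x \<in> L"
      then have "\<one>\<^bsub>GSp n\<^esub> \<otimes>\<^bsub>GSp n\<^esub> x \<in> K <#>\<^bsub>GSp n\<^esub> L" using K.one_closed unfolding set_mult_def by blast
      then show "x \<in> K <#>\<^bsub>GSp n\<^esub> L" using L.mem_carrier[OF x] by (simp only: G.l_one)
    qed
  qed
  then show ?thesis using G.setmult_lcos_assoc[OF K.subset L.subset g] by simp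
qed

context val_frob
begin

lemma subgroup_dot: "subgroup (Iw_dot n v m) (GSp n)"
proof -
  have r: "(m + 1) + k \<ge> m + 1" by simp
  interpret T: val_frob_type n k \<sigma> \<pi> b v "OneP (int m + 1)" "P (int m + 1)" "P (int m)" "m + 1" by (rule type_dot[OF r])
  show ?thesis using T.H_subgroup unfolding H_dot[OF r] .
qed

lemma Iw_dot_mono: "Iw_dot n v (Suc m) \<subseteq> Iw_dot n v m"
  using P_mono[of _ "int (Suc m) + 1" "int m + 1"] P_mono[of _ "int (Suc m)" "int m"]
  by (auto simp: Iw_dot_def)

text \<open>Column type 0 of the dotted group spelled out: it depends on m only, so it can be
  compared across different r.\<close>

definition dot_typ :: "nat \<Rightarrow> 'a vec \<Rightarrow> bool" where
  "dot_typ m x \<longleftrightarrow> x \<in> Car \<and> x $ 0 - 1 \<in> P (int m + 1) \<and> (\<forall>i<2 * n. 0 < i \<longrightarrow> x $ i \<in> P (int m))"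

lemma dot_typ_iff:
  assumes "r + k \<ge> m + 1"
  shows "coltype.col_typ n (OneP (int m + 1)) (P (int m + 1)) (P (int m)) 0 x \<longleftrightarrow> dot_typ m x"
proof -
  interpret T: val_frob_type n k \<sigma> \<pi> b v "OneP (int m + 1)" "P (int m + 1)" "P (int m)" r by (rule type_dot[OF assms])
  show ?thesis
  proof
    assume "T.col_typ 0 x"
    from T.col_typD[OF this] n1 show "dot_typ m x" by (auto simp: dot_typ_def)
  next
    assume "dot_typ m x"
    then show "T.col_typ 0 x" by (auto simp: T.col_typ_def dot_typ_def)
  qed
qed

lemma dot_coset_eqD:
  assumes rm: "r + k \<ge> m + 1" and w: "w \<in> Vs" and y: "y \<in> Vs"
    and eq: "gm r w <#\<^bsub>GSp n\<^esub> Iw_dot n v m = gm r y <#\<^bsub>GSp n\<^esub> Iw_dot n v m"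
  shows "\<exists>x. dot_typ m x \<and> y = gm r w *\<^sub>v x"
  using val_frob_type.gm_coset_eqD[OF type_dot[OF rm] w y] eq
  unfolding H_dot[OF rm] dot_typ_iff[OF rm] by blast

lemma dot_coset_eqI:
  assumes rm: "r + k \<ge> m + 1" and w: "w \<in> Vd m" and y: "y \<in> Vs" and x: "dot_typ m x" "y = gm r w *\<^sub>v x"
  shows "gm r w <#\<^bsub>GSp n\<^esub> Iw_dot n v m = gm r y <#\<^bsub>GSp n\<^esub> Iw_dot n v m"
proof -
  have w': "w \<in> Vs" "\<sigma> (\<alpha> w) / \<alpha> w \<in> OneP (int m + 1)" using w by (auto simp: Vd_iff)
  show ?thesis
    using val_frob_type.gm_coset_eqI[OF type_dot[OF rm] w' y _ x(2)] x(1)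
    unfolding H_dot[OF rm] dot_typ_iff[OF rm] by blast
qed

lemma dot_typ_\<alpha>:
  assumes rm: "r + k \<ge> m + 1" and w: "w \<in> Vd m" and x: "dot_typ m x"
  shows "\<alpha> (gm r w *\<^sub>v x) \<noteq> 0" "\<sigma> (\<alpha> (gm r w *\<^sub>v x)) / \<alpha> (gm r w *\<^sub>v x) - 1 \<in> P (int m + 1)"
proof -
  have w': "w \<in> Vs" "\<sigma> (\<alpha> w) / \<alpha> w \<in> OneP (int m + 1)" using w by (auto simp: Vd_iff)
  show "\<alpha> (gm r w *\<^sub>v x) \<noteq> 0" "\<sigma> (\<alpha> (gm r w *\<^sub>v x)) / \<alpha> (gm r w *\<^sub>v x) - 1 \<in> P (int m + 1)"
    using val_frob_type.gm_typ_\<alpha>[OF type_dot[OF rm] w'] x unfolding dot_typ_iff[OF rm] by blast+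
qed

lemma dot_typ_diff:
  assumes "dot_typ m x" "i < 2 * n"
  shows "x $ i - unit_vec (2 * n) 0 $ i \<in> P (int m)"
  using assms P_mono[of "x $ 0 - 1" "int m + 1" "int m"] by (cases "i = 0") (auto simp: dot_typ_def unit_vec_def)

lemma shift_diff:
  assumes "dot_typ m x" "i < 2 * n"
  shows "shift s x $ i - unit_vec (2 * n) 0 $ i \<in> P (int m)"
  using dot_typ_diff[OF assms] assms \<pi>_power_mult_P
  by (cases "i = 0") (auto simp: dot_typ_def unit_vec_def shift_def)

definition limit_map :: "'a vec \<Rightarrow> nat \<times> nat \<Rightarrow> 'a mat set" where
  "limit_map w = (\<lambda>(r, m) \<in> {(r, m). m < r}. gm r w <#\<^bsub>GSp n\<^esub> Iw_dot n v m)"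

lemma limit_map_apply: "m < r \<Longrightarrow> limit_map w (r, m) = gm r w <#\<^bsub>GSp n\<^esub> Iw_dot n v m"
  by (simp add: limit_map_def)

lemma limit_map_mem:
  assumes w: "w \<in> Vfix"
  shows "limit_map w \<in> Xdot_limit n v \<sigma> \<pi> k b"
  unfolding Xdot_limit_def
proof (intro CollectI conjI allI impI)
  have "limit_map w p \<in> (case p of (r, m) \<Rightarrow> Xset_dot n v \<sigma> \<pi> k b m r)" if p: "p \<in> {(r, m). m < r}" for p
  proof -
    obtain r m where rm: "p = (r, m)" "m < r" using p by auto
    then show ?thesis using gm_Xset_dot[of m r, OF _ Vfix_Vd[OF w]] by (simp add: limit_map_apply)
  qed
  then show "limit_map w \<in> (\<Pi>\<^sub>E (r, m) \<in> {(r, m). m < r}. Xset_dot n v \<sigma> \<pi> k b m r)"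
    unfolding limit_map_def by (intro PiE_I) (auto simp: restrict_def)
next
  fix r m :: nat assume "m < r"
  then show "transition_dot n v \<sigma> \<pi> k b m r (limit_map w (Suc r, m)) = limit_map w (r, m)"
    using transition_dot_gm[OF _ Vfix_Vd[OF w]] by (simp add: limit_map_apply)
next
  fix r m :: nat assume rm: "Suc m < r"
  have "w \<in> Vs" using w by (simp add: Vfix_def)
  from lcoset_set_mult[OF subgroup_dot[of "Suc m"] subgroup_dot[of m] Iw_dot_mono gm_GSp[OF this, of r]]
  show "limit_map w (r, Suc m) <#>\<^bsub>GSp n\<^esub> Iw_dot n v m = limit_map w (r, m)"
    using rm by (simp add: limit_map_apply)
qed

text \<open>At level (m + 1, m) the vector y is g_(b,m+1)(w) times a vector congruent to the first
  unit vector modulo p^m. Rewritten by \<open>gm_shift\<close> in the fixed basis for r = 0, the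
  coordinates of y no longer depend on m, so the congruences for all m make them equal to the unit
  vector.\<close>

lemma limit_map_inj:
  assumes w: "w \<in> Vfix" and y: "y \<in> Vfix" and eq: "limit_map w = limit_map y"
  shows "w = y"
proof -
  have V: "w \<in> Vs" "y \<in> Vs" using w y by (auto simp: Vfix_def)
  have C: "w \<in> Car" "y \<in> Car" using V Vs_carrier by auto
  let ?g = "gm 0 w" and ?e = "unit_vec (2 * n) 0 :: 'a vec"
  have ex: "\<exists>x. dot_typ m x \<and> y = ?g *\<^sub>v shift (Suc m) x" for m
  proof -
    have "gm (Suc m) w <#\<^bsub>GSp n\<^esub> Iw_dot n v m = gm (Suc m) y <#\<^bsub>GSp n\<^esub> Iw_dot n v m"
      using fun_cong[OF eq, of "(Suc m, m)"] by (simp add: limit_map_apply)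
    from dot_coset_eqD[OF _ V this] obtain x where x: "dot_typ m x" "y = gm (Suc m) w *\<^sub>v x" by auto
    then show ?thesis using gm_shift[OF C(1), of x 0 "Suc m"] by (auto simp: dot_typ_def)
  qed
  obtain x0 where x0: "y = ?g *\<^sub>v shift (Suc 0) x0" using ex[of 0] by blast
  have "shift (Suc 0) x0 = ?e"
  proof (rule eq_vecI)
    fix i assume "i < dim_vec ?e"
    then have i: "i < 2 * n" by simp
    have "shift (Suc 0) x0 $ i - ?e $ i \<in> P (int m)" for m
    proof -
      obtain x where x: "dot_typ m x" "y = ?g *\<^sub>v shift (Suc m) x" using ex by blast
      have "shift (Suc 0) x0 = shift (Suc m) x"
        by (rule is_simil_inj[OF gm_simil[OF V(1), of 0] shift_carrier shift_carrier]) (use x0 x(2) in simp)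
      then show ?thesis using shift_diff[OF x(1) i] by simp
    qed
    then show "shift (Suc 0) x0 $ i = ?e $ i" using P_all_zero[of "shift (Suc 0) x0 $ i - ?e $ i"] by simp
  qed (simp add: shift_def)
  then show "w = y" using x0 gm_e0[OF C(1)] by simp
qed

context
  fixes f assumes f: "f \<in> Xdot_limit n v \<sigma> \<pi> k b"
begin

lemma f_trans: "m < r \<Longrightarrow> transition_dot n v \<sigma> \<pi> k b m r (f (Suc r, m)) = f (r, m)"
  and f_m: "Suc m < r \<Longrightarrow> f (r, Suc m) <#>\<^bsub>GSp n\<^esub> Iw_dot n v m = f (r, m)"
  and f_mem: "m < r \<Longrightarrow> f (r, m) \<in> Xset_dot n v \<sigma> \<pi> k b m r"
  and f_ext: "\<not> m < r \<Longrightarrow> f (r, m) = undefined"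
  using f unfolding Xdot_limit_def by (auto simp: PiE_iff extensional_def)

definition represents :: "'a vec \<Rightarrow> nat \<Rightarrow> nat \<Rightarrow> bool" where
  "represents y r m \<longleftrightarrow> y \<in> Vd m \<and> gm r y <#\<^bsub>GSp n\<^esub> Iw_dot n v m = f (r, m)"

lemma represents_r: "m < r \<Longrightarrow> represents y (Suc r) m \<Longrightarrow> represents y r m"
  using transition_dot_gm[of m r y] f_trans[of m r] by (simp add: represents_def)

lemma represents_m:
  assumes "Suc m < r" "represents y r (Suc m)"
  shows "represents y r m"
proof -
  have y: "y \<in> Vs" using assms by (simp add: represents_def Vd_iff)
  show ?thesis
    using lcoset_set_mult[OF subgroup_dot[of "Suc m"] subgroup_dot[of m] Iw_dot_mono gm_GSp[OF y, of r]] f_m[OF assms(1)] assms Vd_mono[of y "Suc m" m]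
    by (simp add: represents_def)
qed

lemma represents_r_le: "m < r \<Longrightarrow> represents y (r + d) m \<Longrightarrow> represents y r m"
  by (induction d) (auto dest: represents_r[rotated])

lemma represents_m_le: "m + d < r \<Longrightarrow> represents y r (m + d) \<Longrightarrow> represents y r m"
  by (induction d) (auto dest: represents_m[rotated])

lemma represents_le:
  assumes "represents y r' m'" "m \<le> m'" "r \<le> r'" "m < r" "m' < r'"
  shows "represents y r m"
proof -
  have "represents y r' m" using represents_m_le[of m "m' - m" r' y] assms by simp
  then show ?thesis using represents_r_le[of m r y "r' - r"] assms by simp
qed

text \<open>The pairs (s + 1, s) are cofinal: a vector representing the family there represents it
  at every (r, m) with m < r \<le> s + 1.\<close>

lemma exists_representatives: "\<exists>ys. \<forall>s r m. m < r \<longrightarrow> r \<le> Suc s \<longrightarrow> represents (ys s) r m"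
proof -
  have "\<exists>y. represents y (Suc s) s" for s
    using dot_represented[OF _ f_mem[of s "Suc s"]] by (auto simp: represents_def)
  then obtain ys where ys: "\<And>s. represents (ys s) (Suc s) s" by metis
  show ?thesis
  proof (intro exI[of _ ys] allI impI)
    fix s r m assume "m < r" "r \<le> Suc s"
    then show "represents (ys s) r m" by (intro represents_le[OF ys]) auto
  qed
qed

text \<open>Successive representatives are related through bases that vary with the vector and with
  r. The estimates are therefore made for their coordinates \<xi> in one fixed basis, the columns of
  \<open>g\<close>, taken at the lowest level (1, 0).\<close>

lemma limit_map_preimage: "\<exists>w\<in>Vfix. limit_map w = f"
proof -
  obtain ys where Q: "\<And>s r m. m < r \<Longrightarrow> r \<le> Suc s \<Longrightarrow> represents (ys s) r m"
    using exists_representatives by blast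
  let ?e = "unit_vec (2 * n) 0 :: 'a vec"
  have Vd: "ys s \<in> Vd m" if "m \<le> s" for s m using Q[of m "Suc m" s] that by (simp add: represents_def)
  have Vs: "ys s \<in> Vs" for s using Vd[of 0 s] by (simp add: Vd_iff)
  have C: "ys s \<in> Car" for s using Vs Vs_carrier by blast
  have coset: "gm r (ys s) <#\<^bsub>GSp n\<^esub> Iw_dot n v m = gm r (ys t) <#\<^bsub>GSp n\<^esub> Iw_dot n v m"
    if "m < r" "r \<le> Suc s" "r \<le> Suc t" for r m s t
    using Q[OF that(1,2)] Q[OF that(1,3)] by (simp add: represents_def)
  have rel: "\<exists>x. dot_typ m x \<and> ys t = gm r (ys s) *\<^sub>v x" if "m < r" "r \<le> Suc s" "r \<le> Suc t" for r m s t
    using dot_coset_eqD[OF _ Vs Vs coset[OF that]] that(1) by simp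
  define g where "g = gm 1 (ys 0)"
  have gs: "is_simil n (- (\<pi> ^ (n * 1) * \<alpha> (ys 0))) g" unfolding g_def by (rule gm_simil[OF Vs])
  have gC: "g \<in> carrier_mat (2 * n) (2 * n)" using gs by (rule is_simil_carrier)
  have "\<exists>x. x \<in> Car \<and> ys t = g *\<^sub>v x" for t
    using rel[of 0 1 0 t] unfolding g_def dot_typ_def by auto
  then obtain \<xi> where \<xi>: "\<And>t. \<xi> t \<in> Car" "\<And>t. ys t = g *\<^sub>v \<xi> t" by metis
  \<comment> \<open>At level (s + 1, s) the two vectors differ by a vector close to the first unit
    vector. \<open>gm_shift\<close> brings this down to r = 1, and \<kappa>, the integral change of
    basis from \<open>g\<close>, preserves the estimate.\<close>
  have step: "\<xi> (Suc s) $ i - \<xi> s $ i \<in> P (int s)" if i: "i < 2 * n" for s i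
  proof -
    obtain h where h: "dot_typ s h" "ys (Suc s) = gm (Suc s) (ys s) *\<^sub>v h"
      using rel[of s "Suc s" s "Suc s"] by auto
    have "gm 1 (ys 0) <#\<^bsub>GSp n\<^esub> Iw_dot n v 0 = gm 1 (ys s) <#\<^bsub>GSp n\<^esub> Iw_dot n v 0" by (rule coset) auto
    then obtain \<kappa> where \<kappa>: "\<kappa> \<in> Iw_dot n v 0" "gm 1 (ys s) = g * \<kappa>"
      using GSp_lcoset_eq_iff[OF subgroup_dot gm_GSp[OF Vs] gm_GSp[OF Vs]] unfolding g_def by blast
    have \<kappa>C: "\<kappa> \<in> carrier_mat (2 * n) (2 * n)" using \<kappa>(1) by (auto simp: Iw_dot_def dest: GSp_carrier_mat)
    have \<kappa>0: "\<kappa> $$ (i, l) \<in> P 0" if "i < 2 * n" "l < 2 * n" for i l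
    proof -
      have "i = l \<Longrightarrow> \<kappa> $$ (i, l) - 1 \<in> P 1" "i < l \<Longrightarrow> \<kappa> $$ (i, l) \<in> P 1" "l < i \<Longrightarrow> \<kappa> $$ (i, l) \<in> P 0"
        using \<kappa>(1) that by (auto simp: Iw_dot_def)
      then show ?thesis
        using units_P[OF one_units_P[of "\<kappa> $$ (i, l)" 1], of 0] P_mono[of "\<kappa> $$ (i, l)" 1 0]
        by (cases i l rule: linorder_cases) auto
    qed
    have hC: "h \<in> Car" using h(1) by (simp add: dot_typ_def)
    have "g *\<^sub>v \<xi> (Suc s) = gm (1 + s) (ys s) *\<^sub>v h"
      unfolding \<xi>(2)[symmetric] h(2) by simp
    also have "\<dots> = g *\<^sub>v (\<kappa> *\<^sub>v shift s h)"
      unfolding gm_shift[OF C hC] \<kappa>(2) by (rule assoc_mult_mat_vec[OF gC \<kappa>C shift_carrier])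
    finally have 1: "\<xi> (Suc s) = \<kappa> *\<^sub>v shift s h"
      by (rule is_simil_inj[OF gs \<xi>(1) mult_mat_vec_carrier[OF \<kappa>C shift_carrier]])
    have "g *\<^sub>v \<xi> s = gm 1 (ys s) *\<^sub>v ?e"
      unfolding \<xi>(2)[symmetric] by (rule gm_e0[OF C, symmetric])
    also have "\<dots> = g *\<^sub>v (\<kappa> *\<^sub>v ?e)"
      unfolding \<kappa>(2) by (rule assoc_mult_mat_vec[OF gC \<kappa>C unit_vec_carrier])
    finally have 2: "\<xi> s = \<kappa> *\<^sub>v ?e"
      by (rule is_simil_inj[OF gs \<xi>(1) mult_mat_vec_carrier[OF \<kappa>C unit_vec_carrier]])
    have "\<xi> (Suc s) $ i - \<xi> s $ i = (\<Sum>l<2 * n. \<kappa> $$ (i, l) * (shift s h $ l - ?e $ l))"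
      unfolding 1 2 mult_mat_vec_sum[OF \<kappa>C shift_carrier i] mult_mat_vec_sum[OF \<kappa>C unit_vec_carrier i] by (simp add: sum_subtractf right_diff_distrib)
    also have "\<dots> \<in> P (int s)"
      using P_mult_le[OF \<kappa>0[OF i] shift_diff[OF h(1)]] by (intro P_sum) auto
    finally show ?thesis .
  qed
  have tail: "\<xi> (s + d) $ i - \<xi> s $ i \<in> P (int s)" if i: "i < 2 * n" for s d i
  proof (induction d)
    case (Suc d)
    have "\<xi> (s + Suc d) $ i - \<xi> s $ i = (\<xi> (Suc (s + d)) $ i - \<xi> (s + d) $ i) + (\<xi> (s + d) $ i - \<xi> s $ i)" by simp
    also have "\<dots> \<in> P (int s)" using Suc P_mono[OF step[OF i, of "s + d"], of "int s"] by (intro P_add) auto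
    finally show ?case .
  qed simp
  have "\<exists>x. \<forall>N. \<exists>M. \<forall>t\<ge>M. \<xi> t $ i - x \<in> P N" if i: "i < 2 * n" for i
  proof (rule complete[unfolded val_complete_def, rule_format])
    fix N :: int
    have "\<xi> a $ i - \<xi> c $ i \<in> P N" if "a \<ge> nat N" "c \<ge> nat N" for a c
    proof -
      have "\<xi> a $ i - \<xi> (nat N) $ i \<in> P N" if "a \<ge> nat N" for a
        using tail[OF i, of "nat N" "a - nat N"] that P_mono[of _ "int (nat N)" N] by simp
      from P_diff[OF this[OF that(1)] this[OF that(2)]] show ?thesis by simp
    qed
    then show "\<exists>M. \<forall>a\<ge>M. \<forall>c\<ge>M. \<xi> a $ i - \<xi> c $ i \<in> P N" by blast
  qed
  then obtain x where x: "\<And>i N. i < 2 * n \<Longrightarrow> \<exists>M. \<forall>t\<ge>M. \<xi> t $ i - x i \<in> P N" by metis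
  define z where "z = vec (2 * n) x"
  have zC: "z \<in> Car" by (simp add: z_def)
  have conv: "vconv \<xi> z"
  proof -
    have "\<xi> t $ i - z $ i \<in> P N" if t: "t \<ge> nat N" and i: "i < 2 * n" for t i N
    proof -
      obtain M where M: "\<And>t. t \<ge> M \<Longrightarrow> \<xi> t $ i - x i \<in> P N" using x[OF i] by blast
      have "\<xi> (t + M) $ i - \<xi> t $ i \<in> P N" using P_mono[OF tail[OF i, of t M], of N] t by simp
      from P_diff[OF M[of "t + M"] this] show ?thesis using i by (simp add: z_def)
    qed
    then show ?thesis unfolding vconv_def using \<xi>(1) zC by blast
  qed
  define y where "y = g *\<^sub>v z"
  have yC: "y \<in> Car" using gC zC by (simp add: y_def)
  have ysf: "ys = (\<lambda>t. g *\<^sub>v \<xi> t)" using \<xi>(2) by (rule ext)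
  have convy: "vconv ys y" unfolding y_def ysf by (rule vconv_mult[OF gC conv])
  \<comment> \<open>The type condition is insensitive to errors in p^(m+1). For large t the vector
    \<open>ys t\<close> has this type relative to \<open>ys r\<close> by equality of cosets, and y
    is close enough to inherit it.\<close>
  have dt: "\<exists>\<eta>. dot_typ m \<eta> \<and> y = gm r (ys r) *\<^sub>v \<eta>" if rm: "m < r" for r m
  proof -
    let ?G = "gm r (ys r)"
    obtain c where Gs: "is_simil n c ?G" using gm_simil[OF Vs] by blast
    let ?M = "sinv n c ?G"
    have My: "?M *\<^sub>v (?G *\<^sub>v u) = u" if "u \<in> Car" for u
      using assoc_mult_mat_vec[OF sinv_carrier[of n c ?G] is_simil_carrier[OF Gs] that] that by (simp add: sinv_left[OF Gs])
    have cM: "vconv (\<lambda>t. ?M *\<^sub>v ys t) (?M *\<^sub>v y)" by (rule vconv_mult[OF sinv_carrier convy])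
    obtain N where N: "\<And>t i. t \<ge> N \<Longrightarrow> i < 2 * n \<Longrightarrow> (?M *\<^sub>v ys t) $ i - (?M *\<^sub>v y) $ i \<in> P (int m + 1)"
      using cM unfolding vconv_def by blast
    let ?t = "max N r"
    have "r \<le> Suc r" "r \<le> Suc ?t" by (simp_all add: le_SucI)
    from rel[OF rm this] obtain h where h: "dot_typ m h" "ys ?t = ?G *\<^sub>v h" by blast
    have hC: "h \<in> Car" using h(1) by (simp add: dot_typ_def)
    have d: "h $ i - (?M *\<^sub>v y) $ i \<in> P (int m + 1)" if "i < 2 * n" for i
      using N[of ?t i] that unfolding h(2) My[OF hC] by simp
    have MC: "?M *\<^sub>v y \<in> Car" by (rule mult_mat_vec_carrier[OF sinv_carrier yC])
    have "(?M *\<^sub>v y) $ 0 - 1 = (h $ 0 - 1) - (h $ 0 - (?M *\<^sub>v y) $ 0)" by simp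
    then have "(?M *\<^sub>v y) $ 0 - 1 \<in> P (int m + 1)" using P_diff[OF _ d[of 0]] h(1) n1 by (simp only: dot_typ_def)
    moreover have "(?M *\<^sub>v y) $ i \<in> P (int m)" if "i < 2 * n" "0 < i" for i
    proof -
      have "(?M *\<^sub>v y) $ i = h $ i - (h $ i - (?M *\<^sub>v y) $ i)" by simp
      moreover have "h $ i \<in> P (int m)" using h(1) that by (simp add: dot_typ_def)
      ultimately show ?thesis using P_diff[OF _ P_mono[OF d[OF that(1)], of "int m"]] by (metis add_increasing2 order_refl zero_le_one)
    qed
    ultimately have "dot_typ m (?M *\<^sub>v y)" using MC by (simp add: dot_typ_def)
    moreover have "?G *\<^sub>v (?M *\<^sub>v y) = y"
      using assoc_mult_mat_vec[OF is_simil_carrier[OF Gs] sinv_carrier[of n c ?G] yC] yC by (simp add: sinv_right[OF Gs])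
    ultimately show ?thesis by metis
  qed
  have "sform n y ((F ^^ i) y) = 0" if i: "i \<in> {1..<n}" for i
  proof (rule vconv_sform_zero[OF convy vconv_Fi[OF convy]])
    fix t
    show "sform n (ys t) ((F ^^ i) (ys t)) = 0" using Vs[of t] i unfolding Vsymp_def by blast
  qed
  \<comment> \<open>Nonvanishing does not pass to limits. It is read off from the type of y relative
    to a representative, and the same comparison gives the congruence for every m, hence
    \<sigma>(\<alpha> y) = \<alpha> y.\<close>
  moreover have ratio: "\<alpha> y \<noteq> 0" "\<sigma> (\<alpha> y) / \<alpha> y - 1 \<in> P (int m + 1)" for m
  proof -
    obtain \<eta> where \<eta>: "dot_typ m \<eta>" "y = gm (Suc m) (ys (Suc m)) *\<^sub>v \<eta>" using dt[of m "Suc m"] by auto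
    show "\<alpha> y \<noteq> 0" "\<sigma> (\<alpha> y) / \<alpha> y - 1 \<in> P (int m + 1)"
      using dot_typ_\<alpha>[OF _ Vd \<eta>(1), of "Suc m" "Suc m"] unfolding \<eta>(2) by auto
  qed
  ultimately have yV: "y \<in> Vs" using yC unfolding Vsymp_def alpha_def by blast
  have "\<sigma> (\<alpha> y) / \<alpha> y - 1 \<in> P (int m)" for m using P_mono[OF ratio(2)[of m], of "int m"] by simp
  then have "\<sigma> (\<alpha> y) / \<alpha> y - 1 = 0" by (rule P_all_zero)
  then have yfix: "y \<in> Vfix" using yV ratio(1) by (simp add: Vfix_def)
  have "limit_map y (r, m) = f (r, m)" for r m
  proof (cases "m < r")
    case True
    obtain \<eta> where \<eta>: "dot_typ m \<eta>" "y = gm r (ys r) *\<^sub>v \<eta>" using dt[OF True] by auto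
    have "gm r (ys r) <#\<^bsub>GSp n\<^esub> Iw_dot n v m = gm r y <#\<^bsub>GSp n\<^esub> Iw_dot n v m"
      by (rule dot_coset_eqI[OF _ Vd yV \<eta>]) (use True in auto)
    then show ?thesis using Q[OF True, of r] True by (simp add: limit_map_apply represents_def)
  next
    case False
    then show ?thesis using f_ext[OF False] by (simp add: limit_map_def)
  qed
  then have "limit_map y = f" by (intro ext) auto
  then show ?thesis using yfix by blast
qed

end

lemma bij_limit: "bij_betw limit_map Vfix (Xdot_limit n v \<sigma> \<pi> k b)"
  unfolding bij_betw_def inj_on_def
  using limit_map_inj limit_map_mem limit_map_preimage by blast

end

section \<open>The base change of the data over the local field\<close>

text \<open>K is an unramified extension of itself, spanned by 1. This places the image of K inside
  the domain on which \<open>\<iota>\<close> is known to be a homomorphism.\<close>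

lemma to_ac_finite_unramified:
  fixes v :: "'k::field \<Rightarrow> int"
  assumes "discrete_valuation_on UNIV v"
  shows "finite_unramified v (range to_ac)"
proof -
  define w where "w = v \<circ> the_inv (to_ac :: 'k \<Rightarrow> 'k alg_closure)"
  have inj: "inj (to_ac :: 'k \<Rightarrow> 'k alg_closure)" by (auto simp: inj_def)
  have w: "w (to_ac x) = v x" for x unfolding w_def using inj by (simp add: the_inv_f_f)
  have nz: "v ` (UNIV - {0}) = UNIV" using assms by (simp add: discrete_valuation_on_def)
  have im: "w ` (range to_ac - {0}) = v ` (UNIV - {0})"
  proof
    show "w ` (range to_ac - {0}) \<subseteq> v ` (UNIV - {0})" using w by auto
    show "v ` (UNIV - {0}) \<subseteq> w ` (range to_ac - {0})"
    proof
      fix j assume "j \<in> v ` (UNIV - {0})"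
      then obtain x where "x \<noteq> 0" "j = v x" by auto
      then show "j \<in> w ` (range to_ac - {0})" by (intro image_eqI[of _ _ "to_ac x"]) (auto simp: w)
    qed
  qed
  have "discrete_valuation_on (range to_ac) w"
    unfolding discrete_valuation_on_def
  proof (intro conjI ballI impI)
    fix x y :: "'k alg_closure" assume "x \<in> range to_ac - {0}" "y \<in> range to_ac - {0}"
    then obtain a c where ac: "x = to_ac a" "y = to_ac c" "a \<noteq> 0" "c \<noteq> 0" by auto
    show "w (x * y) = w x + w y"
      using assms ac unfolding discrete_valuation_on_def by (simp add: w flip: to_ac_mult)
    assume "x + y \<noteq> 0"
    then have "a + c \<noteq> 0" using ac by (metis to_ac_0 to_ac_add)
    then show "min (w x) (w y) \<le> w (x + y)"
      using assms ac unfolding discrete_valuation_on_def by (simp add: w flip: to_ac_add)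
  qed (simp add: im nz)
  moreover have "range (to_ac :: 'k \<Rightarrow> 'k alg_closure) = {\<Sum>\<beta>\<in>{1}. to_ac (c \<beta>) * \<beta> | c. True}" (is "_ = ?R")
  proof
    show "range (to_ac :: 'k \<Rightarrow> 'k alg_closure) \<subseteq> ?R" by (auto intro!: exI[of _ "\<lambda>_. _"])
    show "?R \<subseteq> range (to_ac :: 'k \<Rightarrow> 'k alg_closure)" by auto
  qed
  ultimately show ?thesis unfolding finite_unramified_def
  proof (intro conjI ballI)
    fix x y :: "'k alg_closure" assume "x \<in> range to_ac" "y \<in> range to_ac"
    then obtain a c where "x = to_ac a" "y = to_ac c" by auto
    then show "x - y \<in> range to_ac" "x * y \<in> range to_ac" by (auto simp flip: to_ac_diff to_ac_mult)
  next
    fix x :: "'k alg_closure" assume "x \<in> range to_ac"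
    then show "inverse x \<in> range to_ac" by (auto simp flip: to_ac_inverse)
  next
    assume R: "range (to_ac :: 'k \<Rightarrow> 'k alg_closure) = {\<Sum>\<beta>\<in>{1}. to_ac (c \<beta>) * \<beta> | c. True}"
    show "\<exists>B. finite B \<and> range (to_ac :: 'k \<Rightarrow> 'k alg_closure) = {\<Sum>\<beta>\<in>B. to_ac (c \<beta>) * \<beta> | c. True}"
      by (rule exI[of _ "{1}"], rule conjI, simp, rule R)
  next
    assume "discrete_valuation_on (range to_ac) w"
    then show "\<exists>w. discrete_valuation_on (range to_ac) w \<and> (\<forall>x. x \<noteq> 0 \<longrightarrow> w (to_ac x) = v x)" using w by blast
  qed simp
qed

lemma is_simil_map_hom:
  fixes h :: "'k::field \<Rightarrow> 'a::field"
  assumes h: "semiring_hom h" "inj h" and g: "is_simil n c g"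
  shows "is_simil n (h c) (map_mat h g)"
proof -
  interpret h: semiring_hom h by (rule h)
  have m1: "h (- 1) = - 1"
  proof -
    have "h 1 + h (- 1) = 0" by (simp only: h.hom_add[symmetric]) simp
    then show ?thesis by (simp add: eq_neg_iff_add_eq_0 add.commute)
  qed
  have pw: "h ((- 1) ^ i) = (- 1) ^ i" for i by (induction i) (simp_all only: power_0 power_Suc h.hom_mult m1 h.hom_one)
  have sm: "h (sum f A) = (\<Sum>i\<in>A. h (f i))" for f and A :: "nat set"
    by (induction A rule: infinite_finite_induct) (auto simp: h.hom_add)
  have gC: "g \<in> carrier_mat (2 * n) (2 * n)" using g by (rule is_simil_carrier)
  show ?thesis
  proof (rule is_similI)
    have "h c \<noteq> h 0" using is_simil_nonzero[OF g] h(2) by (auto simp: inj_def)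
    then show "h c \<noteq> 0" by simp
    show "map_mat h g \<in> carrier_mat (2 * n) (2 * n)" using gC by simp
    fix i j assume ij: "i < 2 * n" "j < 2 * n"
    have C: "col g i \<in> carrier_vec (2 * n)" "col g j \<in> carrier_vec (2 * n)"
      "col (map_mat h g) i \<in> carrier_vec (2 * n)" "col (map_mat h g) j \<in> carrier_vec (2 * n)"
      using ij gC by (auto intro!: col_carrier_vec)
    have e: "h ((- 1) ^ Suc l * col g i $ l * col g j $ (2 * n - 1 - l))
        = (- 1) ^ Suc l * col (map_mat h g) i $ l * col (map_mat h g) j $ (2 * n - 1 - l)" if "l < 2 * n" for l
      unfolding h.hom_mult pw using that ij gC by simp
    have "sform n (col (map_mat h g) i) (col (map_mat h g) j) = h (sform n (col g i) (col g j))"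
      unfolding sform_sum[OF C(1,2)] sform_sum[OF C(3,4)] sm using e by (intro sum.cong) auto
    also have "\<dots> = h c * (if i + j = 2 * n - 1 then (- 1) ^ j else 0)"
      unfolding is_simil_gram[OF g ij] by (simp add: h.hom_mult pw)
    finally show "sform n (col (map_mat h g) i) (col (map_mat h g) j) = h c * (if i + j = 2 * n - 1 then (- 1) ^ j else 0)" .
  qed
qed

text \<open>Since \<pi> and b come from K, \<sigma> fixes \<pi> and the similitude factor -\<pi>^k
  of b is obtained by transport along the embedding of K; both are demanded by
  \<open>symp_frob\<close>.\<close>

lemma val_frob_base_change:
  fixes vK :: "'k::field \<Rightarrow> int" and vL :: "'a::field \<Rightarrow> int"
    and \<iota> :: "'k alg_closure \<Rightarrow> 'a" and \<sigma> :: "'a \<Rightarrow> 'a" and \<pi>\<^sub>K :: 'k and \<pi> :: 'a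
    and b\<^sub>K :: "'k mat" and b :: "'a mat" and n k :: nat
  assumes "local_field vK" and cmu: "completed_max_unramified vK vL \<iota>" and fr: "frobenius vK vL \<iota> \<sigma>"
    and "\<pi>\<^sub>K \<noteq> 0" "vK \<pi>\<^sub>K = 1" "\<pi> = \<iota> (to_ac \<pi>\<^sub>K)"
    and n: "n \<ge> 1" and "k \<in> {0, 1}"
    and bK: "b\<^sub>K \<in> carrier (GSp n)" "simil n b\<^sub>K = - (\<pi>\<^sub>K ^ k)" "b = map_mat (\<lambda>x. \<iota> (to_ac x)) b\<^sub>K"
    and "basic n \<sigma> \<pi> b"
  shows "val_frob n k \<sigma> \<pi> b vL"
proof -
  define h where "h x = \<iota> (to_ac x)" for x
  have "to_ac x \<in> max_unramified vK" for x
    using assms(1) to_ac_finite_unramified[of vK] by (auto simp: max_unramified_def local_field_def)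
  then have add: "h (x + y) = h x + h y" and mult: "h (x * y) = h x * h y" for x y
    using cmu by (auto simp: h_def completed_max_unramified_def to_ac_add to_ac_mult)
  have h1: "h 1 = 1" using cmu by (simp add: h_def completed_max_unramified_def)
  have h0: "h 0 = 0" using add[of 0 0] by (metis add_0 add_cancel_right_right)
  have hom: "semiring_hom h" by unfold_locales (rule add mult h1 h0)+
  have vL: "vL (h x) = vK x" if "x \<noteq> 0" for x using cmu that by (simp add: h_def completed_max_unramified_def)
  have nz: "h x \<noteq> 0" if "x \<noteq> 0" for x
  proof
    assume "h x = 0"
    then show False using mult[of x "inverse x"] h1 that by (metis mult_zero_left right_inverse zero_neq_one)
  qed
  have neg: "h (- x) = - h x" for x
    using add[of x "- x"] h0 by (simp add: eq_neg_iff_add_eq_0 add.commute)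
  have inj: "inj h"
  proof (rule injI)
    fix x y assume "h x = h y"
    then have "h (x - y) = 0" using add[of x "- y"] by (simp add: neg)
    then show "x = y" using nz[of "x - y"] by auto
  qed
  have pw: "h (x ^ i) = h x ^ i" for x i by (induction i) (auto simp: h1 mult)
  have bs: "is_simil n (- (\<pi> ^ k)) b"
  proof -
    have "is_simil n (- (\<pi>\<^sub>K ^ k)) b\<^sub>K" using is_simil_simil[OF n bK(1)] bK(2) by simp
    from is_simil_map_hom[OF hom inj this] have "is_simil n (- (h \<pi>\<^sub>K ^ k)) (map_mat h b\<^sub>K)"
      unfolding neg pw .
    moreover have "h = (\<lambda>x. \<iota> (to_ac x))" by (rule ext) (rule h_def)
    ultimately show ?thesis by (simp only: assms(6) bK(3))
  qed
  have \<sigma>: "bij \<sigma>" "\<sigma> 1 = 1" "\<And>x y. \<sigma> (x + y) = \<sigma> x + \<sigma> y" "\<And>x y. \<sigma> (x * y) = \<sigma> x * \<sigma> y"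
    "\<And>x. \<sigma> (h x) = h x" "\<And>x. x \<noteq> 0 \<Longrightarrow> vL (\<sigma> x) = vL x"
    using fr by (auto simp: h_def frobenius_def)
  have "\<pi> \<noteq> 0" "\<sigma> \<pi> = \<pi>" "vL \<pi> = 1" using assms(4-6) nz[of \<pi>\<^sub>K] \<sigma>(5)[of \<pi>\<^sub>K] vL[of \<pi>\<^sub>K] by (simp_all add: h_def)
  moreover have "discrete_valuation_on UNIV vL" "val_complete vL"
    using cmu by (auto simp: completed_max_unramified_def)
  ultimately show ?thesis
    using n \<sigma> bs assms(8) assms(12) by unfold_locales blast+
qed

theorem mainTheorem4:
  fixes vK :: "'k::field \<Rightarrow> int"
    and vL :: "'a::field \<Rightarrow> int"
    and \<iota> :: "'k alg_closure \<Rightarrow> 'a"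
    and \<sigma> :: "'a \<Rightarrow> 'a"
    and \<pi>\<^sub>K :: 'k and \<pi> :: 'a
    and b\<^sub>K :: "'k mat" and b :: "'a mat"
    and n k :: nat
  assumes "local_field vK"
    and "completed_max_unramified vK vL \<iota>"
    and "frobenius vK vL \<iota> \<sigma>"
    and "\<pi>\<^sub>K \<noteq> 0" "vK \<pi>\<^sub>K = 1" "\<pi> = \<iota> (to_ac \<pi>\<^sub>K)"
    and "n \<ge> 1" "k \<in> {0, 1}"
    and "b\<^sub>K \<in> carrier (GSp n)" "simil n b\<^sub>K = - (\<pi>\<^sub>K ^ k)" "b = map_mat (\<lambda>x. \<iota> (to_ac x)) b\<^sub>K"
    and "basic n \<sigma> \<pi> b"
  shows "(\<forall>r m. r + k \<ge> m + 1 \<longrightarrow>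
            (\<forall>x\<in>Vsymp n \<sigma> b. \<forall>y\<in>Vsymp n \<sigma> b.
               rel_level n vL \<sigma> \<pi> k b m (r + 1) x y \<longrightarrow> rel_level n vL \<sigma> \<pi> k b m r x y) \<and>
            (\<forall>x\<in>Vsymp_dot n vL \<sigma> b m. \<forall>y\<in>Vsymp_dot n vL \<sigma> b m.
               rel_level_dot n vL \<sigma> \<pi> k b m (r + 1) x y \<longrightarrow> rel_level_dot n vL \<sigma> \<pi> k b m r x y) \<and>
            transition n vL \<sigma> \<pi> k b m r \<in> Xset n vL \<sigma> \<pi> k b m (r + 1) \<rightarrow> Xset n vL \<sigma> \<pi> k b m r \<and>
            (\<forall>x\<in>Vsymp n \<sigma> b.
               transition n vL \<sigma> \<pi> k b m r (gmat n \<sigma> \<pi> k b (r + 1) x <#\<^bsub>GSp n\<^esub> Iw n vL m)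
                 = gmat n \<sigma> \<pi> k b r x <#\<^bsub>GSp n\<^esub> Iw n vL m) \<and>
            transition_dot n vL \<sigma> \<pi> k b m r
              \<in> Xset_dot n vL \<sigma> \<pi> k b m (r + 1) \<rightarrow> Xset_dot n vL \<sigma> \<pi> k b m r \<and>
            (\<forall>x\<in>Vsymp_dot n vL \<sigma> b m.
               transition_dot n vL \<sigma> \<pi> k b m r (gmat n \<sigma> \<pi> k b (r + 1) x <#\<^bsub>GSp n\<^esub> Iw_dot n vL m)
                 = gmat n \<sigma> \<pi> k b r x <#\<^bsub>GSp n\<^esub> Iw_dot n vL m)) \<and>
         (\<exists>\<Phi>. bij_betw \<Phi> (Xdot_limit n vL \<sigma> \<pi> k b) (XU n \<sigma> \<pi> k b))"
proof -
  interpret val_frob n k \<sigma> \<pi> b vL by (rule val_frob_base_change[OF assms])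
  \<comment> \<open>A compatible family is sent to the vector that defines it, and this vector to
    its U-coset at r = 0, as w = w_0.\<close>
  have "bij_betw ((\<lambda>w. gm 0 w <#\<^bsub>GSp n\<^esub> Unip n) \<circ> inv_into Vfix limit_map)
      (Xdot_limit n vL \<sigma> \<pi> k b) (XU n \<sigma> \<pi> k b)"
    by (rule bij_betw_trans[OF bij_betw_inv_into[OF bij_limit] bij_XU])
  then show ?thesis
    unfolding rel_level_def rel_level_dot_def
    by (intro conjI allI impI ballI funcsetI exI[of _ "_ \<circ> _"])
      ((rule level_step[unfolded Suc_eq_plus1] level_step_dot[unfolded Suc_eq_plus1]
        transition_Xset[unfolded Suc_eq_plus1] transition_gm[unfolded Suc_eq_plus1]
        transition_dot_Xset[unfolded Suc_eq_plus1] transition_dot_gm[unfolded Suc_eq_plus1])?; assumption)+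
qed

end
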